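(* (Embedding Lemma.) Let $n\in\mathbb N$ and let $\alpha$ be an s-tensor norm of order $n$ which is finitely generated or cofinitely generated. Then, for every normed space $E$, the natural mapping $$\otimes^{n,s}\kappa_E:\otimes^{n,s}_\alpha E\longrightarrow\otimes^{n,s}_\alpha E''$$ is an isometry.
   Context: Normed spaces are over $\mathbb K=\mathbb R$ or $\mathbb C$. $\kappa_E:E\to E''$ is the canonical embedding. $FIN(E)$ is the set of finite dimensional subspaces of $E$, $COFIN(E)$ the set of closed finite codimensional subspaces, and for $L\in COFIN(E)$, $Q_L^E:E\to E/L$ is the canonical quotient map. "Isometry" means norm preserving (not necessarily surjective). $\otimes^{n,s}E$ is the linear span in $\otimes^nE$ of the elements $\otimes^n x=x\otimes\cdots\otimes x$, $x\in E$. For a continuous linear $T:E\to F$, $\otimes^{n,s}T:\otimes^{n,s}E\to\otimes^{n,s}F$ is the linear map with $\otimes^n x\mapsto\otimes^n(Tx)$. For $z\in\otimes^{n,s}E$: $\pi_s(z)=\inf\{\sum_j|\lambda_j|\|x_j\|^n\}$ over all representations $z=\sum_{j=1}^r\lambda_j\otimes^n x_j$, and $\varepsilon_s(z)=\sup_{x'\in B_{E'}}|\sum_j\lambda_j x'(x_j)^n|$ for any such representation. An s-tensor norm $\alpha$ of order $n$ assigns to each normed space $E$ a norm $\alpha(\,\cdot\,;\otimes^{n,s}E)$ on $\otimes^{n,s}E$ such that (1) $\varepsilon_s\le\alpha\le\pi_s$ and (2) $\|\otimes^{n,s}T:\otimes^{n,s}_\alpha E\to\otimes^{n,s}_\alpha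 F\|\le\|T\|^n$ for every continuous linear $T:E\to F$; here $\otimes^{n,s}_\alpha E$ is $\otimes^{n,s}E$ with this norm. $\alpha$ is finitely generated if for every normed $E$ and $z\in\otimes^{n,s}E$, $\alpha(z;\otimes^{n,s}E)=\inf\{\alpha(z;\otimes^{n,s}M):M\in FIN(E),\ z\in\otimes^{n,s}M\}$. $\alpha$ is cofinitely generated if for every normed $E$ and $z\in\otimes^{n,s}E$, $\alpha(z;\otimes^{n,s}E)=\sup\{\alpha((\otimes^{n,s}Q_L^E)(z);\otimes^{n,s}E/L):L\in COFIN(E)\}$. *)

theory Defs
  imports "HOL-Analysis.Analysis"
begin

section \<open>Scalars\<close>

text \<open>The scalar field is \<open>\<real>\<close> or \<open>\<complex>\<close>, with its usual absolute value.\<close>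

class real_or_complex = real_normed_field +
  assumes real_or_complex:
    "(\<forall>x. \<exists>a. x = a *\<^sub>R 1) \<or>
     (\<exists>i. i * i = - 1 \<and>
        (\<forall>x. \<exists>a b. x = a *\<^sub>R 1 + b *\<^sub>R i \<and> norm x = sqrt (a\<^sup>2 + b\<^sup>2)))"

instance real :: real_or_complex
  by standard auto

instance complex :: real_or_complex
proof
  have "\<exists>a b. x = a *\<^sub>R 1 + b *\<^sub>R \<i> \<and> norm x = sqrt (a\<^sup>2 + b\<^sup>2)" for x :: complex
    by (rule exI[of _ "Re x"], rule exI[of _ "Im x"])
       (simp add: complex_eq_iff cmod_def)
  then show "(\<forall>x::complex. \<exists>a. x = a *\<^sub>R 1) \<or>
     (\<exists>i::complex. i * i = - 1 \<and>
        (\<forall>x. \<exists>a b. x = a *\<^sub>R 1 + b *\<^sub>R i \<and> norm x = sqrt (a\<^sup>2 + b\<^sup>2)))"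
    by (intro disjI2 exI[of _ \<i>]) auto
qed


section \<open>Vector spaces and normed spaces with explicit carrier\<close>

text \<open>
  An s-tensor norm is a function of a normed space, and its axioms quantify over all normed
  spaces. Normed spaces therefore have to be objects, not types: they are records whose
  carrier is a subset of a type \<open>'u\<close>. This type plays the role of a universe of
  points and is arbitrary (a type variable) throughout. The values of the operations
  outside the carrier are irrelevant.
\<close>

record ('u, 'k) vspace =
  carr :: "'u set"
  vadd :: "'u \<Rightarrow> 'u \<Rightarrow> 'u"
  vzero :: "'u"
  vsmul :: "'k \<Rightarrow> 'u \<Rightarrow> 'u"

record ('u, 'k) nspace = "('u, 'k) vspace" +
  vnorm :: "'u \<Rightarrow> real"

locale lin_space =
  fixes V :: "('u, 'k :: real_or_complex, 'm) vspace_scheme"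
  assumes add_closed: "x \<in> carr V \<Longrightarrow> y \<in> carr V \<Longrightarrow> vadd V x y \<in> carr V"
    and zero_closed: "vzero V \<in> carr V"
    and smul_closed: "x \<in> carr V \<Longrightarrow> vsmul V c x \<in> carr V"
    and add_assoc: "x \<in> carr V \<Longrightarrow> y \<in> carr V \<Longrightarrow> z \<in> carr V \<Longrightarrow>
          vadd V (vadd V x y) z = vadd V x (vadd V y z)"
    and add_commute: "x \<in> carr V \<Longrightarrow> y \<in> carr V \<Longrightarrow> vadd V x y = vadd V y x"
    and add_zero: "x \<in> carr V \<Longrightarrow> vadd V x (vzero V) = x"
    and add_inverse: "x \<in> carr V \<Longrightarrow> \<exists>y\<in>carr V. vadd V x y = vzero V"
    and smul_add_right: "x \<in> carr V \<Longrightarrow> y \<in> carr V \<Longrightarrow>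
          vsmul V c (vadd V x y) = vadd V (vsmul V c x) (vsmul V c y)"
    and smul_add_left: "x \<in> carr V \<Longrightarrow>
          vsmul V (c + d) x = vadd V (vsmul V c x) (vsmul V d x)"
    and smul_smul: "x \<in> carr V \<Longrightarrow> vsmul V (c * d) x = vsmul V c (vsmul V d x)"
    and smul_one: "x \<in> carr V \<Longrightarrow> vsmul V 1 x = x"

locale normed_space = lin_space E
  for E :: "('u, 'k :: real_or_complex) nspace" +
  assumes norm_nonneg: "x \<in> carr E \<Longrightarrow> 0 \<le> vnorm E x"
    and norm_eq_zero: "x \<in> carr E \<Longrightarrow> vnorm E x = 0 \<longleftrightarrow> x = vzero E"
    and norm_smul: "x \<in> carr E \<Longrightarrow> vnorm E (vsmul E c x) = norm c * vnorm E x"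
    and norm_triangle: "x \<in> carr E \<Longrightarrow> y \<in> carr E \<Longrightarrow>
          vnorm E (vadd E x y) \<le> vnorm E x + vnorm E y"

definition vdiff :: "('u, 'k :: real_or_complex, 'm) vspace_scheme \<Rightarrow> 'u \<Rightarrow> 'u \<Rightarrow> 'u"
  where "vdiff V x y = vadd V x (vsmul V (- 1) y)"

fun lincomb :: "('u, 'k, 'm) vspace_scheme \<Rightarrow> ('k \<times> 'u) list \<Rightarrow> 'u" where
  "lincomb V [] = vzero V"
| "lincomb V ((c, x) # R) = vadd V (vsmul V c x) (lincomb V R)"

definition lspan :: "('u, 'k, 'm) vspace_scheme \<Rightarrow> 'u set \<Rightarrow> 'u set"
  where "lspan V B = {lincomb V R | R. snd ` set R \<subseteq> B}"

definition finite_dim :: "('u, 'k, 'm) vspace_scheme \<Rightarrow> bool"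
  where "finite_dim V \<longleftrightarrow> (\<exists>B. finite B \<and> B \<subseteq> carr V \<and> lspan V B = carr V)"

definition lin_subspace :: "('u, 'k, 'm) vspace_scheme \<Rightarrow> 'u set \<Rightarrow> bool"
  where "lin_subspace V M \<longleftrightarrow> M \<subseteq> carr V \<and> vzero V \<in> M \<and>
    (\<forall>x\<in>M. \<forall>y\<in>M. vadd V x y \<in> M) \<and> (\<forall>c. \<forall>x\<in>M. vsmul V c x \<in> M)"

abbreviation restrict_space_to :: "('u, 'k) nspace \<Rightarrow> 'u set \<Rightarrow> ('u, 'k) nspace"
  where "restrict_space_to E M \<equiv> E\<lparr>carr := M\<rparr>"

definition closed_in_space :: "('u, 'k :: real_or_complex) nspace \<Rightarrow> 'u set \<Rightarrow> bool"
  where "closed_in_space E L \<longleftrightarrow>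
    (\<forall>x\<in>carr E. (\<forall>\<delta>>0. \<exists>y\<in>L. vnorm E (vdiff E x y) < \<delta>) \<longrightarrow> x \<in> L)"

text \<open>The transport of the structure of \<open>X\<close> along a map that is injective on the carrier of
  \<open>X\<close>: an isometric copy of \<open>X\<close> inside another type.\<close>

definition copy_along :: "('u \<Rightarrow> 'v) \<Rightarrow> ('u, 'k) nspace \<Rightarrow> ('v, 'k) nspace"
  where "copy_along e X = (let d = inv_into (carr X) e in
    \<lparr>carr = e ` carr X,
     vadd = (\<lambda>a b. e (vadd X (d a) (d b))),
     vzero = e (vzero X),
     vsmul = (\<lambda>c a. e (vsmul X c (d a))),
     vnorm = (\<lambda>a. vnorm X (d a))\<rparr>)"


section \<open>Operators, dual, bidual, quotients\<close>

definition linear_map ::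
  "('u, 'k, 'm) vspace_scheme \<Rightarrow> ('v, 'k, 'p) vspace_scheme \<Rightarrow> ('u \<Rightarrow> 'v) \<Rightarrow> bool"
  where "linear_map V W T \<longleftrightarrow> (\<forall>x\<in>carr V. T x \<in> carr W) \<and>
    (\<forall>x\<in>carr V. \<forall>y\<in>carr V. T (vadd V x y) = vadd W (T x) (T y)) \<and>
    (\<forall>c. \<forall>x\<in>carr V. T (vsmul V c x) = vsmul W c (T x))"

definition cont_linear :: "('u, 'k) nspace \<Rightarrow> ('v, 'k) nspace \<Rightarrow> ('u \<Rightarrow> 'v) \<Rightarrow> bool"
  where "cont_linear E F T \<longleftrightarrow> linear_map E F T \<and>
    (\<exists>C. \<forall>x\<in>carr E. vnorm F (T x) \<le> C * vnorm E x)"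

definition op_norm :: "('u, 'k) nspace \<Rightarrow> ('v, 'k) nspace \<Rightarrow> ('u \<Rightarrow> 'v) \<Rightarrow> real"
  where "op_norm E F T = Sup {vnorm F (T x) | x. x \<in> carr E \<and> vnorm E x \<le> 1}"

definition isometric_map :: "('u, 'k) nspace \<Rightarrow> ('v, 'k) nspace \<Rightarrow> ('u \<Rightarrow> 'v) \<Rightarrow> bool"
  where "isometric_map E F T \<longleftrightarrow> linear_map E F T \<and> (\<forall>x\<in>carr E. vnorm F (T x) = vnorm E x)"

definition scalar_space :: "('k :: real_or_complex, 'k) nspace"
  where "scalar_space = \<lparr>carr = UNIV, vadd = (+), vzero = 0, vsmul = (*), vnorm = norm\<rparr>"

definition dual :: "('u, 'k :: real_or_complex) nspace \<Rightarrow> ('u \<Rightarrow> 'k, 'k) nspace"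
  where "dual E =
    \<lparr>carr = {f \<in> extensional (carr E). cont_linear E scalar_space f},
     vadd = (\<lambda>f g. \<lambda>x\<in>carr E. f x + g x),
     vzero = (\<lambda>x\<in>carr E. 0),
     vsmul = (\<lambda>c f. \<lambda>x\<in>carr E. c * f x),
     vnorm = op_norm E scalar_space\<rparr>"

abbreviation bidual :: "('u, 'k :: real_or_complex) nspace \<Rightarrow> (('u \<Rightarrow> 'k) \<Rightarrow> 'k, 'k) nspace"
  where "bidual E \<equiv> dual (dual E)"

definition canonical_embedding :: "('u, 'k :: real_or_complex) nspace \<Rightarrow> 'u \<Rightarrow> ('u \<Rightarrow> 'k) \<Rightarrow> 'k"
  where "canonical_embedding E x = (\<lambda>f\<in>carr (dual E). f x)"

definition coset_of :: "('u, 'k) nspace \<Rightarrow> 'u set \<Rightarrow> 'u \<Rightarrow> 'u set"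
  where "coset_of E L x = {vadd E x l | l. l \<in> L}"

definition quotient_space :: "('u, 'k) nspace \<Rightarrow> 'u set \<Rightarrow> ('u set, 'k) nspace"
  where "quotient_space E L =
    \<lparr>carr = coset_of E L ` carr E,
     vadd = (\<lambda>A B. {vadd E a b | a b. a \<in> A \<and> b \<in> B}),
     vzero = L,
     vsmul = (\<lambda>c A. {vadd E (vsmul E c a) l | a l. a \<in> A \<and> l \<in> L}),
     vnorm = (\<lambda>A. Inf (vnorm E ` A))\<rparr>"

text \<open>The quotient \<open>E/L\<close> has carrier type \<open>'u set\<close>. Choosing a point in each coset is
  injective on cosets and yields a copy of \<open>E/L\<close> in the universe \<open>'u\<close> of \<open>E\<close>.\<close>

definition coset_rep :: "'u set \<Rightarrow> 'u"
  where "coset_rep A = (SOME x. x \<in> A)"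

definition quotient_copy :: "('u, 'k) nspace \<Rightarrow> 'u set \<Rightarrow> ('u, 'k) nspace"
  where "quotient_copy E L = copy_along coset_rep (quotient_space E L)"

definition quotient_map :: "('u, 'k) nspace \<Rightarrow> 'u set \<Rightarrow> 'u \<Rightarrow> 'u"
  where "quotient_map E L = coset_rep \<circ> coset_of E L"

definition FIN :: "('u, 'k) nspace \<Rightarrow> 'u set set"
  where "FIN E = {M. lin_subspace E M \<and> finite_dim (restrict_space_to E M)}"

definition COFIN :: "('u, 'k :: real_or_complex) nspace \<Rightarrow> 'u set set"
  where "COFIN E =
    {L. lin_subspace E L \<and> closed_in_space E L \<and> finite_dim (quotient_space E L)}"


section \<open>Symmetric tensor products\<close>

text \<open>
  The algebraic tensor power is realised in the algebraic dual of the space of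
  \<open>n\<close>-linear forms: \<open>x\<^sub>1 \<otimes> \<dots> \<otimes> x\<^sub>n\<close> is the evaluation \<open>\<phi> \<mapsto> \<phi> (x\<^sub>1, \<dots>, x\<^sub>n)\<close>, and the
  tensor power is the span of these elements. No continuity is required of the forms.
\<close>

type_synonym ('u, 'k) tensor = "('u list \<Rightarrow> 'k) \<Rightarrow> 'k"

definition tuples :: "nat \<Rightarrow> ('u, 'k, 'm) vspace_scheme \<Rightarrow> 'u list set"
  where "tuples n V = {xs. length xs = n \<and> set xs \<subseteq> carr V}"

definition multilinear_forms ::
  "nat \<Rightarrow> ('u, 'k :: real_or_complex, 'm) vspace_scheme \<Rightarrow> ('u list \<Rightarrow> 'k) set"
  where "multilinear_forms n V = {\<phi> \<in> extensional (tuples n V).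
    \<forall>xs\<in>tuples n V. \<forall>i<n.
      (\<forall>x\<in>carr V. \<forall>y\<in>carr V. \<phi> (xs[i := vadd V x y]) = \<phi> (xs[i := x]) + \<phi> (xs[i := y])) \<and>
      (\<forall>c. \<forall>x\<in>carr V. \<phi> (xs[i := vsmul V c x]) = c * \<phi> (xs[i := x]))}"

definition functionals_on_forms ::
  "nat \<Rightarrow> ('u, 'k :: real_or_complex, 'm) vspace_scheme \<Rightarrow> (('u, 'k) tensor, 'k) vspace"
  where "functionals_on_forms n V =
    \<lparr>carr = extensional (multilinear_forms n V),
     vadd = (\<lambda>z w. \<lambda>\<phi>\<in>multilinear_forms n V. z \<phi> + w \<phi>),
     vzero = (\<lambda>\<phi>\<in>multilinear_forms n V. 0),
     vsmul = (\<lambda>c z. \<lambda>\<phi>\<in>multilinear_forms n V. c * z \<phi>)\<rparr>"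

definition elementary_tensor ::
  "nat \<Rightarrow> ('u, 'k :: real_or_complex, 'm) vspace_scheme \<Rightarrow> 'u list \<Rightarrow> ('u, 'k) tensor"
  where "elementary_tensor n V xs = (\<lambda>\<phi>\<in>multilinear_forms n V. \<phi> xs)"

definition tensor_power ::
  "nat \<Rightarrow> ('u, 'k :: real_or_complex, 'm) vspace_scheme \<Rightarrow> (('u, 'k) tensor, 'k) vspace"
  where "tensor_power n V = (functionals_on_forms n V)
    \<lparr>carr := lspan (functionals_on_forms n V) (elementary_tensor n V ` tuples n V)\<rparr>"

definition diag_tensor ::
  "nat \<Rightarrow> ('u, 'k :: real_or_complex, 'm) vspace_scheme \<Rightarrow> 'u \<Rightarrow> ('u, 'k) tensor"
  where "diag_tensor n V x = elementary_tensor n V (replicate n x)"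

definition sym_tensors ::
  "nat \<Rightarrow> ('u, 'k :: real_or_complex, 'm) vspace_scheme \<Rightarrow> ('u, 'k) tensor set"
  where "sym_tensors n V = lspan (tensor_power n V) (diag_tensor n V ` carr V)"

text \<open>\<open>\<otimes>\<^sup>nT\<close> restricted to symmetric tensors, i.e. \<open>z \<mapsto> (\<psi> \<mapsto> z (\<psi> \<circ> (T \<times> \<dots> \<times> T)))\<close>; it is
  linear and maps \<open>x \<otimes> \<dots> \<otimes> x\<close> to \<open>Tx \<otimes> \<dots> \<otimes> Tx\<close>.\<close>

definition sym_map ::
  "nat \<Rightarrow> ('u, 'k :: real_or_complex) nspace \<Rightarrow> ('v, 'k) nspace \<Rightarrow> ('u \<Rightarrow> 'v)
    \<Rightarrow> ('u, 'k) tensor \<Rightarrow> ('v, 'k) tensor"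
  where "sym_map n E F T z =
    (\<lambda>\<psi>\<in>multilinear_forms n F. z (\<lambda>xs\<in>tuples n E. \<psi> (map T xs)))"

text \<open>A representation \<open>z = \<Sum>\<^sub>j \<lambda>\<^sub>j \<otimes>\<^sup>n x\<^sub>j\<close> is given as the list of the pairs
  \<open>(\<lambda>\<^sub>j, x\<^sub>j)\<close>.\<close>

definition represents ::
  "nat \<Rightarrow> ('u, 'k :: real_or_complex) nspace \<Rightarrow> ('k \<times> 'u) list \<Rightarrow> ('u, 'k) tensor \<Rightarrow> bool"
  where "represents n E R z \<longleftrightarrow> snd ` set R \<subseteq> carr E \<and>
    z = lincomb (tensor_power n E) (map (\<lambda>(c, x). (c, diag_tensor n E x)) R)"

definition proj_s ::
  "nat \<Rightarrow> ('u, 'k :: real_or_complex) nspace \<Rightarrow> ('u, 'k) tensor \<Rightarrow> real"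
  where "proj_s n E z = Inf {(\<Sum>(c, x)\<leftarrow>R. norm c * vnorm E x ^ n) | R. represents n E R z}"

text \<open>The supremum below does not depend on the representation; an arbitrary one is chosen.\<close>

definition inj_s ::
  "nat \<Rightarrow> ('u, 'k :: real_or_complex) nspace \<Rightarrow> ('u, 'k) tensor \<Rightarrow> real"
  where "inj_s n E z = (let R = SOME R. represents n E R z in
    Sup {norm (\<Sum>(c, x)\<leftarrow>R. c * f x ^ n) | f. f \<in> carr (dual E) \<and> vnorm (dual E) f \<le> 1})"


section \<open>s-tensor norms\<close>

type_synonym ('u, 'k) tnorm = "('u, 'k) nspace \<Rightarrow> ('u, 'k) tensor \<Rightarrow> real"

definition sym_tensor_space ::
  "nat \<Rightarrow> ('u, 'k :: real_or_complex) tnorm \<Rightarrow> ('u, 'k) nspace \<Rightarrow> (('u, 'k) tensor, 'k) nspace"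
  where "sym_tensor_space n \<alpha> E =
    \<lparr>carr = sym_tensors n E,
     vadd = vadd (tensor_power n E),
     vzero = vzero (tensor_power n E),
     vsmul = vsmul (tensor_power n E),
     vnorm = \<alpha> E\<rparr>"

definition s_tensor_norm :: "nat \<Rightarrow> ('u, 'k :: real_or_complex) tnorm \<Rightarrow> bool"
  where "s_tensor_norm n \<alpha> \<longleftrightarrow>
    (\<forall>E. normed_space E \<longrightarrow>
       normed_space (sym_tensor_space n \<alpha> E) \<and>
       (\<forall>z\<in>sym_tensors n E. inj_s n E z \<le> \<alpha> E z \<and> \<alpha> E z \<le> proj_s n E z)) \<and>
    (\<forall>E F T. normed_space E \<longrightarrow> normed_space F \<longrightarrow> cont_linear E F T \<longrightarrow>
       cont_linear (sym_tensor_space n \<alpha> E) (sym_tensor_space n \<alpha> F) (sym_map n E F T) \<and>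
       op_norm (sym_tensor_space n \<alpha> E) (sym_tensor_space n \<alpha> F) (sym_map n E F T)
         \<le> op_norm E F T ^ n)"

text \<open>For \<open>M \<subseteq> E\<close>, the tensor product over \<open>M\<close> is identified with a subspace of the one over
  \<open>E\<close> via the map induced by the inclusion; \<open>w\<close> below is \<open>z\<close> regarded as a tensor over
  \<open>M\<close>.\<close>

definition finitely_generated :: "nat \<Rightarrow> ('u, 'k :: real_or_complex) tnorm \<Rightarrow> bool"
  where "finitely_generated n \<alpha> \<longleftrightarrow>
    (\<forall>E. normed_space E \<longrightarrow> (\<forall>z\<in>sym_tensors n E.
       \<alpha> E z = Inf {\<alpha> (restrict_space_to E M) w | M w.
         M \<in> FIN E \<and> w \<in> sym_tensors n (restrict_space_to E M) \<and>
         sym_map n (restrict_space_to E M) E (\<lambda>x. x) w = z}))"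

definition cofinitely_generated :: "nat \<Rightarrow> ('u, 'k :: real_or_complex) tnorm \<Rightarrow> bool"
  where "cofinitely_generated n \<alpha> \<longleftrightarrow>
    (\<forall>E. normed_space E \<longrightarrow> (\<forall>z\<in>sym_tensors n E.
       \<alpha> E z = Sup {\<alpha> (quotient_copy E L) (sym_map n E (quotient_copy E L) (quotient_map E L) z)
         | L. L \<in> COFIN E}))"


section \<open>Room for the bidual\<close>

text \<open>
  The bidual of a space over \<open>'u\<close> has the carrier type \<open>('u \<Rightarrow> 'k) \<Rightarrow> 'k\<close>, so a tensor norm
  on the spaces over \<open>'u\<close> can only be evaluated on a copy of the bidual along a map \<open>e\<close> into
  \<open>'u\<close> that is injective on the bidual (for an s-tensor norm the choice of \<open>e\<close> is
  immaterial, since isometric isomorphisms preserve it). The condition that such an \<open>e\<close>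
  exists says only that the universe is large enough for \<open>E\<close>: \<open>room_for_bidual\<close> shows that
  every space over any type has an isometric copy in some universe with this property.
\<close>

lemma normed_space_copy_along:
  assumes "normed_space X" "inj_on e (carr X)"
  shows "normed_space (copy_along e X)"
proof -
  interpret X: normed_space X by fact
  note [simp] = inv_into_f_f[OF assms(2)]
  show ?thesis
  proof (unfold_locales, goal_cases)
    case (7 x)
    then obtain u where u: "u \<in> carr X" "x = e u"
      by (auto simp: copy_along_def Let_def)
    then obtain v where "v \<in> carr X" "vadd X u v = vzero X"
      using X.add_inverse by blast
    with u show ?case
      by (auto simp: copy_along_def Let_def intro!: bexI[of _ v])
  next
    case (13 x)
    then show ?case
      using assms(2) X.zero_closed
      by (auto simp: copy_along_def Let_def X.norm_eq_zero inj_on_eq_iff)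
  qed (auto simp: copy_along_def Let_def X.add_closed X.zero_closed X.smul_closed
        X.add_assoc X.add_zero X.smul_add_right X.smul_add_left X.smul_smul X.smul_one
        X.norm_nonneg X.norm_smul X.norm_triangle intro: arg_cong[OF X.add_commute])
qed

lemma isometric_map_copy_along:
  assumes "normed_space X" "inj_on e (carr X)"
  shows "isometric_map X (copy_along e X) e"
  using inv_into_f_f[OF assms(2)]
  by (auto simp: isometric_map_def linear_map_def copy_along_def Let_def)

lemma room_for_bidual:
  fixes X :: "('a, 'k :: real_or_complex) nspace"
  defines "E \<equiv> copy_along (Inl :: 'a \<Rightarrow> 'a + (('a \<Rightarrow> 'k) \<Rightarrow> 'k)) X"
  shows "\<exists>e :: (('a + (('a \<Rightarrow> 'k) \<Rightarrow> 'k) \<Rightarrow> 'k) \<Rightarrow> 'k) \<Rightarrow> 'a + (('a \<Rightarrow> 'k) \<Rightarrow> 'k).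
    inj_on e (carr (bidual E))"
    and "Inl ` carr X = carr E"
    and "normed_space X \<Longrightarrow> normed_space E"
    and "normed_space X \<Longrightarrow> isometric_map X E Inl"
proof -
  show "Inl ` carr X = carr E"
    by (simp add: E_def copy_along_def Let_def)
  show "normed_space X \<Longrightarrow> normed_space E"
    unfolding E_def by (rule normed_space_copy_along) auto
  show "normed_space X \<Longrightarrow> isometric_map X E Inl"
    unfolding E_def by (rule isometric_map_copy_along) auto
  define D where "D = carr (dual E)"
  have cE: "carr E = Inl ` carr X"
    by (simp add: E_def copy_along_def Let_def)
  define r :: "('a \<Rightarrow> 'k) \<Rightarrow> ('a + (('a \<Rightarrow> 'k) \<Rightarrow> 'k) \<Rightarrow> 'k)"
    where "r g = (\<lambda>v\<in>carr E. g (projl v))" for g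
  have r: "r (\<lambda>x. f (Inl x)) = f" if "f \<in> D" for f
  proof -
    have "f \<in> extensional (carr E)"
      using that by (simp add: D_def dual_def)
    then show ?thesis
      by (auto simp: r_def cE fun_eq_iff extensional_def restrict_def)
  qed
  define e :: "(('a + (('a \<Rightarrow> 'k) \<Rightarrow> 'k) \<Rightarrow> 'k) \<Rightarrow> 'k) \<Rightarrow> 'a + (('a \<Rightarrow> 'k) \<Rightarrow> 'k)"
    where "e \<Phi> = Inr (\<lambda>g. \<Phi> (r g))" for \<Phi>
  have "inj_on e (carr (bidual E))"
  proof (rule inj_onI)
    fix \<Phi> \<Psi>
    assume "\<Phi> \<in> carr (bidual E)" "\<Psi> \<in> carr (bidual E)" and eq: "e \<Phi> = e \<Psi>"
    then have ext: "\<Phi> \<in> extensional D" "\<Psi> \<in> extensional D"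
      by (simp_all add: D_def dual_def[of "dual E"])
    have "\<Phi> f = \<Psi> f" if "f \<in> D" for f
    proof -
      from eq have "(\<lambda>g. \<Phi> (r g)) = (\<lambda>g. \<Psi> (r g))"
        by (simp add: e_def)
      then have "\<Phi> (r (\<lambda>x. f (Inl x))) = \<Psi> (r (\<lambda>x. f (Inl x)))"
        by (rule fun_cong)
      then show ?thesis
        by (simp add: r[OF that])
    qed
    with ext show "\<Phi> = \<Psi>"
      by (rule extensionalityI)
  qed
  then show "\<exists>e :: (('a + (('a \<Rightarrow> 'k) \<Rightarrow> 'k) \<Rightarrow> 'k) \<Rightarrow> 'k) \<Rightarrow> 'a + (('a \<Rightarrow> 'k) \<Rightarrow> 'k).
    inj_on e (carr (bidual E))"
    by blast
qed

end

theory Submission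
  imports Defs
begin

text \<open>
  Write \<open>\<kappa> : E \<rightarrow> E''\<close> for the canonical embedding. It is a contraction, so the metric mapping
  property gives \<open>\<alpha>(\<otimes>\<kappa> z) \<le> \<alpha>(z)\<close>. For the reverse inequality, \<open>z\<close> has to be recovered from
  \<open>\<otimes>\<kappa> z\<close> by maps of norm (almost) one.

  If \<open>\<alpha>\<close> is cofinitely generated, it suffices to bound the norm of \<open>z\<close> in \<open>E/L\<close> for \<open>L\<close> closed of
  finite codimension. The quotient map \<open>Q : E \<rightarrow> E/L\<close> factors as \<open>Q = P \<circ> \<kappa>\<close>, where \<open>P\<close> is the
  bitranspose \<open>E'' \<rightarrow> (E/L)'' = E/L\<close> of \<open>Q\<close>, a contraction
  (\<open>extension_to_finite_dim\<close>); so the bound is the metric mapping property for \<open>P\<close>.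

  If \<open>\<alpha>\<close> is finitely generated, let \<open>w\<close> be a tensor over a finite dimensional \<open>M \<subseteq> E''\<close> whose image
  over \<open>E''\<close> is \<open>\<otimes>\<kappa> z\<close>. A weak form of the principle of local reflexivity
  (\<open>local_reflexivity\<close>) provides, for each \<open>\<epsilon> > 0\<close>, a linear \<open>R : E'' \<rightarrow> E\<close> with \<open>R \<circ> \<kappa> = id\<close> whose
  restriction to \<open>M\<close> has norm at most \<open>1 + \<epsilon>\<close>. The map \<open>R\<close> is in general unbounded, but the
  algebraic tensor power is functorial for all linear maps, so \<open>\<otimes>R\<close> takes \<open>w\<close> to
  \<open>\<otimes>(R \<circ> \<kappa>) z = z\<close>. Hence \<open>\<alpha>(z) \<le> (1 + \<epsilon>)\<^sup>n \<alpha>(w)\<close>.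

  Local reflexivity is proved by a single separation argument
  (\<open>small_left_inverse_on_finite_set\<close>): on a finite set \<open>N \<subseteq> E''\<close>, a left inverse of \<open>\<kappa>\<close> that is as
  small as required exists because otherwise the Hahn-Banach theorem in \<open>E\<^sup>N\<close> yields functionals
  in \<open>E'\<close> that contradict the norms of the elements of \<open>N\<close>. A net of the unit ball of \<open>M\<close> then
  serves as \<open>N\<close>.
\<close>


section \<open>Scalars\<close>

text \<open>In the real case, \<open>i = 0\<close> serves.\<close>

lemma scalar_parts:
  "\<exists>i :: 'k :: real_or_complex. \<forall>x. \<exists>a b. x = of_real a + of_real b * i \<and>
     \<bar>a\<bar> \<le> norm x \<and> \<bar>b\<bar> \<le> norm x"
  using real_or_complex[where 'a = 'k]
proof
  assume real: "\<forall>x :: 'k. \<exists>a. x = a *\<^sub>R 1"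
  have "\<exists>a b. x = of_real a + of_real b * 0 \<and> \<bar>a\<bar> \<le> norm x \<and> \<bar>b\<bar> \<le> norm x" for x :: 'k
  proof -
    obtain a where "x = a *\<^sub>R 1" using real by blast
    then show ?thesis by (intro exI[of _ a] exI[of _ 0]) (simp add: of_real_def)
  qed
  then show ?thesis by blast
next
  assume "\<exists>i :: 'k. i * i = - 1 \<and>
    (\<forall>x. \<exists>a b. x = a *\<^sub>R 1 + b *\<^sub>R i \<and> norm x = sqrt (a\<^sup>2 + b\<^sup>2))"
  then obtain i :: 'k where i:
    "\<And>x. \<exists>a b. x = a *\<^sub>R 1 + b *\<^sub>R i \<and> norm x = sqrt (a\<^sup>2 + b\<^sup>2)"
    by blast
  have "\<exists>a b. x = of_real a + of_real b * i \<and> \<bar>a\<bar> \<le> norm x \<and> \<bar>b\<bar> \<le> norm x" for x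
  proof -
    obtain a b where ab: "x = a *\<^sub>R 1 + b *\<^sub>R i" "norm x = sqrt (a\<^sup>2 + b\<^sup>2)"
      using i by blast
    then have "x = of_real a + of_real b * i"
      by (simp add: of_real_def)
    moreover have "\<bar>a\<bar> \<le> norm x" "\<bar>b\<bar> \<le> norm x"
      by (auto simp: ab(2) intro!: real_le_rsqrt)
    ultimately show ?thesis by blast
  qed
  then show ?thesis by blast
qed

lemma finite_scalar_net:
  fixes C \<eta> :: real
  assumes "\<eta> > 0"
  shows "\<exists>N :: 'k :: real_or_complex set. finite N \<and> (\<forall>c. norm c \<le> C \<longrightarrow> (\<exists>t\<in>N. norm (c - t) \<le> \<eta>))"
proof -
  obtain i :: 'k where i: "\<And>x. \<exists>a b. x = of_real a + of_real b * i \<and>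
     \<bar>a\<bar> \<le> norm x \<and> \<bar>b\<bar> \<le> norm x"
    using scalar_parts by blast
  define S where "S = (\<lambda>(a, b). of_real a + of_real b * i) ` ({-C..C} \<times> {-C..C})"
  have "compact S"
    unfolding S_def case_prod_unfold
    by (intro compact_continuous_image compact_Times continuous_intros) auto
  then obtain N where N: "finite N" "S \<subseteq> (\<Union>x\<in>N. ball x \<eta>)"
    using assms by (metis compact_eq_totally_bounded)
  have "\<exists>t\<in>N. norm (c - t) \<le> \<eta>" if "norm c \<le> C" for c
  proof -
    obtain a b where "c = of_real a + of_real b * i" "\<bar>a\<bar> \<le> norm c" "\<bar>b\<bar> \<le> norm c"
      using i by blast
    then have "c \<in> S"
      using that unfolding S_def by (intro image_eqI[of _ _ "(a, b)"]) auto
    then show ?thesis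
      using N(2) by (force simp: dist_norm norm_minus_commute intro: less_imp_le)
  qed
  with N(1) show ?thesis by blast
qed


section \<open>Linear algebra on carriers\<close>

lemma lspanI: "snd ` set R \<subseteq> B \<Longrightarrow> x = lincomb V R \<Longrightarrow> x \<in> lspan V B"
  unfolding lspan_def by blast

lemma lspanE:
  assumes "x \<in> lspan V B"
  obtains R where "snd ` set R \<subseteq> B" "x = lincomb V R"
  using assms unfolding lspan_def by blast

context lin_space
begin

declare add_closed [simp] zero_closed [simp] smul_closed [simp] add_zero [simp] smul_one [simp]

lemma zero_add [simp]: "x \<in> carr V \<Longrightarrow> vadd V (vzero V) x = x"
  by (metis add_commute add_zero zero_closed)

lemma add_left_commute:
  "x \<in> carr V \<Longrightarrow> y \<in> carr V \<Longrightarrow> z \<in> carr V \<Longrightarrow> vadd V x (vadd V y z) = vadd V y (vadd V x z)"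
  by (metis add_assoc add_commute)

lemmas add_ac = add_assoc add_commute add_left_commute

lemma add_left_cancel:
  assumes "x \<in> carr V" "y \<in> carr V" "z \<in> carr V"
  shows "vadd V x y = vadd V x z \<longleftrightarrow> y = z"
proof
  assume eq: "vadd V x y = vadd V x z"
  obtain w where w: "w \<in> carr V" "vadd V x w = vzero V"
    using add_inverse assms(1) by blast
  have "vadd V w (vadd V x y) = y" if "y \<in> carr V" for y
    using that w assms(1) by (metis add_assoc add_commute zero_add)
  with eq assms show "y = z" by metis
qed simp

lemma smul_zero_left [simp]:
  assumes "x \<in> carr V"
  shows "vsmul V 0 x = vzero V"
proof -
  have "vadd V (vsmul V 0 x) (vsmul V 0 x) = vadd V (vsmul V 0 x) (vzero V)"
    using smul_add_left[OF assms, of 0 0] assms by simp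
  then show ?thesis
    using assms by (subst (asm) add_left_cancel) auto
qed

lemma smul_zero_right [simp]: "vsmul V c (vzero V) = vzero V"
  by (metis smul_smul smul_zero_left zero_closed mult_zero_right)

lemma add_minus [simp]:
  assumes "x \<in> carr V"
  shows "vadd V x (vsmul V (- 1) x) = vzero V" "vadd V (vsmul V (- 1) x) x = vzero V"
proof -
  have "vadd V (vsmul V 1 x) (vsmul V (- 1) x) = vzero V"
    using assms by (simp del: smul_one flip: smul_add_left)
  then show "vadd V x (vsmul V (- 1) x) = vzero V" using assms by simp
  then show "vadd V (vsmul V (- 1) x) x = vzero V"
    using assms by (simp add: add_commute)
qed

lemma vdiff_closed [simp]: "x \<in> carr V \<Longrightarrow> y \<in> carr V \<Longrightarrow> vdiff V x y \<in> carr V"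
  by (simp add: vdiff_def)

lemma add_vdiff:
  assumes "x \<in> carr V" "y \<in> carr V"
  shows "vadd V y (vdiff V x y) = x" "vadd V (vdiff V x y) y = x"
proof -
  have "vadd V y (vdiff V x y) = vadd V x (vadd V y (vsmul V (- 1) y))"
    unfolding vdiff_def using assms by (intro add_left_commute) auto
  then show "vadd V y (vdiff V x y) = x" using assms by simp
  then show "vadd V (vdiff V x y) y = x" using assms by (simp add: add_commute)
qed

lemma vdiff_eq_zero: "x \<in> carr V \<Longrightarrow> y \<in> carr V \<Longrightarrow> vdiff V x y = vzero V \<longleftrightarrow> x = y"
  by (metis add_vdiff(1) add_zero add_minus(1) vdiff_def)

lemma lincomb_closed: "snd ` set R \<subseteq> carr V \<Longrightarrow> lincomb V R \<in> carr V"
  by (induction R) auto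

lemma lincomb_append:
  "snd ` set R \<subseteq> carr V \<Longrightarrow> snd ` set R' \<subseteq> carr V \<Longrightarrow>
    lincomb V (R @ R') = vadd V (lincomb V R) (lincomb V R')"
  by (induction R) (auto simp: lincomb_closed add_assoc)

lemma lincomb_smul:
  "snd ` set R \<subseteq> carr V \<Longrightarrow>
    vsmul V c (lincomb V R) = lincomb V (map (\<lambda>(a, x). (c * a, x)) R)"
  by (induction R) (auto simp: lincomb_closed smul_add_right smul_smul)

lemma lin_subspace_lspan:
  assumes "B \<subseteq> carr V"
  shows "lin_subspace V (lspan V B)"
  unfolding lin_subspace_def
proof (intro conjI ballI allI)
  show "lspan V B \<subseteq> carr V"
    using assms by (auto elim!: lspanE intro!: lincomb_closed)
  show "vzero V \<in> lspan V B"
    by (rule lspanI[of "[]"]) auto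
  fix x y c assume "x \<in> lspan V B"
  then obtain R where R: "snd ` set R \<subseteq> B" "x = lincomb V R" by (rule lspanE)
  have "vsmul V c x = lincomb V (map (\<lambda>(a, x). (c * a, x)) R)"
    using R assms by (simp add: lincomb_smul subset_trans)
  moreover have "snd ` set (map (\<lambda>(a, x). (c * a, x)) R) \<subseteq> B"
    using R(1) by auto
  ultimately show "vsmul V c x \<in> lspan V B" by (intro lspanI)
  assume "y \<in> lspan V B"
  then obtain R' where R': "snd ` set R' \<subseteq> B" "y = lincomb V R'" by (rule lspanE)
  have "vadd V x y = lincomb V (R @ R')"
    using R R' assms by (subst lincomb_append) auto
  moreover have "snd ` set (R @ R') \<subseteq> B"
    using R(1) R'(1) by auto
  ultimately show "vadd V x y \<in> lspan V B" by (intro lspanI)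
qed

lemma subset_lspan: "B \<subseteq> carr V \<Longrightarrow> B \<subseteq> lspan V B"
proof
  fix x assume "B \<subseteq> carr V" "x \<in> B"
  then show "x \<in> lspan V B"
    by (intro lspanI[of "[(1, x)]"]) auto
qed

lemma lin_space_subspace:
  assumes "lin_subspace V M"
  shows "lin_space (V\<lparr>carr := M\<rparr>)"
proof -
  have M: "\<And>x. x \<in> M \<Longrightarrow> x \<in> carr V" using assms by (auto simp: lin_subspace_def)
  show ?thesis
  proof (unfold_locales, goal_cases)
    case (7 x)
    then show ?case
      using assms M by (intro bexI[of _ "vsmul V (- 1) x"]) (auto simp: lin_subspace_def)
  qed (use assms M in \<open>auto simp: lin_subspace_def add_assoc smul_add_right smul_add_left
        smul_smul intro: add_commute\<close>)
qed

end

lemma lin_subspaceD: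
  assumes "lin_subspace V M"
  shows "x \<in> M \<Longrightarrow> x \<in> carr V" "vzero V \<in> M" "x \<in> M \<Longrightarrow> y \<in> M \<Longrightarrow> vadd V x y \<in> M"
    "x \<in> M \<Longrightarrow> vsmul V c x \<in> M"
  using assms by (auto simp: lin_subspace_def)

lemma linear_mapD:
  assumes "linear_map V W T" "x \<in> carr V"
  shows "T x \<in> carr W" "y \<in> carr V \<Longrightarrow> T (vadd V x y) = vadd W (T x) (T y)"
    "T (vsmul V c x) = vsmul W c (T x)"
  using assms by (auto simp: linear_map_def)

lemma linear_map_zero:
  assumes "lin_space V" "lin_space W" "linear_map V W T"
  shows "T (vzero V) = vzero W"
proof -
  interpret V: lin_space V by fact
  interpret W: lin_space W by fact
  show ?thesis
    by (metis V.smul_zero_left V.zero_closed W.smul_zero_left assms(3) linear_mapD(1,3))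
qed

lemma linear_map_vdiff:
  assumes "lin_space V" "linear_map V W T" "x \<in> carr V" "y \<in> carr V"
  shows "T (vdiff V x y) = vdiff W (T x) (T y)"
  using assms by (simp add: vdiff_def linear_mapD lin_space.smul_closed)

lemma linear_map_comp:
  "linear_map U V S \<Longrightarrow> linear_map V W T \<Longrightarrow> linear_map U W (\<lambda>x. T (S x))"
  by (simp add: linear_map_def)

lemma linear_map_lincomb:
  assumes "lin_space V" "lin_space W" "linear_map V W T" "snd ` set R \<subseteq> carr V"
  shows "T (lincomb V R) = lincomb W (map (\<lambda>(c, x). (c, T x)) R)"
  using assms(4)
proof (induction R)
  case Nil
  then show ?case using linear_map_zero assms by simp
next
  case (Cons r R)
  then have "lincomb V R \<in> carr V"
    using lin_space.lincomb_closed[OF assms(1)] by auto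
  with Cons assms show ?case
    by (cases r) (simp add: linear_mapD lin_space.smul_closed)
qed

lemma finite_dim_linear_image:
  assumes "lin_space V" "lin_space W" "linear_map V W T" "T ` carr V = carr W" "finite_dim V"
  shows "finite_dim W"
proof -
  obtain B where B: "finite B" "B \<subseteq> carr V" "lspan V B = carr V"
    using assms(5) by (auto simp: finite_dim_def)
  have TB: "T ` B \<subseteq> carr W" using B(2) assms(4) by blast
  have "carr W \<subseteq> lspan W (T ` B)"
  proof
    fix y assume "y \<in> carr W"
    then obtain x where "x \<in> lspan V B" "y = T x" using assms(4) B(3) by blast
    then obtain R where R: "snd ` set R \<subseteq> B" "y = T (lincomb V R)"
      using lspanE[of x V B] by metis
    have "snd ` set R \<subseteq> carr V" using R(1) B(2) by (rule subset_trans)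
    then have "y = lincomb W (map (\<lambda>(c, x). (c, T x)) R)"
      using linear_map_lincomb[OF assms(1-3)] R(2) by simp
    moreover have "snd ` set (map (\<lambda>(c, x). (c, T x)) R) \<subseteq> T ` B"
      using R(1) by auto
    ultimately show "y \<in> lspan W (T ` B)" by (intro lspanI)
  qed
  moreover have "lspan W (T ` B) \<subseteq> carr W"
    using lin_space.lin_subspace_lspan[OF assms(2) TB] by (simp add: lin_subspace_def)
  ultimately show ?thesis
    unfolding finite_dim_def using B(1) TB by blast
qed

lemma linear_map_fixing_span:
  assumes "lin_space V" "linear_map V V S" "B \<subseteq> carr V" "lspan V B = carr V"
    and "\<And>b. b \<in> B \<Longrightarrow> S b = b" and "x \<in> carr V"
  shows "S x = x"
proof -
  obtain R where R: "snd ` set R \<subseteq> B" "x = lincomb V R"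
    using assms(4,6) lspanE[of x V B] by metis
  have "map (\<lambda>(c, x). (c, S x)) R = R"
    using R(1) assms(5) by (intro map_idI) auto
  moreover have "snd ` set R \<subseteq> carr V" using R(1) assms(3) by (rule subset_trans)
  ultimately show ?thesis
    using linear_map_lincomb[OF assms(1,1,2), of R] R(2) by simp
qed


section \<open>Extension of linear maps and the Hahn-Banach theorem\<close>

definition prod_space ::
  "('u, 'k, 'm) vspace_scheme \<Rightarrow> ('v, 'k, 'p) vspace_scheme \<Rightarrow> ('u \<times> 'v, 'k) vspace"
  where "prod_space V W =
    \<lparr>carr = carr V \<times> carr W,
     vadd = (\<lambda>a b. (vadd V (fst a) (fst b), vadd W (snd a) (snd b))),
     vzero = (vzero V, vzero W),
     vsmul = (\<lambda>c a. (vsmul V c (fst a), vsmul W c (snd a)))\<rparr>"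

lemma prod_space_simps [simp]:
  "carr (prod_space V W) = carr V \<times> carr W"
  "vadd (prod_space V W) (x, y) (x', y') = (vadd V x x', vadd W y y')"
  "vzero (prod_space V W) = (vzero V, vzero W)"
  "vsmul (prod_space V W) c (x, y) = (vsmul V c x, vsmul W c y)"
  by (simp_all add: prod_space_def)

lemma lin_space_prod_space:
  assumes "lin_space V" "lin_space W"
  shows "lin_space (prod_space V W)"
proof -
  interpret V: lin_space V by fact
  interpret W: lin_space W by fact
  show ?thesis
  proof (unfold_locales, goal_cases)
    case (7 x)
    then show ?case
      by (intro bexI[of _ "vsmul (prod_space V W) (- 1) x"]) auto
  qed (auto simp: V.add_assoc W.add_assoc V.smul_add_right W.smul_add_right
        V.smul_add_left W.smul_add_left V.smul_smul W.smul_smul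
        intro: V.add_commute W.add_commute)
qed

lemma maximal_subspace_within:
  assumes "lin_subspace V G\<^sub>0" "G\<^sub>0 \<subseteq> S"
  obtains G where "lin_subspace V G" "G\<^sub>0 \<subseteq> G" "G \<subseteq> S"
    "\<And>H. lin_subspace V H \<Longrightarrow> G \<subseteq> H \<Longrightarrow> H \<subseteq> S \<Longrightarrow> H = G"
proof -
  define A where "A = {G. lin_subspace V G \<and> G\<^sub>0 \<subseteq> G \<and> G \<subseteq> S}"
  have "\<exists>M\<in>A. \<forall>X\<in>A. M \<subseteq> X \<longrightarrow> X = M"
  proof (rule subset_Zorn_nonempty)
    show "A \<noteq> {}" using assms by (auto simp: A_def)
    fix C assume C: "C \<noteq> {}" "subset.chain A C"
    then have CA: "\<And>G. G \<in> C \<Longrightarrow> lin_subspace V G \<and> G\<^sub>0 \<subseteq> G \<and> G \<subseteq> S"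
      by (auto simp: subset.chain_def A_def)
    have "lin_subspace V (\<Union>C)"
      unfolding lin_subspace_def
    proof (intro conjI ballI allI)
      fix x y assume "x \<in> \<Union>C" "y \<in> \<Union>C"
      then obtain G H where GH: "G \<in> C" "H \<in> C" "x \<in> G" "y \<in> H" by blast
      moreover have "G \<subseteq> H \<or> H \<subseteq> G"
        using C(2) GH(1,2) by (auto simp: subset.chain_def)
      ultimately have "\<exists>G\<in>C. x \<in> G \<and> y \<in> G" by blast
      then show "vadd V x y \<in> \<Union>C"
        using CA lin_subspaceD(3)[of V _ x y] by blast
    next
      show "\<Union>C \<subseteq> carr V" using CA lin_subspaceD(1)[of V] by blast
      show "vzero V \<in> \<Union>C" using C(1) CA lin_subspaceD(2)[of V] by blast
      fix c x assume "x \<in> \<Union>C"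
      then show "vsmul V c x \<in> \<Union>C" using CA lin_subspaceD(4)[of V _ x c] by blast
    qed
    then show "\<Union>C \<in> A"
      using CA C(1) unfolding A_def by blast
  qed
  then obtain G where "G \<in> A" and "\<And>X. X \<in> A \<Longrightarrow> G \<subseteq> X \<Longrightarrow> X = G" by blast
  then show ?thesis
    by (intro that[of G]) (auto simp: A_def)
qed

definition adjoin :: "('u, 'k, 'm) vspace_scheme \<Rightarrow> 'u set \<Rightarrow> 'u \<Rightarrow> 'u set"
  where "adjoin V G x = {vadd V g (vsmul V c x) | g c. g \<in> G}"

lemma (in lin_space) adjoin:
  assumes G: "lin_subspace V G" and x: "x \<in> carr V"
  shows "lin_subspace V (adjoin V G x)" "G \<subseteq> adjoin V G x" "x \<in> adjoin V G x"
proof -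
  note [simp] = lin_subspaceD[OF G]
  show G': "G \<subseteq> adjoin V G x"
  proof
    fix g assume "g \<in> G"
    then have "g = vadd V g (vsmul V 0 x)" using x by simp
    then show "g \<in> adjoin V G x" using \<open>g \<in> G\<close> unfolding adjoin_def by blast
  qed
  have "x = vadd V (vzero V) (vsmul V 1 x)" using x by simp
  then show "x \<in> adjoin V G x" unfolding adjoin_def using lin_subspaceD(2)[OF G] by blast
  show "lin_subspace V (adjoin V G x)"
    unfolding lin_subspace_def
  proof (intro conjI ballI allI)
    show "adjoin V G x \<subseteq> carr V" using x by (auto simp: adjoin_def)
    show "vzero V \<in> adjoin V G x" using G' lin_subspaceD(2)[OF G] by blast
    fix y z c assume "y \<in> adjoin V G x"
    then obtain g a where g: "g \<in> G" "y = vadd V g (vsmul V a x)" by (auto simp: adjoin_def)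
    have "vsmul V c y = vadd V (vsmul V c g) (vsmul V (c * a) x)"
      using g x by (simp add: smul_add_right smul_smul)
    then show "vsmul V c y \<in> adjoin V G x"
      unfolding adjoin_def using g(1) lin_subspaceD(4)[OF G] by blast
    assume "z \<in> adjoin V G x"
    then obtain h b where h: "h \<in> G" "z = vadd V h (vsmul V b x)" by (auto simp: adjoin_def)
    have "vadd V y z = vadd V (vadd V g h) (vsmul V (a + b) x)"
      using g h x by (simp add: smul_add_left add_ac)
    then show "vadd V y z \<in> adjoin V G x"
      unfolding adjoin_def using g(1) h(1) lin_subspaceD(3)[OF G] by blast
  qed
qed

text \<open>
  A linear map is identified with its graph, and a condition on a partially defined map with the
  requirement that the graph be contained in \<open>S\<close>. If a single further point can always be added
  to the domain, a maximal graph is the graph of a map on all of \<open>V\<close>. Both the algebraic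
  extension of linear maps and the Hahn-Banach theorem are instances.
\<close>

lemma extension_principle:
  assumes V: "lin_space V" and W: "lin_space W"
    and G0: "lin_subspace (prod_space V W) G\<^sub>0" "G\<^sub>0 \<subseteq> S"
    and sv: "\<And>G y. lin_subspace (prod_space V W) G \<Longrightarrow> G \<subseteq> S \<Longrightarrow> (vzero V, y) \<in> G \<Longrightarrow> y = vzero W"
    and step: "\<And>G x. lin_subspace (prod_space V W) G \<Longrightarrow> G \<subseteq> S \<Longrightarrow> x \<in> carr V \<Longrightarrow>
      x \<notin> Domain G \<Longrightarrow> \<exists>y\<in>carr W. adjoin (prod_space V W) G (x, y) \<subseteq> S"
  obtains T where "linear_map V W T" "\<And>x. x \<in> carr V \<Longrightarrow> (x, T x) \<in> S"
    "\<And>x y. (x, y) \<in> G\<^sub>0 \<Longrightarrow> T x = y"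
proof -
  interpret V: lin_space V by fact
  interpret W: lin_space W by fact
  interpret P: lin_space "prod_space V W" using V W by (rule lin_space_prod_space)
  obtain G where G: "lin_subspace (prod_space V W) G" "G\<^sub>0 \<subseteq> G" "G \<subseteq> S"
    and max: "\<And>H. lin_subspace (prod_space V W) H \<Longrightarrow> G \<subseteq> H \<Longrightarrow> H \<subseteq> S \<Longrightarrow> H = G"
    using maximal_subspace_within[OF G0] by blast
  have total: "\<exists>y. (x, y) \<in> G" if x: "x \<in> carr V" for x
  proof (rule ccontr)
    assume "\<nexists>y. (x, y) \<in> G"
    then obtain y where y: "y \<in> carr W" "adjoin (prod_space V W) G (x, y) \<subseteq> S"
      using step[OF G(1,3) x] by blast
    have xy: "(x, y) \<in> carr (prod_space V W)" using x y by simp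
    have "adjoin (prod_space V W) G (x, y) = G"
      using max[OF P.adjoin(1)[OF G(1) xy] P.adjoin(2)[OF G(1) xy] y(2)] .
    then show False using P.adjoin(3)[OF G(1) xy] \<open>\<nexists>y. (x, y) \<in> G\<close> by blast
  qed
  have carrG: "x \<in> carr V" "y \<in> carr W" if "(x, y) \<in> G" for x y
    using lin_subspaceD(1)[OF G(1) that] by auto
  have unique: "y = y'" if "(x, y) \<in> G" "(x, y') \<in> G" for x y y'
  proof -
    have "vadd (prod_space V W) (x, y) (vsmul (prod_space V W) (- 1) (x, y')) \<in> G"
      using that lin_subspaceD(3,4)[OF G(1)] by blast
    then have "vdiff W y y' = vzero W"
      using carrG[OF that(1)] carrG[OF that(2)]
      by (intro sv[OF G(1,3)]) (simp add: vdiff_def)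
    then show ?thesis using carrG that by (simp add: W.vdiff_eq_zero)
  qed
  define T where "T x = (THE y. (x, y) \<in> G)" for x
  have T: "T x = y" if "(x, y) \<in> G" for x y
    unfolding T_def using that unique by blast
  then have TG: "(x, T x) \<in> G" if "x \<in> carr V" for x
    using total[OF that] by auto
  have "linear_map V W T"
    unfolding linear_map_def
  proof (intro conjI ballI allI)
    fix x y c assume x: "x \<in> carr V"
    show "T x \<in> carr W" using carrG TG[OF x] by blast
    show "T (vsmul V c x) = vsmul W c (T x)"
      using lin_subspaceD(4)[OF G(1) TG[OF x]] by (intro T) simp
    assume y: "y \<in> carr V"
    show "T (vadd V x y) = vadd W (T x) (T y)"
      using lin_subspaceD(3)[OF G(1) TG[OF x] TG[OF y]] by (intro T) simp
  qed
  with T TG G show ?thesis by (intro that[of T]) auto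
qed

text \<open>The map \<open>k x \<mapsto> x\<close> on the range of \<open>k\<close> is extended; a partially defined map is extended to
  a new point by the value zero.\<close>

lemma linear_left_inverse:
  assumes V: "lin_space V" and W: "lin_space W" and k: "linear_map W V k"
    and inj: "\<And>x. x \<in> carr W \<Longrightarrow> k x = vzero V \<Longrightarrow> x = vzero W"
  obtains J where "linear_map V W J" "\<And>x. x \<in> carr W \<Longrightarrow> J (k x) = x"
proof -
  interpret V: lin_space V by fact
  interpret W: lin_space W by fact
  define G where "G = (\<lambda>x. (k x, x)) ` carr W"
  have G: "lin_subspace (prod_space V W) G"
    unfolding lin_subspace_def
  proof (intro conjI ballI allI)
    show "G \<subseteq> carr (prod_space V W)" using k by (auto simp: G_def linear_mapD)
    show "vzero (prod_space V W) \<in> G"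
      using linear_map_zero[OF W V k] by (auto simp: G_def intro!: rev_image_eqI[of "vzero W"])
    fix a b c assume "a \<in> G"
    then obtain x where x: "x \<in> carr W" "a = (k x, x)" by (auto simp: G_def)
    then show "vsmul (prod_space V W) c a \<in> G"
      using k by (auto simp: G_def linear_mapD intro!: rev_image_eqI[of "vsmul W c x"])
    assume "b \<in> G"
    then obtain y where y: "y \<in> carr W" "b = (k y, y)" by (auto simp: G_def)
    then show "vadd (prod_space V W) a b \<in> G"
      using k x by (auto simp: G_def linear_mapD intro!: rev_image_eqI[of "vadd W x y"])
  qed
  show ?thesis
  proof (rule extension_principle[OF V W G, of "{(v, y). v = vzero V \<longrightarrow> y = vzero W}"])
    show "G \<subseteq> {(v, y). v = vzero V \<longrightarrow> y = vzero W}" using inj by (auto simp: G_def)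
  next
    fix H x assume H: "lin_subspace (prod_space V W) H" "H \<subseteq> {(v, y). v = vzero V \<longrightarrow> y = vzero W}"
      and x: "x \<in> carr V" "x \<notin> Domain H"
    have "adjoin (prod_space V W) H (x, vzero W) \<subseteq> {(v, y). v = vzero V \<longrightarrow> y = vzero W}"
    proof
      fix a assume "a \<in> adjoin (prod_space V W) H (x, vzero W)"
      then obtain v y c where a: "(v, y) \<in> H" "a = (vadd V v (vsmul V c x), vadd W y (vzero W))"
        by (auto simp: adjoin_def)
      have vy: "v \<in> carr V" "y \<in> carr W" using lin_subspaceD(1)[OF H(1) a(1)] by auto
      have "vadd W y (vzero W) = vzero W" if 0: "vadd V v (vsmul V c x) = vzero V"
      proof -
        have "c = 0"
        proof (rule ccontr)
          assume c: "c \<noteq> 0"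
          have "vsmul V c x = vsmul V (- 1) v"
            using 0 vy x V.add_left_cancel[of v "vsmul V c x" "vsmul V (- 1) v"] by simp
          then have "x = vsmul V (inverse c) (vsmul V (- 1) v)"
            using c x by (metis V.smul_one V.smul_smul left_inverse)
          then have "(x, vsmul W (inverse c) (vsmul W (- 1) y)) \<in> H"
            using lin_subspaceD(4)[OF H(1) lin_subspaceD(4)[OF H(1) a(1)]] by simp
          then show False using x(2) by blast
        qed
        then have "v = vzero V" using 0 x vy by simp
        then show ?thesis using a(1) H(2) by auto
      qed
      then show "a \<in> {(v, y). v = vzero V \<longrightarrow> y = vzero W}" using a(2) by auto
    qed
    then show "\<exists>y\<in>carr W. adjoin (prod_space V W) H (x, y) \<subseteq> {(v, y). v = vzero V \<longrightarrow> y = vzero W}"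
      by (rule bexI[OF _ W.zero_closed])
  next
    fix T assume T: "linear_map V W T" "\<And>x y. (x, y) \<in> G \<Longrightarrow> T x = y"
    then show ?thesis by (intro that[of T]) (simp_all add: G_def)
  qed auto
qed

definition seminorm_on ::
  "('u, 'k :: real_or_complex, 'm) vspace_scheme \<Rightarrow> ('u \<Rightarrow> real) \<Rightarrow> bool"
  where "seminorm_on V p \<longleftrightarrow> (\<forall>x\<in>carr V. 0 \<le> p x) \<and>
    (\<forall>x\<in>carr V. \<forall>y\<in>carr V. p (vadd V x y) \<le> p x + p y) \<and>
    (\<forall>c. \<forall>x\<in>carr V. p (vsmul V c x) = norm c * p x)"

lemma seminormD:
  assumes "seminorm_on V p" "x \<in> carr V"
  shows "0 \<le> p x" "y \<in> carr V \<Longrightarrow> p (vadd V x y) \<le> p x + p y" "p (vsmul V c x) = norm c * p x"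
  using assms by (auto simp: seminorm_on_def)

lemma (in lin_space) seminormI:
  assumes nonneg: "\<And>x. x \<in> carr V \<Longrightarrow> 0 \<le> p x"
    and tri: "\<And>x y. x \<in> carr V \<Longrightarrow> y \<in> carr V \<Longrightarrow> p (vadd V x y) \<le> p x + p y"
    and hom: "\<And>c x. x \<in> carr V \<Longrightarrow> p (vsmul V c x) \<le> norm c * p x"
  shows "seminorm_on V p"
  unfolding seminorm_on_def
proof (intro conjI ballI allI)
  fix c x assume x: "x \<in> carr V"
  show "p (vsmul V c x) = norm c * p x"
  proof (cases "c = 0")
    case True
    then show ?thesis using hom[OF x, of 0] nonneg[of "vzero V"] x by simp
  next
    case False
    then have "p x = p (vsmul V (inverse c) (vsmul V c x))"
      using x by (simp flip: smul_smul)
    also have "\<dots> \<le> inverse (norm c) * p (vsmul V c x)"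
      using hom[of "vsmul V c x" "inverse c"] x by (simp add: norm_inverse)
    finally have "norm c * p x \<le> p (vsmul V c x)"
      using False by (simp add: field_simps)
    with hom[OF x, of c] show ?thesis by simp
  qed
qed (use nonneg tri in auto)

lemma scalar_space_simps [simp]:
  "carr scalar_space = UNIV" "vadd scalar_space = (+)" "vzero scalar_space = 0"
  "vsmul scalar_space = (*)" "vnorm scalar_space = norm"
  by (simp_all add: scalar_space_def)

lemma normed_space_scalar_space: "normed_space scalar_space"
  by unfold_locales
    (auto simp: algebra_simps norm_mult norm_triangle_ineq intro: exI[of _ "- x" for x])

lemma lin_space_scalar_space: "lin_space scalar_space"
  using normed_space_scalar_space unfolding normed_space_def by blast

lemma linear_functional_vdiff:
  assumes "lin_space V" "linear_map V scalar_space f" "x \<in> carr V" "y \<in> carr V"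
  shows "f (vdiff V x y) = f x - f y"
  using linear_map_vdiff[OF assms] by (simp add: vdiff_def)

definition real_scalars :: "('u, 'k :: real_or_complex, 'm) vspace_scheme \<Rightarrow> ('u, real) vspace"
  where "real_scalars V =
    \<lparr>carr = carr V, vadd = vadd V, vzero = vzero V, vsmul = (\<lambda>r. vsmul V (of_real r))\<rparr>"

lemma real_scalars_simps [simp]:
  "carr (real_scalars V) = carr V" "vadd (real_scalars V) = vadd V"
  "vzero (real_scalars V) = vzero V" "vsmul (real_scalars V) r = vsmul V (of_real r)"
  by (simp_all add: real_scalars_def)

lemma (in lin_space) lin_space_real_scalars: "lin_space (real_scalars V)"
  by unfold_locales
    (auto simp: add_assoc smul_add_right smul_add_left smul_smul add_inverse intro: add_commute)

lemma Hahn_Banach_real: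
  fixes V :: "('u, real, 'm) vspace_scheme"
  assumes V: "lin_space V" and p: "seminorm_on V p" and x0: "x\<^sub>0 \<in> carr V"
  shows "\<exists>f. linear_map V scalar_space f \<and> (\<forall>x\<in>carr V. f x \<le> p x) \<and> f x\<^sub>0 = p x\<^sub>0"
proof -
  interpret V: lin_space V by fact
  note pD = seminormD[OF p]
  let ?P = "prod_space V (scalar_space :: (real, real) nspace)"
  define S where "S = {(x, t). t \<le> p x}"
  define G\<^sub>0 where "G\<^sub>0 = {(vsmul V c x\<^sub>0, c * p x\<^sub>0) | c. True}"
  have G0: "lin_subspace ?P G\<^sub>0"
    unfolding lin_subspace_def
  proof (intro conjI ballI allI)
    show "G\<^sub>0 \<subseteq> carr ?P" using x0 by (auto simp: G\<^sub>0_def)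
    show "vzero ?P \<in> G\<^sub>0" using x0 by (auto simp: G\<^sub>0_def intro!: exI[of _ 0])
    fix a b c assume "a \<in> G\<^sub>0"
    then obtain s where s: "a = (vsmul V s x\<^sub>0, s * p x\<^sub>0)" by (auto simp: G\<^sub>0_def)
    show "vsmul ?P c a \<in> G\<^sub>0"
      using x0 by (auto simp: G\<^sub>0_def s V.smul_smul intro!: exI[of _ "c * s"])
    assume "b \<in> G\<^sub>0"
    then obtain t where t: "b = (vsmul V t x\<^sub>0, t * p x\<^sub>0)" by (auto simp: G\<^sub>0_def)
    show "vadd ?P a b \<in> G\<^sub>0"
      using x0 by (auto simp: G\<^sub>0_def s t V.smul_add_left algebra_simps intro!: exI[of _ "s + t"])
  qed
  have G0S: "G\<^sub>0 \<subseteq> S"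
    using pD[OF x0] by (auto simp: G\<^sub>0_def S_def intro!: mult_right_mono)
  have p0: "p (vzero V) = 0"
    using pD(3)[OF x0, of 0] x0 by simp
  show ?thesis
  proof (rule extension_principle[OF V lin_space_scalar_space G0 G0S])
    fix G y assume G: "lin_subspace ?P G" "G \<subseteq> S" "(vzero V, y) \<in> G"
    have "(vzero V, - y) \<in> G" using lin_subspaceD(4)[OF G(1,3), of "- 1"] by simp
    then have "- y \<le> p (vzero V)" "y \<le> p (vzero V)" using G(2,3) by (auto simp: S_def)
    then show "y = vzero scalar_space" using p0 by simp
  next
    fix G x assume G: "lin_subspace ?P G" "G \<subseteq> S" and x: "x \<in> carr V" "x \<notin> Domain G"
    note [simp] = V.vdiff_closed[OF _ x(1)] x(1)
    have cG: "v \<in> carr V" if "(v, s) \<in> G" for v s using lin_subspaceD(1)[OF G(1) that] by auto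
    have le: "s - p (vdiff V v x) \<le> p (vadd V w x) - t" if "(v, s) \<in> G" "(w, t) \<in> G" for v s w t
    proof -
      note [simp] = cG[OF that(1)] cG[OF that(2)]
      have "s + t \<le> p (vadd V v w)"
        using lin_subspaceD(3)[OF G(1) that] G(2) by (auto simp: S_def)
      also have "vadd V v w = vadd V (vdiff V v x) (vadd V w x)"
      proof -
        have "vadd V (vdiff V v x) (vadd V w x) = vadd V (vadd V (vdiff V v x) x) w"
          by (simp add: V.add_ac)
        then show ?thesis by (simp add: V.add_vdiff)
      qed
      also have "p \<dots> \<le> p (vdiff V v x) + p (vadd V w x)" by (intro pD) auto
      finally show ?thesis by simp
    qed
    \<comment> \<open>the value at \<open>x\<close> may be any number between the two families of bounds\<close>
    define L where "L = {s - p (vdiff V v x) | v s. (v, s) \<in> G}"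
    have zG: "(vzero V, 0) \<in> G" using lin_subspaceD(2)[OF G(1)] by simp
    have "L \<noteq> {}" using zG by (auto simp: L_def)
    have bdd: "bdd_above L"
      using le[OF _ zG] by (intro bdd_aboveI[of _ "p (vadd V (vzero V) x) - 0"]) (auto simp: L_def)
    define a where "a = Sup L"
    have a1: "s - p (vdiff V v x) \<le> a" if "(v, s) \<in> G" for v s
      unfolding a_def using that bdd by (intro cSup_upper) (auto simp: L_def)
    have a2: "a \<le> p (vadd V w x) - t" if "(w, t) \<in> G" for w t
      unfolding a_def using that le \<open>L \<noteq> {}\<close> by (intro cSup_least) (auto simp: L_def)
    have "s + c * a \<le> p (vadd V v (vsmul V c x))" if vs: "(v, s) \<in> G" for v s c
    proof -
      note [simp] = cG[OF vs]
      consider "c = 0" | "c > 0" | "c < 0" by linarith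
      then show ?thesis
      proof cases
        case 1
        then show ?thesis using vs G(2) by (auto simp: S_def)
      next
        case 2
        have "(vsmul V (inverse c) v, inverse c * s) \<in> G"
          using lin_subspaceD(4)[OF G(1) vs, of "inverse c"] by simp
        from a2[OF this] have "c * (a + inverse c * s) \<le> c * p (vadd V (vsmul V (inverse c) v) x)"
          using 2 by (intro mult_left_mono) auto
        also have "\<dots> = p (vsmul V c (vadd V (vsmul V (inverse c) v) x))"
          using 2 by (simp add: pD)
        also have "vsmul V c (vadd V (vsmul V (inverse c) v) x) = vadd V v (vsmul V c x)"
          using 2 by (simp add: V.smul_add_right flip: V.smul_smul)
        finally show ?thesis using 2 by (simp add: distrib_left mult.assoc[symmetric])
      next
        case 3
        define b where "b = - c"
        have b: "b > 0" "c = - b" using 3 by (auto simp: b_def)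
        have "(vsmul V (inverse b) v, inverse b * s) \<in> G"
          using lin_subspaceD(4)[OF G(1) vs, of "inverse b"] by simp
        from a1[OF this] have "b * (inverse b * s - a) \<le> b * p (vdiff V (vsmul V (inverse b) v) x)"
          using b by (intro mult_left_mono) auto
        also have "\<dots> = p (vsmul V b (vdiff V (vsmul V (inverse b) v) x))"
          using b by (simp add: pD)
        also have "vsmul V b (vdiff V (vsmul V (inverse b) v) x) = vadd V v (vsmul V c x)"
          using b by (simp add: vdiff_def V.smul_add_right flip: V.smul_smul)
        finally show ?thesis using b by (simp add: right_diff_distrib mult.assoc[symmetric])
      qed
    qed
    then have "adjoin ?P G (x, a) \<subseteq> S"
      by (auto simp: adjoin_def S_def)
    then show "\<exists>y\<in>carr (scalar_space :: (real, real) nspace). adjoin ?P G (x, y) \<subseteq> S" by auto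
  next
    fix T assume T: "linear_map V scalar_space T" "\<And>x. x \<in> carr V \<Longrightarrow> (x, T x) \<in> S"
      "\<And>x y. (x, y) \<in> G\<^sub>0 \<Longrightarrow> T x = y"
    have "(vsmul V 1 x\<^sub>0, 1 * p x\<^sub>0) \<in> G\<^sub>0" unfolding G\<^sub>0_def by blast
    then have "T x\<^sub>0 = p x\<^sub>0" using T(3) x0 by simp
    with T(1,2) show ?thesis by (auto simp: S_def)
  qed
qed

text \<open>A real-linear functional \<open>f\<close> is the real part of the linear functional
  \<open>x \<mapsto> f x - i f (i x)\<close>. Rotating \<open>x\<close> by a scalar of modulus one makes the value of the latter
  real and nonnegative, so that it is bounded by the same seminorm as \<open>f\<close>.\<close>

lemma real_part_of_linear_functional:
  fixes V :: "('u, 'k :: real_or_complex, 'm) vspace_scheme"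
  assumes V: "lin_space V" and f: "linear_map (real_scalars V) scalar_space f"
  shows "\<exists>g. linear_map V scalar_space g \<and> (\<forall>x\<in>carr V. \<bar>f x\<bar> \<le> norm (g x)) \<and>
    (\<forall>x\<in>carr V. \<exists>u. norm u = 1 \<and> norm (g x) = f (vsmul V u x))"
proof -
  interpret V: lin_space V by fact
  have f_add: "f (vadd V x y) = f x + f y" and f_smul: "f (vsmul V (of_real c) x) = c * f x"
    if "x \<in> carr V" "y \<in> carr V" for x y c
    using f that by (auto simp: linear_map_def)
  show ?thesis using real_or_complex[where 'a = 'k]
  proof
    assume "\<forall>x :: 'k. \<exists>a. x = a *\<^sub>R 1"
    then have real: "\<exists>a. c = of_real a" for c :: 'k by (simp add: of_real_def)
    have "linear_map V scalar_space (\<lambda>x. of_real (f x) :: 'k)"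
      unfolding linear_map_def
    proof (intro conjI ballI allI)
      fix c x assume "x \<in> carr V"
      then show "of_real (f (vsmul V c x)) = vsmul scalar_space c (of_real (f x))"
        using real[of c] f_smul[of x x] by auto
    qed (auto simp: f_add)
    moreover have "\<exists>u. norm u = 1 \<and> norm (of_real (f x) :: 'k) = f (vsmul V u x)"
      if "x \<in> carr V" for x
      using f_smul[OF that that, of "if f x \<ge> 0 then 1 else - 1"]
      by (intro exI[of _ "of_real (if f x \<ge> 0 then 1 else - 1)"]) auto
    ultimately show ?thesis by (intro exI[of _ "\<lambda>x. of_real (f x)"]) auto
  next
    assume "\<exists>i :: 'k. i * i = - 1 \<and>
      (\<forall>x. \<exists>a b. x = a *\<^sub>R 1 + b *\<^sub>R i \<and> norm x = sqrt (a\<^sup>2 + b\<^sup>2))"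
    then obtain i :: 'k where ii: "i * i = - 1"
      and parts: "\<And>x. \<exists>a b. x = of_real a + of_real b * i \<and> norm x = sqrt (a\<^sup>2 + b\<^sup>2)"
      unfolding of_real_def by auto
    have indep: "a = 0" if "of_real a + of_real b * i = 0" for a b
    proof (rule ccontr)
      assume a: "a \<noteq> 0"
      have "(of_real a :: 'k) = - (of_real b * i)" using that by (simp add: eq_neg_iff_add_eq_0)
      then have "(of_real a :: 'k) * of_real a = of_real b * of_real b * (i * i)"
        by (simp add: algebra_simps)
      then have "(of_real (a * a + b * b) :: 'k) = 0" by (simp add: ii)
      then have "a * a + b * b = 0" by (simp only: of_real_eq_0_iff)
      then show False using a by (simp add: add_nonneg_eq_0_iff)
    qed
    have re: "a = a'" if "of_real a + of_real b * i = of_real a' + of_real b' * i" for a b a' b'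
      using indep[of "a - a'" "b - b'"] that by (simp add: algebra_simps)
    define g where "g x = of_real (f x) + of_real (- f (vsmul V i x)) * i" for x
    have g_add: "g (vadd V x y) = g x + g y" if "x \<in> carr V" "y \<in> carr V" for x y
      using that by (simp add: g_def f_add V.smul_add_right algebra_simps)
    have g_i: "g (vsmul V i x) = i * g x" if "x \<in> carr V" for x
    proof -
      have "vsmul V i (vsmul V i x) = vsmul V (of_real (- 1)) x"
        using that ii by (simp flip: V.smul_smul)
      then have "f (vsmul V i (vsmul V i x)) = - f x" using f_smul[OF that that, of "- 1"] by simp
      then have "g (vsmul V i x) = of_real (f (vsmul V i x)) + of_real (f x) * i"
        by (simp add: g_def)
      also have "\<dots> = of_real (f x) * i - of_real (f (vsmul V i x)) * (i * i)" by (simp add: ii)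
      also have "\<dots> = i * g x" by (simp add: g_def algebra_simps)
      finally show ?thesis .
    qed
    have g_real: "g (vsmul V (of_real c) x) = of_real c * g x" if "x \<in> carr V" for c x
    proof -
      have "vsmul V i (vsmul V (of_real c) x) = vsmul V (of_real c) (vsmul V i x)"
        using that by (metis V.smul_smul mult.commute)
      then show ?thesis
        using that by (simp add: g_def f_smul[where y = x] algebra_simps)
    qed
    have g_smul: "g (vsmul V c x) = c * g x" if x: "x \<in> carr V" for c x
    proof -
      obtain a b where c: "c = of_real a + of_real b * i" using parts by blast
      have "vsmul V c x = vadd V (vsmul V (of_real a) x) (vsmul V (of_real b) (vsmul V i x))"
        using x by (simp add: c V.smul_add_left V.smul_smul)
      then show ?thesis using x by (simp add: g_add g_real g_i c algebra_simps)
    qed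
    have abs_le: "\<bar>f x\<bar> \<le> norm (g x)" for x
    proof -
      obtain a b where ab: "g x = of_real a + of_real b * i" "norm (g x) = sqrt (a\<^sup>2 + b\<^sup>2)"
        using parts by blast
      have "f x = a" using re ab(1) unfolding g_def by blast
      then show ?thesis by (auto simp: ab(2) intro!: real_le_rsqrt)
    qed
    have "\<exists>u. norm u = 1 \<and> norm (g x) = f (vsmul V u x)" if x: "x \<in> carr V" for x
    proof (cases "g x = 0")
      case True
      then show ?thesis using abs_le[of x] x by (intro exI[of _ 1]) auto
    next
      case False
      define u where "u = of_real (norm (g x)) / g x"
      have "g (vsmul V u x) = of_real (norm (g x)) + of_real 0 * i"
        using False x by (simp add: g_smul u_def)
      then have "f (vsmul V u x) = norm (g x)" using re unfolding g_def by blast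
      moreover have "norm u = 1" using False by (simp add: u_def norm_divide)
      ultimately show ?thesis by (intro exI[of _ u]) auto
    qed
    moreover have "linear_map V scalar_space g" by (auto simp: linear_map_def g_add g_smul)
    ultimately show ?thesis using abs_le by blast
  qed
qed

text \<open>The form with a seminorm yields norming functionals, if \<open>p\<close> is the norm, and functionals that
  vanish on a subspace, if \<open>p\<close> is the distance to it.\<close>

theorem Hahn_Banach:
  assumes V: "lin_space V" and p: "seminorm_on V p" and x0: "x\<^sub>0 \<in> carr V"
  obtains f where "linear_map V scalar_space f" "\<And>x. x \<in> carr V \<Longrightarrow> norm (f x) \<le> p x"
    "norm (f x\<^sub>0) = p x\<^sub>0"
proof -
  interpret V: lin_space V by fact
  have "seminorm_on (real_scalars V) p" using p by (simp add: seminorm_on_def)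
  then obtain f where f: "linear_map (real_scalars V) scalar_space f"
    "\<And>x. x \<in> carr V \<Longrightarrow> f x \<le> p x" "f x\<^sub>0 = p x\<^sub>0"
    using Hahn_Banach_real[OF V.lin_space_real_scalars, of p x\<^sub>0] x0 by auto
  obtain g where g: "linear_map V scalar_space g" "\<And>x. x \<in> carr V \<Longrightarrow> \<bar>f x\<bar> \<le> norm (g x)"
    "\<And>x. x \<in> carr V \<Longrightarrow> \<exists>u. norm u = 1 \<and> norm (g x) = f (vsmul V u x)"
    using real_part_of_linear_functional[OF V f(1)] by blast
  have le: "norm (g x) \<le> p x" if "x \<in> carr V" for x
  proof -
    obtain u where u: "norm u = 1" "norm (g x) = f (vsmul V u x)" using g(3)[OF \<open>x \<in> carr V\<close>] by blast
    then show ?thesis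
      using f(2)[of "vsmul V u x"] that by (simp add: seminormD[OF p])
  qed
  have "norm (g x\<^sub>0) = p x\<^sub>0"
    using le[OF x0] g(2)[OF x0] f(3) by linarith
  from that[OF g(1) le this] show ?thesis .
qed


section \<open>Bounded linear maps and duals\<close>

context lin_space
begin

lemma vdiff_add_add:
  assumes [simp]: "a \<in> carr V" "b \<in> carr V" "c \<in> carr V" "d \<in> carr V"
  shows "vdiff V (vadd V a b) (vadd V c d) = vadd V (vdiff V a c) (vdiff V b d)"
  by (simp add: vdiff_def smul_add_right add_ac)

lemma vdiff_smul_left:
  "x \<in> carr V \<Longrightarrow> vdiff V (vsmul V a x) (vsmul V b x) = vsmul V (a - b) x"
  using smul_add_left[of x a "- b"] by (simp add: vdiff_def flip: smul_smul)

lemma vdiff_zero_right [simp]: "x \<in> carr V \<Longrightarrow> vdiff V x (vzero V) = x"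
  by (simp add: vdiff_def)

end

context normed_space
begin

declare norm_nonneg [simp]

lemma norm_zero [simp]: "vnorm E (vzero E) = 0"
  by (simp add: norm_eq_zero)

lemma seminorm_norm: "seminorm_on E (vnorm E)"
  by (intro seminormI) (auto simp: norm_smul norm_triangle)

lemma norm_minus_one: "x \<in> carr E \<Longrightarrow> vnorm E (vsmul E (- 1) x) = vnorm E x"
  by (simp add: norm_smul)

lemma normed_space_subspace:
  assumes "lin_subspace E M"
  shows "normed_space (restrict_space_to E M)"
proof -
  interpret M: lin_space "restrict_space_to E M" using assms by (rule lin_space_subspace)
  show ?thesis
    using lin_subspaceD(1)[OF assms]
    by unfold_locales (auto simp: norm_eq_zero norm_smul norm_triangle)
qed

end

lemma lin_space_of_normed: "normed_space E \<Longrightarrow> lin_space E"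
  by (simp add: normed_space_def)

lemma cont_linear_linear: "cont_linear E F T \<Longrightarrow> linear_map E F T"
  by (simp add: cont_linear_def)

lemma cont_linear_contraction:
  assumes "linear_map E F T" "\<And>x. x \<in> carr E \<Longrightarrow> vnorm F (T x) \<le> vnorm E x"
  shows "cont_linear E F T"
  unfolding cont_linear_def using assms by (intro conjI exI[of _ 1]) auto

lemma bdd_above_unit_ball_image:
  assumes "normed_space E" "cont_linear E F T"
  shows "bdd_above {vnorm F (T x) | x. x \<in> carr E \<and> vnorm E x \<le> 1}"
proof -
  interpret E: normed_space E by fact
  obtain C where C: "\<And>x. x \<in> carr E \<Longrightarrow> vnorm F (T x) \<le> C * vnorm E x"
    using assms(2) unfolding cont_linear_def by blast
  have "vnorm F (T x) \<le> \<bar>C\<bar>" if x: "x \<in> carr E" "vnorm E x \<le> 1" for x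
  proof -
    have "C * vnorm E x \<le> \<bar>C\<bar> * 1" using x by (intro mult_mono) auto
    then show ?thesis using C[OF x(1)] by linarith
  qed
  then show ?thesis by (auto intro!: bdd_aboveI)
qed

lemma norm_le_op_norm_unit_ball:
  assumes "normed_space E" "cont_linear E F T" "x \<in> carr E" "vnorm E x \<le> 1"
  shows "vnorm F (T x) \<le> op_norm E F T"
  unfolding op_norm_def
  using assms by (intro cSup_upper bdd_above_unit_ball_image) auto

lemma norm_le_op_norm:
  assumes E: "normed_space E" and F: "normed_space F" and T: "cont_linear E F T"
    and x: "x \<in> carr E"
  shows "vnorm F (T x) \<le> op_norm E F T * vnorm E x"
proof -
  interpret E: normed_space E by fact
  interpret F: normed_space F by fact
  note lin = cont_linear_linear[OF T]
  show ?thesis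
  proof (cases "vnorm E x = 0")
    case True
    then show ?thesis
      using E.norm_eq_zero[OF x] linear_map_zero[OF E.lin_space_axioms F.lin_space_axioms lin]
      by simp
  next
    case False
    then have pos: "vnorm E x > 0" using E.norm_nonneg[OF x] by linarith
    have "vnorm F (T (vsmul E (of_real (inverse (vnorm E x))) x)) \<le> op_norm E F T"
      using pos x by (intro norm_le_op_norm_unit_ball[OF E T]) (auto simp: E.norm_smul norm_inverse)
    also have "vnorm F (T (vsmul E (of_real (inverse (vnorm E x))) x)) = inverse (vnorm E x) * vnorm F (T x)"
      using pos x lin by (simp add: linear_mapD F.norm_smul norm_inverse)
    finally show ?thesis using pos by (simp add: field_simps)
  qed
qed

lemma op_norm_nonneg:
  assumes E: "normed_space E" and F: "normed_space F" and T: "cont_linear E F T"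
  shows "0 \<le> op_norm E F T"
proof -
  interpret E: normed_space E by fact
  interpret F: normed_space F by fact
  have "vnorm F (T (vzero E)) \<le> op_norm E F T"
    by (rule norm_le_op_norm_unit_ball[OF E T]) auto
  then show ?thesis
    using linear_map_zero[OF E.lin_space_axioms F.lin_space_axioms cont_linear_linear[OF T]]
    by simp
qed

lemma op_norm_le:
  assumes E: "normed_space E" and "0 \<le> C"
    and C: "\<And>x. x \<in> carr E \<Longrightarrow> vnorm F (T x) \<le> C * vnorm E x"
  shows "op_norm E F T \<le> C"
  unfolding op_norm_def
proof (rule cSup_least)
  interpret E: normed_space E by fact
  show "{vnorm F (T x) | x. x \<in> carr E \<and> vnorm E x \<le> 1} \<noteq> {}"
    by (auto intro!: exI[of _ "vzero E"])
  fix t assume "t \<in> {vnorm F (T x) | x. x \<in> carr E \<and> vnorm E x \<le> 1}"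
  then obtain x where x: "t = vnorm F (T x)" "x \<in> carr E" "vnorm E x \<le> 1" by blast
  have "C * vnorm E x \<le> C * 1" using x \<open>0 \<le> C\<close> by (intro mult_left_mono) auto
  then show "t \<le> C" using C[OF x(2)] x(1) by linarith
qed

lemma mem_dual:
  "f \<in> carr (dual E) \<longleftrightarrow> f \<in> extensional (carr E) \<and> cont_linear E scalar_space f"
  by (simp add: dual_def)

lemma dual_simps [simp]:
  "vadd (dual E) f g = (\<lambda>x\<in>carr E. f x + g x)" "vzero (dual E) = (\<lambda>x\<in>carr E. 0)"
  "vsmul (dual E) c f = (\<lambda>x\<in>carr E. c * f x)" "vnorm (dual E) f = op_norm E scalar_space f"
  by (simp_all add: dual_def)

lemma dual_linear: "f \<in> carr (dual E) \<Longrightarrow> linear_map E scalar_space f"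
  by (simp add: mem_dual cont_linear_def)

lemma dualI:
  assumes "lin_space E" "linear_map E scalar_space f"
    and "\<And>x. x \<in> carr E \<Longrightarrow> norm (f x) \<le> C * vnorm E x"
  shows "(\<lambda>x\<in>carr E. f x) \<in> carr (dual E)"
proof -
  interpret E: lin_space E by fact
  show ?thesis
    using assms(2,3) by (auto simp: mem_dual cont_linear_def linear_map_def)
qed

lemma dual_bound:
  assumes "normed_space E" "f \<in> carr (dual E)" "x \<in> carr E"
  shows "norm (f x) \<le> vnorm (dual E) f * vnorm E x"
  using norm_le_op_norm[OF assms(1) normed_space_scalar_space, of f x] assms
  by (simp add: mem_dual)

lemma dual_combination:
  assumes E: "normed_space E" and f: "f \<in> carr (dual E)" and g: "g \<in> carr (dual E)"
  shows "(\<lambda>x\<in>carr E. f x + a * g x) \<in> carr (dual E)"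
proof (rule dualI)
  show "lin_space E" using E by (rule lin_space_of_normed)
  show "linear_map E scalar_space (\<lambda>x. f x + a * g x)"
    using dual_linear[OF f] dual_linear[OF g] by (auto simp: linear_map_def algebra_simps)
  fix x assume x: "x \<in> carr E"
  have "norm (f x + a * g x) \<le> norm (f x) + norm a * norm (g x)"
    by (metis norm_mult norm_triangle_ineq)
  also have "\<dots> \<le> vnorm (dual E) f * vnorm E x + norm a * (vnorm (dual E) g * vnorm E x)"
    using dual_bound[OF E f x] dual_bound[OF E g x] by (intro add_mono mult_left_mono) auto
  finally show "norm (f x + a * g x) \<le> (vnorm (dual E) f + norm a * vnorm (dual E) g) * vnorm E x"
    by (simp add: algebra_simps)
qed

lemma zero_in_dual:
  assumes "normed_space E"
  shows "(\<lambda>x\<in>carr E. 0) \<in> carr (dual E)"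
  using lin_space_of_normed[OF assms]
  by (rule dualI[where C = 0]) (auto simp: linear_map_def)

lemma lin_space_dual:
  assumes E: "normed_space E"
  shows "lin_space (dual E)"
proof -
  interpret E: normed_space E by fact
  note comb = dual_combination[OF E]
  have add: "(\<lambda>x\<in>carr E. f x + g x) \<in> carr (dual E)" if "f \<in> carr (dual E)" "g \<in> carr (dual E)" for f g
    using comb[OF that, of 1] by simp
  have smul: "(\<lambda>x\<in>carr E. c * f x) \<in> carr (dual E)" if "f \<in> carr (dual E)" for c f
    using comb[OF zero_in_dual[OF E] that, of c] by (simp add: restrict_def cong: if_cong)
  have ext: "f = g" if "f \<in> carr (dual E)" "g \<in> carr (dual E)" "\<And>x. x \<in> carr E \<Longrightarrow> f x = g x" for f g
    using that by (auto simp: mem_dual intro: extensionalityI)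
  show ?thesis
  proof (unfold_locales, goal_cases)
    case 1
    then show ?case by (simp add: add)
  next
    case 2
    then show ?case by (simp add: zero_in_dual E)
  next
    case 3
    then show ?case by (simp add: smul)
  next
    case (6 f)
    then show ?case by (auto simp: mem_dual extensional_def fun_eq_iff)
  next
    case (7 f)
    then show ?case by (intro bexI[of _ "\<lambda>x\<in>carr E. (- 1) * f x"] smul) (auto simp: fun_eq_iff restrict_def)
  next
    case (11 f)
    then show ?case by (auto simp: mem_dual extensional_def fun_eq_iff)
  qed (auto simp: fun_eq_iff restrict_def algebra_simps)
qed

lemma normed_space_dual:
  assumes E: "normed_space E"
  shows "normed_space (dual E)"
proof -
  interpret E: normed_space E by fact
  interpret D: lin_space "dual E" using E by (rule lin_space_dual)
  note nonneg = op_norm_nonneg[OF E normed_space_scalar_space]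
  have sem: "seminorm_on (dual E) (vnorm (dual E))"
  proof (rule D.seminormI)
    fix f assume f: "f \<in> carr (dual E)"
    then show f0: "0 \<le> vnorm (dual E) f" by (simp add: nonneg mem_dual)
    {
      fix c
      have "op_norm E scalar_space (\<lambda>x\<in>carr E. c * f x) \<le> norm c * op_norm E scalar_space f"
      proof (rule op_norm_le[OF E])
        fix x assume "x \<in> carr E"
        then show "vnorm scalar_space ((\<lambda>x\<in>carr E. c * f x) x) \<le> norm c * op_norm E scalar_space f * vnorm E x"
          using mult_left_mono[OF dual_bound[OF E f], of x "norm c"] by (simp add: norm_mult mult.assoc)
      qed (use f0 in simp)
      then show "vnorm (dual E) (vsmul (dual E) c f) \<le> norm c * vnorm (dual E) f" by simp
    next
      fix g assume g: "g \<in> carr (dual E)"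
      then have g0: "0 \<le> vnorm (dual E) g" by (simp add: nonneg mem_dual)
      have "op_norm E scalar_space (\<lambda>x\<in>carr E. f x + g x) \<le> op_norm E scalar_space f + op_norm E scalar_space g"
      proof (rule op_norm_le[OF E])
        fix x assume "x \<in> carr E"
        then show "vnorm scalar_space ((\<lambda>x\<in>carr E. f x + g x) x) \<le>
            (op_norm E scalar_space f + op_norm E scalar_space g) * vnorm E x"
          using dual_bound[OF E f, of x] dual_bound[OF E g, of x] norm_triangle_ineq[of "f x" "g x"]
          by (simp add: algebra_simps)
      qed (use f0 g0 in simp)
      then show "vnorm (dual E) (vadd (dual E) f g) \<le> vnorm (dual E) f + vnorm (dual E) g" by simp
    }
  qed
  show ?thesis
  proof (unfold_locales, goal_cases)
    case (2 f)
    show ?case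
    proof
      assume "vnorm (dual E) f = 0"
      then have "f x = 0" if "x \<in> carr E" for x
        using dual_bound[OF E 2 that] by simp
      then show "f = vzero (dual E)"
        using 2 by (auto simp: mem_dual extensional_def)
    next
      assume "f = vzero (dual E)"
      then show "vnorm (dual E) f = 0"
        using seminormD(3)[OF sem 2, of 0] 2 by (metis D.smul_zero_left mult_zero_left Real_Vector_Spaces.norm_zero)
    qed
  qed (use sem in \<open>auto simp: seminorm_on_def\<close>)
qed

lemma norming_functional:
  assumes E: "normed_space E" and x: "x \<in> carr E"
  obtains f where "f \<in> carr (dual E)" "vnorm (dual E) f \<le> 1" "norm (f x) = vnorm E x"
proof -
  interpret E: normed_space E by fact
  obtain f where f: "linear_map E scalar_space f" "\<And>x. x \<in> carr E \<Longrightarrow> norm (f x) \<le> vnorm E x"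
    "norm (f x) = vnorm E x"
    using Hahn_Banach[OF E.lin_space_axioms E.seminorm_norm x] by blast
  have "(\<lambda>x\<in>carr E. f x) \<in> carr (dual E)"
    using f(2) by (intro dualI[OF E.lin_space_axioms f(1), of 1]) auto
  moreover have "vnorm (dual E) (\<lambda>x\<in>carr E. f x) \<le> 1"
    using f(2) by (auto intro!: op_norm_le[OF E])
  ultimately show ?thesis using f(3) x that by fastforce
qed

lemma dual_separates:
  assumes E: "normed_space E" and x: "x \<in> carr E" and "\<And>f. f \<in> carr (dual E) \<Longrightarrow> f x = 0"
  shows "x = vzero E"
  using norming_functional[OF E x] assms(3) normed_space.norm_eq_zero[OF E x]
  by (metis Real_Vector_Spaces.norm_zero)

lemma dual_separates_points:
  assumes E: "normed_space E" and x: "x \<in> carr E" and y: "y \<in> carr E"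
    and eq: "\<And>f. f \<in> carr (dual E) \<Longrightarrow> f x = f y"
  shows "x = y"
proof -
  note lin = lin_space_of_normed[OF E]
  have "vdiff E x y = vzero E"
  proof (rule dual_separates[OF E])
    fix f assume f: "f \<in> carr (dual E)"
    show "f (vdiff E x y) = 0"
      using eq[OF f] linear_functional_vdiff[OF lin dual_linear[OF f] x y] by simp
  qed (use x y lin in \<open>simp add: lin_space.vdiff_closed\<close>)
  then show ?thesis using x y lin by (simp add: lin_space.vdiff_eq_zero)
qed

lemma canonical_embedding_apply [simp]:
  "f \<in> carr (dual E) \<Longrightarrow> canonical_embedding E x f = f x"
  by (simp add: canonical_embedding_def)

lemma canonical_embedding:
  assumes E: "normed_space E"
  shows "linear_map E (bidual E) (canonical_embedding E)"
    and "x \<in> carr E \<Longrightarrow> vnorm (bidual E) (canonical_embedding E x) \<le> vnorm E x"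
proof -
  interpret E: normed_space E by fact
  interpret D: normed_space "dual E" using E by (rule normed_space_dual)
  have mem: "canonical_embedding E x \<in> carr (bidual E)" if x: "x \<in> carr E" for x
    unfolding canonical_embedding_def
  proof (rule dualI[OF D.lin_space_axioms])
    show "linear_map (dual E) scalar_space (\<lambda>f. f x)" using x by (auto simp: linear_map_def)
    fix f assume "f \<in> carr (dual E)"
    then show "norm (f x) \<le> vnorm E x * vnorm (dual E) f"
      using dual_bound[OF E _ x] by (simp add: mult.commute)
  qed
  show "linear_map E (bidual E) (canonical_embedding E)"
    unfolding linear_map_def
  proof (intro conjI ballI allI)
    fix x y c assume x: "x \<in> carr E"
    show "canonical_embedding E x \<in> carr (bidual E)" using mem x .
    show "canonical_embedding E (vsmul E c x) = vsmul (bidual E) c (canonical_embedding E x)"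
      using x linear_mapD(3)[OF dual_linear x] by (auto simp: canonical_embedding_def)
    assume y: "y \<in> carr E"
    show "canonical_embedding E (vadd E x y) = vadd (bidual E) (canonical_embedding E x) (canonical_embedding E y)"
      using linear_mapD(2)[OF dual_linear x y] by (auto simp: canonical_embedding_def)
  qed
  show "vnorm (bidual E) (canonical_embedding E x) \<le> vnorm E x" if x: "x \<in> carr E"
    unfolding dual_simps
  proof (rule op_norm_le[OF D.normed_space_axioms])
    fix f assume "f \<in> carr (dual E)"
    then show "vnorm scalar_space (canonical_embedding E x f) \<le> vnorm E x * vnorm (dual E) f"
      using dual_bound[OF E _ x] by (simp add: mult.commute)
  qed (use x in simp)
qed


section \<open>Operators of finite rank and finite dimensional spaces\<close>

text \<open>The operators of the form \<open>x \<mapsto> \<Sum>\<^sub>i g\<^sub>i(x) c\<^sub>i\<close> with functionals \<open>g\<^sub>i\<close> in \<open>\<Phi>\<close>. The inductive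
  form replaces the handling of sums of vectors by a rule induction that adds one summand.\<close>

inductive_set finite_rank ::
  "('u, 'k :: real_or_complex, 'm) vspace_scheme \<Rightarrow> ('u \<Rightarrow> 'k) set \<Rightarrow> ('u \<Rightarrow> 'u) set"
  for V :: "('u, 'k, 'm) vspace_scheme" and \<Phi> :: "('u \<Rightarrow> 'k) set"
  where
    zero: "(\<lambda>x. vzero V) \<in> finite_rank V \<Phi>"
  | add: "S \<in> finite_rank V \<Phi> \<Longrightarrow> g \<in> \<Phi> \<Longrightarrow> c \<in> carr V \<Longrightarrow>
      (\<lambda>x. vadd V (S x) (vsmul V (g x) c)) \<in> finite_rank V \<Phi>"

text \<open>Two instances are needed: the dual of a normed space, and on a bidual the evaluations at the
  elements of the dual.\<close>

locale separating_functionals = lin_space V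
  for V :: "('u, 'k :: real_or_complex, 'm) vspace_scheme" +
  fixes \<Phi> :: "('u \<Rightarrow> 'k) set"
  assumes linear: "g \<in> \<Phi> \<Longrightarrow> linear_map V scalar_space g"
    and combination: "g \<in> \<Phi> \<Longrightarrow> h \<in> \<Phi> \<Longrightarrow> \<exists>k\<in>\<Phi>. \<forall>x\<in>carr V. k x = g x + a * h x"
    and separates: "x \<in> carr V \<Longrightarrow> (\<And>g. g \<in> \<Phi> \<Longrightarrow> g x = 0) \<Longrightarrow> x = vzero V"
begin

lemma finite_rank_linear:
  assumes "S \<in> finite_rank V \<Phi>"
  shows "linear_map V V S"
  using assms
proof induction
  case (add S g c)
  have *: "S x \<in> carr V" "S (vadd V x y) = vadd V (S x) (S y)" "S (vsmul V a x) = vsmul V a (S x)"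
    "g (vadd V x y) = g x + g y" "g (vsmul V a x) = a * g x"
    if "x \<in> carr V" "y \<in> carr V" for x y a
    using add.IH linear[OF add.hyps(2)] that by (auto simp: linear_map_def)
  show ?case
    unfolding linear_map_def
    using add.hyps(3) by (auto simp: * smul_add_left smul_add_right smul_smul add_ac)
qed (auto simp: linear_map_def)

text \<open>This is where the closure of \<open>\<Phi>\<close> under linear combinations enters: \<open>g \<circ> (id - S)\<close> equals
  \<open>g - \<Sum>\<^sub>i g(c\<^sub>i) g\<^sub>i\<close>.\<close>

lemma finite_rank_residual:
  assumes "S \<in> finite_rank V \<Phi>" and g: "g \<in> \<Phi>"
  shows "\<exists>k\<in>\<Phi>. \<forall>x\<in>carr V. k x = g (vdiff V x (S x))"
  using assms(1)
proof induction
  case zero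
  show ?case using g by (intro bexI[of _ g]) auto
next
  case (add S h c)
  then obtain k where k: "k \<in> \<Phi>" "\<And>x. x \<in> carr V \<Longrightarrow> k x = g (vdiff V x (S x))" by blast
  obtain k' where k': "k' \<in> \<Phi>" "\<And>x. x \<in> carr V \<Longrightarrow> k' x = k x + (- g c) * h x"
    using combination[OF k(1) add.hyps(2)] by blast
  have "k' x = g (vdiff V x (vadd V (S x) (vsmul V (h x) c)))" if x: "x \<in> carr V" for x
    using x add.hyps(3) k(2)[OF x] k'(2)[OF x] linear_mapD(1)[OF finite_rank_linear[OF add.hyps(1)] x]
    by (simp add: linear_mapD(2,3)[OF linear[OF g]]
        linear_functional_vdiff[OF lin_space_axioms linear[OF g]])
  then show ?case using k'(1) by blast
qed

text \<open>If \<open>S\<close> already fixes the points treated so far and \<open>y = b - S b \<noteq> 0\<close>, choose a functional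
  \<open>g\<close> with \<open>g y \<noteq> 0\<close> and add to \<open>S x\<close> the multiple \<open>g(x - S x) / g(y)\<close> of \<open>y\<close>. The correction
  vanishes at the points fixed by \<open>S\<close> and equals \<open>y\<close> at \<open>b\<close>.\<close>

lemma finite_rank_fixing:
  assumes "finite B" "B \<subseteq> carr V"
  shows "\<exists>S\<in>finite_rank V \<Phi>. \<forall>b\<in>B. S b = b"
  using assms
proof induction
  case empty
  then show ?case using finite_rank.zero by blast
next
  case (insert b B)
  then obtain S where S: "S \<in> finite_rank V \<Phi>" "\<And>b. b \<in> B \<Longrightarrow> S b = b" by auto
  note S_closed = linear_mapD(1)[OF finite_rank_linear[OF S(1)]]
  have b: "b \<in> carr V" using insert.prems by simp
  define y where "y = vdiff V b (S b)"
  have y: "y \<in> carr V" using b S_closed by (simp add: y_def)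
  show ?case
  proof (cases "y = vzero V")
    case True
    then have "S b = b" using b S_closed by (simp add: y_def vdiff_eq_zero)
    then show ?thesis using S by blast
  next
    case False
    then obtain g where g: "g \<in> \<Phi>" "g y \<noteq> 0" using separates y by blast
    obtain k where k: "k \<in> \<Phi>" "\<And>x. x \<in> carr V \<Longrightarrow> k x = g (vdiff V x (S x))"
      using finite_rank_residual[OF S(1) g(1)] by blast
    define S' where "S' x = vadd V (S x) (vsmul V (k x) (vsmul V (inverse (g y)) y))" for x
    have "S' \<in> finite_rank V \<Phi>"
      unfolding S'_def using S(1) k(1) y by (intro finite_rank.add) auto
    moreover have "S' b = b"
    proof -
      have "k b = g y" using k(2)[OF b] by (simp add: y_def)
      then have "S' b = vadd V (S b) y"
        using g(2) y by (simp add: S'_def flip: smul_smul)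
      then show ?thesis using b S_closed by (simp add: y_def add_vdiff)
    qed
    moreover have "S' x = x" if "x \<in> B" for x
    proof -
      have x: "x \<in> carr V" using that insert.prems by blast
      have "vdiff V x (S x) = vzero V" using S(2)[OF that] x by (simp add: vdiff_eq_zero)
      then have "k x = 0"
        using k(2)[OF x] linear_map_zero[OF lin_space_axioms lin_space_scalar_space linear[OF g(1)]]
        by simp
      then show ?thesis using S(2)[OF that] x y by (simp add: S'_def)
    qed
    ultimately show ?thesis by blast
  qed
qed

lemma finite_dim_identity:
  assumes "finite_dim V"
  obtains S where "S \<in> finite_rank V \<Phi>" "\<And>x. x \<in> carr V \<Longrightarrow> S x = x"
proof -
  obtain B where B: "finite B" "B \<subseteq> carr V" "lspan V B = carr V"
    using assms by (auto simp: finite_dim_def)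
  obtain S where S: "S \<in> finite_rank V \<Phi>" "\<And>b. b \<in> B \<Longrightarrow> S b = b"
    using finite_rank_fixing[OF B(1,2)] by blast
  have "S x = x" if "x \<in> carr V" for x
    using linear_map_fixing_span[OF lin_space_axioms finite_rank_linear[OF S(1)] B(2,3) S(2) that] .
  with S(1) show ?thesis by (rule that)
qed

end

lemma separating_functionals_dual:
  assumes E: "normed_space E"
  shows "separating_functionals E (carr (dual E))"
proof -
  interpret E: normed_space E by fact
  show ?thesis
  proof (unfold_locales, goal_cases)
    case (1 g)
    then show ?case by (rule dual_linear)
  next
    case (2 g h a)
    then show ?case
      by (intro bexI[OF _ dual_combination[OF E, of g h a]]) auto
  next
    case (3 x)
    then show ?case using dual_separates[OF E] by blast
  qed
qed

text \<open>The identity of \<open>F\<close> is \<open>\<Sum>\<^sub>i g\<^sub>i(\<cdot>) c\<^sub>i\<close> with bounded \<open>g\<^sub>i\<close>, so \<open>R = \<Sum>\<^sub>i g\<^sub>i(\<cdot>) R c\<^sub>i\<close> is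
  bounded. The next two lemmas use the same representation of the identity: the values of the
  \<open>g\<^sub>i\<close> on the unit ball have finite nets in the scalar field, and \<open>\<Theta>\<close> is the evaluation at
  \<open>\<Sum>\<^sub>i \<Theta>(g\<^sub>i) c\<^sub>i\<close>.\<close>

lemma finite_dim_cont_linear:
  assumes F: "normed_space F" and G: "normed_space G" and fin: "finite_dim F"
    and R: "linear_map F G R"
  shows "cont_linear F G R"
proof -
  interpret F: normed_space F by fact
  interpret G: normed_space G by fact
  interpret separating_functionals F "carr (dual F)" using F by (rule separating_functionals_dual)
  have "\<exists>C. \<forall>x\<in>carr F. vnorm G (R (S x)) \<le> C * vnorm F x" if "S \<in> finite_rank F (carr (dual F))" for S
    using that
  proof induction
    case zero
    show ?case
      using linear_map_zero[OF F.lin_space_axioms G.lin_space_axioms R] by (intro exI[of _ 0]) auto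
  next
    case (add S g c)
    then obtain C where C: "\<And>x. x \<in> carr F \<Longrightarrow> vnorm G (R (S x)) \<le> C * vnorm F x" by blast
    have "vnorm G (R (vadd F (S x) (vsmul F (g x) c))) \<le> (C + vnorm (dual F) g * vnorm G (R c)) * vnorm F x"
      if x: "x \<in> carr F" for x
    proof -
      have Sx: "S x \<in> carr F" using linear_mapD(1)[OF finite_rank_linear[OF add.hyps(1)] x] .
      have "R (vadd F (S x) (vsmul F (g x) c)) = vadd G (R (S x)) (vsmul G (g x) (R c))"
        using R Sx add.hyps(3) by (simp add: linear_mapD)
      also have "vnorm G \<dots> \<le> vnorm G (R (S x)) + norm (g x) * vnorm G (R c)"
        using R Sx add.hyps(3) by (metis G.norm_smul G.norm_triangle G.smul_closed linear_mapD(1))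
      also have "\<dots> \<le> C * vnorm F x + (vnorm (dual F) g * vnorm F x) * vnorm G (R c)"
        using C[OF x] dual_bound[OF F add.hyps(2) x] linear_mapD(1)[OF R add.hyps(3)]
        by (intro add_mono mult_right_mono) auto
      finally show ?thesis by (simp add: algebra_simps)
    qed
    then show ?case by blast
  qed
  moreover obtain S where "S \<in> finite_rank F (carr (dual F))" "\<And>x. x \<in> carr F \<Longrightarrow> S x = x"
    using finite_dim_identity[OF fin] by blast
  ultimately show ?thesis using R unfolding cont_linear_def by force
qed

lemma finite_dim_unit_ball_net:
  assumes F: "normed_space F" and fin: "finite_dim F" and "\<eta> > 0"
  obtains N where "finite N" "N \<subseteq> carr F"
    "\<And>x. x \<in> carr F \<Longrightarrow> vnorm F x \<le> 1 \<Longrightarrow> \<exists>v\<in>N. vnorm F (vdiff F x v) \<le> \<eta>"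
proof -
  interpret F: normed_space F by fact
  interpret separating_functionals F "carr (dual F)" using F by (rule separating_functionals_dual)
  have "\<exists>N. finite N \<and> N \<subseteq> carr F \<and>
      (\<forall>x\<in>carr F. vnorm F x \<le> 1 \<longrightarrow> (\<exists>v\<in>N. vnorm F (vdiff F (S x) v) \<le> \<eta>))"
    if "S \<in> finite_rank F (carr (dual F))" "\<eta> > 0" for S \<eta>
    using that
  proof (induction arbitrary: \<eta>)
    case zero
    then show ?case by (intro exI[of _ "{vzero F}"]) auto
  next
    case (add S g c)
    obtain N where N: "finite N" "N \<subseteq> carr F"
      "\<And>x. x \<in> carr F \<Longrightarrow> vnorm F x \<le> 1 \<Longrightarrow> \<exists>v\<in>N. vnorm F (vdiff F (S x) v) \<le> \<eta> / 2"
      using add.IH[of "\<eta> / 2"] add.prems by auto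
    define \<delta> where "\<delta> = \<eta> / (2 * (1 + vnorm F c))"
    have c0: "0 \<le> vnorm F c" using add.hyps(3) by simp
    have \<delta>: "\<delta> > 0" using add.prems c0 by (simp add: \<delta>_def)
    have \<delta>c: "\<delta> * vnorm F c \<le> \<eta> / 2"
    proof -
      have "\<delta> * vnorm F c \<le> \<delta> * (1 + vnorm F c)" using \<delta> by (intro mult_left_mono) auto
      also have "\<dots> = \<eta> / 2"
        using add_pos_nonneg[OF zero_less_one c0] by (simp add: \<delta>_def divide_simps)
      finally show ?thesis .
    qed
    obtain Z :: "'b set" where Z: "finite Z"
      "\<And>a. norm a \<le> vnorm (dual F) g \<Longrightarrow> \<exists>t\<in>Z. norm (a - t) \<le> \<delta>"
      using finite_scalar_net[OF \<delta>, of "vnorm (dual F) g"] by blast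
    define N' where "N' = (\<lambda>(v, t). vadd F v (vsmul F t c)) ` (N \<times> Z)"
    have "\<exists>w\<in>N'. vnorm F (vdiff F (vadd F (S x) (vsmul F (g x) c)) w) \<le> \<eta>"
      if x: "x \<in> carr F" "vnorm F x \<le> 1" for x
    proof -
      obtain v where v: "v \<in> N" "vnorm F (vdiff F (S x) v) \<le> \<eta> / 2" using N(3)[OF x] by blast
      have "vnorm (dual F) g * vnorm F x \<le> vnorm (dual F) g * 1"
        using x(2) normed_space.norm_nonneg[OF normed_space_dual[OF F] add.hyps(2)]
        by (intro mult_left_mono) auto
      then have "norm (g x) \<le> vnorm (dual F) g"
        using dual_bound[OF F add.hyps(2) x(1)] by linarith
      then obtain t where t: "t \<in> Z" "norm (g x - t) \<le> \<delta>" using Z(2) by blast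
      have [simp]: "S x \<in> carr F" "v \<in> carr F" "c \<in> carr F"
        using linear_mapD(1)[OF finite_rank_linear[OF add.hyps(1)] x(1)] v(1) N(2) add.hyps(3) by auto
      have "vdiff F (vadd F (S x) (vsmul F (g x) c)) (vadd F v (vsmul F t c))
          = vadd F (vdiff F (S x) v) (vsmul F (g x - t) c)"
        by (simp add: F.vdiff_add_add F.vdiff_smul_left)
      also have "vnorm F \<dots> \<le> vnorm F (vdiff F (S x) v) + norm (g x - t) * vnorm F c"
        by (metis F.norm_smul F.norm_triangle F.smul_closed F.vdiff_closed \<open>S x \<in> carr F\<close> \<open>c \<in> carr F\<close> \<open>v \<in> carr F\<close>)
      also have "\<dots> \<le> \<eta> / 2 + \<delta> * vnorm F c"
        using v(2) t(2) c0 by (intro add_mono mult_right_mono) auto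
      also have "\<dots> \<le> \<eta>" using \<delta>c by simp
      finally show ?thesis using v(1) t(1) unfolding N'_def by force
    qed
    moreover have "finite N'" using N(1) Z(1) by (simp add: N'_def)
    moreover have "N' \<subseteq> carr F" using N(2) add.hyps(3) by (auto simp: N'_def)
    ultimately show ?case by (intro exI[of _ N']) simp
  qed
  moreover obtain S where "S \<in> finite_rank F (carr (dual F))" "\<And>x. x \<in> carr F \<Longrightarrow> S x = x"
    using finite_dim_identity[OF fin] by blast
  ultimately obtain N where "finite N" "N \<subseteq> carr F"
    "\<forall>x\<in>carr F. vnorm F x \<le> 1 \<longrightarrow> (\<exists>v\<in>N. vnorm F (vdiff F x v) \<le> \<eta>)"
    using \<open>\<eta> > 0\<close> by metis
  then show ?thesis using that by blast
qed

lemma finite_dim_reflexive: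
  assumes F: "normed_space F" and fin: "finite_dim F" and \<Theta>: "\<Theta> \<in> carr (bidual F)"
  shows "\<exists>y\<in>carr F. \<forall>h\<in>carr (dual F). h y = \<Theta> h"
proof -
  interpret F: normed_space F by fact
  interpret D: normed_space "dual F" using F by (rule normed_space_dual)
  interpret separating_functionals F "carr (dual F)" using F by (rule separating_functionals_dual)
  note \<Theta>D = linear_mapD[OF dual_linear[OF \<Theta>], unfolded scalar_space_simps]
  have "(\<exists>y\<in>carr F. \<forall>h\<in>carr (dual F). (\<lambda>x\<in>carr F. h (S x)) \<in> carr (dual F) \<and>
      h y = \<Theta> (\<lambda>x\<in>carr F. h (S x)))"
    if "S \<in> finite_rank F (carr (dual F))" for S
    using that
  proof induction
    case zero
    show ?case
    proof (intro bexI[of _ "vzero F"] ballI)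
      fix h assume "h \<in> carr (dual F)"
      then have h0: "h (vzero F) = 0"
        using linear_map_zero[OF F.lin_space_axioms lin_space_scalar_space dual_linear] by simp
      have "\<Theta> (\<lambda>x\<in>carr F. 0) = 0"
        using linear_map_zero[OF D.lin_space_axioms lin_space_scalar_space dual_linear[OF \<Theta>]] by simp
      then show "(\<lambda>x\<in>carr F. h (vzero F)) \<in> carr (dual F) \<and> h (vzero F) = \<Theta> (\<lambda>x\<in>carr F. h (vzero F))"
        using h0 zero_in_dual[OF F] by simp
    qed simp
  next
    case (add S g c)
    then obtain y where y: "y \<in> carr F"
      "\<And>h. h \<in> carr (dual F) \<Longrightarrow> (\<lambda>x\<in>carr F. h (S x)) \<in> carr (dual F) \<and> h y = \<Theta> (\<lambda>x\<in>carr F. h (S x))"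
      by blast
    show ?case
    proof (intro bexI[of _ "vadd F y (vsmul F (\<Theta> g) c)"] ballI)
      fix h assume h: "h \<in> carr (dual F)"
      note hD = linear_mapD[OF dual_linear[OF h], simplified]
      have "(\<lambda>x\<in>carr F. h (vadd F (S x) (vsmul F (g x) c))) =
          vadd (dual F) (\<lambda>x\<in>carr F. h (S x)) (vsmul (dual F) (h c) g)"
        using linear_mapD(1)[OF finite_rank_linear[OF add.hyps(1)]] add.hyps(3)
        by (auto simp: hD)
      moreover have "\<dots> \<in> carr (dual F)"
        using y(2)[OF h] add.hyps(2) D.smul_closed by (intro D.add_closed) auto
      moreover have "\<Theta> (vadd (dual F) (\<lambda>x\<in>carr F. h (S x)) (vsmul (dual F) (h c) g)) = h y + h c * \<Theta> g"
        using y(2)[OF h] add.hyps(2) D.smul_closed[OF add.hyps(2)]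
        by (simp add: \<Theta>D del: dual_simps)
      ultimately show "(\<lambda>x\<in>carr F. h (vadd F (S x) (vsmul F (g x) c))) \<in> carr (dual F) \<and>
          h (vadd F y (vsmul F (\<Theta> g) c)) = \<Theta> (\<lambda>x\<in>carr F. h (vadd F (S x) (vsmul F (g x) c)))"
        using y(1) add.hyps(3) by (simp add: hD mult.commute)
    qed (use y(1) add.hyps(3) in simp)
  qed
  moreover obtain S where S: "S \<in> finite_rank F (carr (dual F))" "\<And>x. x \<in> carr F \<Longrightarrow> S x = x"
    using finite_dim_identity[OF fin] by blast
  ultimately obtain y where y: "y \<in> carr F" "\<And>h. h \<in> carr (dual F) \<Longrightarrow> h y = \<Theta> (\<lambda>x\<in>carr F. h (S x))"
    by blast
  have "(\<lambda>x\<in>carr F. h (S x)) = h" if "h \<in> carr (dual F)" for h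
    using that S(2) by (auto simp: mem_dual extensional_def)
  then show ?thesis using y by auto
qed


section \<open>Quotients\<close>

text \<open>For the norm of \<open>E\<close> this is the quotient norm; for the maximum norm on \<open>E\<^sup>N\<close> it is the
  distance that is used to separate a point from a subspace.\<close>

definition quotient_seminorm ::
  "('u, 'k, 'm) vspace_scheme \<Rightarrow> ('u \<Rightarrow> real) \<Rightarrow> 'u set \<Rightarrow> 'u \<Rightarrow> real"
  where "quotient_seminorm V p L x = Inf ((\<lambda>l. p (vadd V x l)) ` L)"

context lin_space
begin

lemma quotient_seminorm_le:
  assumes "seminorm_on V p" "lin_subspace V L" "x \<in> carr V" "l \<in> L"
  shows "quotient_seminorm V p L x \<le> p (vadd V x l)"
  unfolding quotient_seminorm_def
proof (rule cInf_lower)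
  show "bdd_below ((\<lambda>l. p (vadd V x l)) ` L)"
    using assms lin_subspaceD(1)[OF assms(2)]
    by (intro bdd_belowI[of _ 0]) (auto simp: seminorm_on_def)
qed (use assms in simp)

lemma quotient_seminorm_less:
  assumes "lin_subspace V L" "quotient_seminorm V p L x < t"
  obtains l where "l \<in> L" "p (vadd V x l) < t"
proof -
  have "L \<noteq> {}" using lin_subspaceD(2)[OF assms(1)] by blast
  then show ?thesis
    using cInf_lessD[of "(\<lambda>l. p (vadd V x l)) ` L" t] assms(2) that
    by (auto simp: quotient_seminorm_def)
qed

lemma seminorm_quotient:
  assumes p: "seminorm_on V p" and L: "lin_subspace V L"
  shows "seminorm_on V (quotient_seminorm V p L)"
proof (rule seminormI)
  note L_carr [simp] = lin_subspaceD(1)[OF L]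
  have ne: "L \<noteq> {}" using lin_subspaceD(2)[OF L] by blast
  fix x assume [simp]: "x \<in> carr V"
  show "0 \<le> quotient_seminorm V p L x"
    unfolding quotient_seminorm_def using ne
    by (intro cInf_greatest) (auto intro!: seminormD(1)[OF p])
  {
    fix y assume [simp]: "y \<in> carr V"
    show "quotient_seminorm V p L (vadd V x y) \<le> quotient_seminorm V p L x + quotient_seminorm V p L y"
    proof (rule field_le_epsilon)
      fix e :: real assume "e > 0"
      then have less: "quotient_seminorm V p L x < quotient_seminorm V p L x + e / 2"
        "quotient_seminorm V p L y < quotient_seminorm V p L y + e / 2" by auto
      obtain l where l: "l \<in> L" "p (vadd V x l) < quotient_seminorm V p L x + e / 2"
        using quotient_seminorm_less[OF L less(1)] .
      obtain l' where l': "l' \<in> L" "p (vadd V y l') < quotient_seminorm V p L y + e / 2"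
        using quotient_seminorm_less[OF L less(2)] .
      have "quotient_seminorm V p L (vadd V x y) \<le> p (vadd V (vadd V x y) (vadd V l l'))"
        using l l' lin_subspaceD(3)[OF L] by (intro quotient_seminorm_le[OF p L]) auto
      also have "vadd V (vadd V x y) (vadd V l l') = vadd V (vadd V x l) (vadd V y l')"
        using l l' by (simp add: add_ac)
      also have "p \<dots> \<le> p (vadd V x l) + p (vadd V y l')"
        using l l' by (intro seminormD[OF p]) auto
      finally show "quotient_seminorm V p L (vadd V x y)
          \<le> quotient_seminorm V p L x + quotient_seminorm V p L y + e"
        using l l' by linarith
    qed
  }
  fix c
  show "quotient_seminorm V p L (vsmul V c x) \<le> norm c * quotient_seminorm V p L x"
  proof (rule field_le_epsilon)
    fix e :: real assume e: "e > 0"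
    have pos: "e / (norm c + 1) > 0" using e by (simp add: add_nonneg_pos)
    then have "quotient_seminorm V p L x < quotient_seminorm V p L x + e / (norm c + 1)" by simp
    then obtain l where l: "l \<in> L" "p (vadd V x l) < quotient_seminorm V p L x + e / (norm c + 1)"
      by (rule quotient_seminorm_less[OF L])
    have "quotient_seminorm V p L (vsmul V c x) \<le> p (vadd V (vsmul V c x) (vsmul V c l))"
      using l lin_subspaceD(4)[OF L] by (intro quotient_seminorm_le[OF p L]) auto
    also have "\<dots> = norm c * p (vadd V x l)"
      using l by (simp add: seminormD(3)[OF p] flip: smul_add_right)
    also have "\<dots> \<le> norm c * (quotient_seminorm V p L x + e / (norm c + 1))"
      using l by (intro mult_left_mono) auto
    also have "\<dots> \<le> norm c * quotient_seminorm V p L x + e"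
    proof -
      have "norm c * (e / (norm c + 1)) \<le> (norm c + 1) * (e / (norm c + 1))"
        using pos by (intro mult_right_mono) auto
      also have "\<dots> = e" by (simp add: add_nonneg_eq_0_iff)
      finally show ?thesis by (simp add: distrib_left)
    qed
    finally show "quotient_seminorm V p L (vsmul V c x) \<le> norm c * quotient_seminorm V p L x + e" .
  qed
qed

lemma quotient_seminorm_subspace:
  assumes "seminorm_on V p" "lin_subspace V L" "l \<in> L"
  shows "quotient_seminorm V p L l = 0"
proof -
  have l [simp]: "l \<in> carr V" using lin_subspaceD(1)[OF assms(2,3)] .
  have "p (vzero V) = 0" using seminormD(3)[OF assms(1) l, of 0] by simp
  then have "quotient_seminorm V p L l \<le> 0"
    using quotient_seminorm_le[OF assms(1,2) l lin_subspaceD(4)[OF assms(2,3), of "- 1"]] by simp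
  then show ?thesis
    using seminormD(1)[OF seminorm_quotient[OF assms(1,2)] l] by simp
qed

end

lemma lin_space_image:
  assumes V: "lin_space V" and carr: "carr W = T ` carr V" and zero: "vzero W = T (vzero V)"
    and add: "\<And>x y. x \<in> carr V \<Longrightarrow> y \<in> carr V \<Longrightarrow> vadd W (T x) (T y) = T (vadd V x y)"
    and smul: "\<And>c x. x \<in> carr V \<Longrightarrow> vsmul W c (T x) = T (vsmul V c x)"
  shows "lin_space W"
proof -
  interpret V: lin_space V by fact
  show ?thesis
  proof (unfold_locales, goal_cases)
    case (7 x)
    then obtain u where "u \<in> carr V" "x = T u" using carr by auto
    then show ?case using carr zero add by (intro bexI[of _ "T (vsmul V (- 1) u)"]) auto
  qed (auto simp: carr zero add smul V.add_assoc V.smul_add_right V.smul_add_left V.smul_smul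
      intro: arg_cong[OF V.add_commute])
qed

context normed_space
begin

context
  fixes L
  assumes L: "lin_subspace E L"
begin

lemma coset_eq_image: "coset_of E L x = vadd E x ` L"
  by (auto simp: coset_of_def)

lemma coset_self: "x \<in> carr E \<Longrightarrow> x \<in> coset_of E L x"
  unfolding coset_eq_image using lin_subspaceD(2)[OF L] by (intro image_eqI[of _ _ "vzero E"]) auto

lemma coset_absorb:
  assumes x: "x \<in> carr E" and y: "y \<in> coset_of E L x"
  shows "coset_of E L y = coset_of E L x"
proof -
  note [simp] = lin_subspaceD(1)[OF L]
  have sub: "coset_of E L b \<subseteq> coset_of E L a" if a: "a \<in> carr E" and b: "b \<in> coset_of E L a" for a b
  proof -
    obtain l where l: "l \<in> L" "b = vadd E a l" using b by (auto simp: coset_of_def)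
    show ?thesis
    proof
      fix z assume "z \<in> coset_of E L b"
      then obtain m where m: "m \<in> L" "z = vadd E b m" by (auto simp: coset_of_def)
      then have "z = vadd E a (vadd E l m)" using l a by (simp add: add_assoc)
      then show "z \<in> coset_of E L a"
        unfolding coset_of_def using lin_subspaceD(3)[OF L l(1) m(1)] by blast
    qed
  qed
  obtain l where l: "l \<in> L" "y = vadd E x l" using y by (auto simp: coset_of_def)
  then have "x = vadd E y (vsmul E (- 1) l)" using x by (simp add: add_assoc)
  then have "x \<in> coset_of E L y"
    unfolding coset_of_def using lin_subspaceD(4)[OF L l(1), of "- 1"] by blast
  moreover have "y \<in> carr E" using l x by simp
  ultimately show ?thesis using sub[OF x y] sub[of y x] by blast
qed

lemma coset_add:
  assumes x: "x \<in> carr E" and y: "y \<in> carr E"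
  shows "vadd (quotient_space E L) (coset_of E L x) (coset_of E L y) = coset_of E L (vadd E x y)"
proof -
  note [simp] = lin_subspaceD(1)[OF L] x y
  have "{vadd E a b | a b. a \<in> coset_of E L x \<and> b \<in> coset_of E L y} = coset_of E L (vadd E x y)"
  proof (intro subset_antisym subsetI)
    fix z assume "z \<in> {vadd E a b | a b. a \<in> coset_of E L x \<and> b \<in> coset_of E L y}"
    then obtain l m where lm: "l \<in> L" "m \<in> L" "z = vadd E (vadd E x l) (vadd E y m)"
      by (auto simp: coset_of_def)
    then have "z = vadd E (vadd E x y) (vadd E l m)" by (simp add: add_ac)
    then show "z \<in> coset_of E L (vadd E x y)"
      unfolding coset_of_def using lin_subspaceD(3)[OF L lm(1,2)] by blast
  next
    fix z assume "z \<in> coset_of E L (vadd E x y)"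
    then obtain l where l: "l \<in> L" "z = vadd E (vadd E x y) l" by (auto simp: coset_of_def)
    then have "z = vadd E (vadd E x l) y" by (simp add: add_ac)
    moreover have "vadd E x l \<in> coset_of E L x" using l(1) by (auto simp: coset_of_def)
    ultimately show "z \<in> {vadd E a b | a b. a \<in> coset_of E L x \<and> b \<in> coset_of E L y}"
      using coset_self[OF y] by blast
  qed
  then show ?thesis by (simp add: quotient_space_def)
qed

lemma coset_smul:
  assumes x: "x \<in> carr E"
  shows "vsmul (quotient_space E L) c (coset_of E L x) = coset_of E L (vsmul E c x)"
proof -
  note [simp] = lin_subspaceD(1)[OF L] x
  have "{vadd E (vsmul E c a) l | a l. a \<in> coset_of E L x \<and> l \<in> L} = coset_of E L (vsmul E c x)"
  proof (intro subset_antisym subsetI)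
    fix z assume "z \<in> {vadd E (vsmul E c a) l | a l. a \<in> coset_of E L x \<and> l \<in> L}"
    then obtain l m where lm: "l \<in> L" "m \<in> L" "z = vadd E (vsmul E c (vadd E x l)) m"
      by (auto simp: coset_of_def)
    then have "z = vadd E (vsmul E c x) (vadd E (vsmul E c l) m)"
      by (simp add: smul_add_right add_assoc)
    then show "z \<in> coset_of E L (vsmul E c x)"
      unfolding coset_of_def using lin_subspaceD(3)[OF L lin_subspaceD(4)[OF L lm(1)] lm(2)] by blast
  next
    fix z assume "z \<in> coset_of E L (vsmul E c x)"
    then show "z \<in> {vadd E (vsmul E c a) l | a l. a \<in> coset_of E L x \<and> l \<in> L}"
      using coset_self[OF x] unfolding coset_of_def[of E L "vsmul E c x"] by blast
  qed
  then show ?thesis by (simp add: quotient_space_def)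
qed

lemma coset_zero: "coset_of E L (vzero E) = L"
  using lin_subspaceD(1)[OF L] by (force simp: coset_eq_image image_iff)

lemma quotient_norm_coset:
  "vnorm (quotient_space E L) (coset_of E L x) = quotient_seminorm E (vnorm E) L x"
  by (simp add: quotient_space_def coset_eq_image quotient_seminorm_def image_image)

lemma quotient_space_carr: "carr (quotient_space E L) = coset_of E L ` carr E"
  and quotient_space_zero: "vzero (quotient_space E L) = L"
  by (simp_all add: quotient_space_def)

lemma normed_space_quotient:
  assumes closed: "closed_in_space E L"
  shows "normed_space (quotient_space E L)"
proof -
  note sem = seminorm_quotient[OF seminorm_norm L]
  interpret Q: lin_space "quotient_space E L"
    by (rule lin_space_image[OF lin_space_axioms, where T = "coset_of E L"])
      (simp_all add: quotient_space_carr quotient_space_zero coset_zero coset_add coset_smul)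
  have zero: "quotient_seminorm E (vnorm E) L x = 0 \<longleftrightarrow> coset_of E L x = L" if x: "x \<in> carr E" for x
  proof
    assume 0: "quotient_seminorm E (vnorm E) L x = 0"
    have "\<exists>y\<in>L. vnorm E (vdiff E x y) < \<delta>" if "\<delta> > 0" for \<delta>
    proof -
      have "quotient_seminorm E (vnorm E) L x < \<delta>" using 0 that by simp
      then obtain l where l: "l \<in> L" "vnorm E (vadd E x l) < \<delta>"
        by (rule quotient_seminorm_less[OF L])
      have "vdiff E x (vsmul E (- 1) l) = vadd E x l"
        using lin_subspaceD(1)[OF L l(1)] by (simp add: vdiff_def flip: smul_smul)
      then show ?thesis using l lin_subspaceD(4)[OF L l(1)] by metis
    qed
    then have "x \<in> L" using closed x unfolding closed_in_space_def by blast
    then have "x \<in> coset_of E L (vzero E)" by (simp add: coset_zero)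
    from coset_absorb[OF zero_closed this] show "coset_of E L x = L" by (simp add: coset_zero)
  next
    assume "coset_of E L x = L"
    then have "x \<in> L" using coset_self[OF x] by simp
    then show "quotient_seminorm E (vnorm E) L x = 0"
      by (rule quotient_seminorm_subspace[OF seminorm_norm L])
  qed
  have "vnorm (quotient_space E L) L = 0"
    using zero[OF zero_closed] quotient_norm_coset[of "vzero E"] by (simp add: coset_zero)
  then show ?thesis
    by unfold_locales
      (auto simp: quotient_space_carr quotient_space_zero quotient_norm_coset zero coset_add coset_smul
        seminormD[OF sem])
qed

lemma coset_rep_in:
  assumes "x \<in> carr E"
  shows "coset_rep (coset_of E L x) \<in> coset_of E L x"
  unfolding coset_rep_def using coset_self[OF assms] by (rule someI)

lemma inj_on_coset_rep: "inj_on coset_rep (carr (quotient_space E L))"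
proof (rule inj_onI)
  fix A B assume "A \<in> carr (quotient_space E L)" "B \<in> carr (quotient_space E L)"
    and eq: "coset_rep A = coset_rep B"
  then obtain x y where x: "x \<in> carr E" "A = coset_of E L x" and y: "y \<in> carr E" "B = coset_of E L y"
    by (auto simp: quotient_space_carr)
  then show "A = B"
    using coset_absorb[OF x(1)] coset_absorb[OF y(1)] coset_rep_in[OF x(1)] coset_rep_in[OF y(1)] eq
    by metis
qed

lemma quotient_copy:
  assumes "closed_in_space E L"
  shows "normed_space (quotient_copy E L)"
    and "linear_map E (quotient_copy E L) (quotient_map E L)"
    and "x \<in> carr E \<Longrightarrow> vnorm (quotient_copy E L) (quotient_map E L x) \<le> vnorm E x"
    and "finite_dim (quotient_space E L) \<Longrightarrow> finite_dim (quotient_copy E L)"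
proof -
  note Q = normed_space_quotient[OF assms]
  have iso: "isometric_map (quotient_space E L) (quotient_copy E L) coset_rep"
    unfolding quotient_copy_def by (rule isometric_map_copy_along[OF Q inj_on_coset_rep])
  show N: "normed_space (quotient_copy E L)"
    unfolding quotient_copy_def by (rule normed_space_copy_along[OF Q inj_on_coset_rep])
  have "linear_map E (quotient_space E L) (coset_of E L)"
    by (simp add: linear_map_def quotient_space_carr coset_add coset_smul)
  with iso show "linear_map E (quotient_copy E L) (quotient_map E L)"
    unfolding quotient_map_def comp_def isometric_map_def by (blast intro: linear_map_comp)
  show "vnorm (quotient_copy E L) (quotient_map E L x) \<le> vnorm E x" if x: "x \<in> carr E"
    using iso x quotient_seminorm_le[OF seminorm_norm L x lin_subspaceD(2)[OF L]]
    by (simp add: isometric_map_def quotient_map_def quotient_space_carr quotient_norm_coset)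
  assume fin: "finite_dim (quotient_space E L)"
  show "finite_dim (quotient_copy E L)"
  proof (rule finite_dim_linear_image[OF _ _ _ _ fin])
    show "linear_map (quotient_space E L) (quotient_copy E L) coset_rep"
      using iso by (simp add: isometric_map_def)
    show "coset_rep ` carr (quotient_space E L) = carr (quotient_copy E L)"
      by (simp add: quotient_copy_def copy_along_def Let_def)
  qed (use Q N lin_space_of_normed in blast)+
qed

end

end


section \<open>Local reflexivity\<close>

definition function_space ::
  "'i set \<Rightarrow> ('u, 'k :: real_or_complex, 'm) vspace_scheme \<Rightarrow> ('i \<Rightarrow> 'u, 'k) vspace"
  where "function_space N V =
    \<lparr>carr = N \<rightarrow>\<^sub>E carr V, vadd = (\<lambda>g h. \<lambda>v\<in>N. vadd V (g v) (h v)),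
     vzero = (\<lambda>v\<in>N. vzero V), vsmul = (\<lambda>c h. \<lambda>v\<in>N. vsmul V c (h v))\<rparr>"

lemma function_space_simps [simp]:
  "carr (function_space N V) = N \<rightarrow>\<^sub>E carr V"
  "vadd (function_space N V) g h = (\<lambda>v\<in>N. vadd V (g v) (h v))"
  "vzero (function_space N V) = (\<lambda>v\<in>N. vzero V)"
  "vsmul (function_space N V) c h = (\<lambda>v\<in>N. vsmul V c (h v))"
  by (simp_all add: function_space_def)

lemma (in lin_space) lin_space_function_space: "lin_space (function_space N V)"
proof (unfold_locales, goal_cases)
  case (6 h)
  then show ?case by (auto simp: PiE_iff extensional_def fun_eq_iff)
next
  case (7 h)
  then have "vadd V (h v) (vsmul V (- 1) (h v)) = vzero V" if "v \<in> N" for v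
    using that by (simp add: PiE_iff)
  then show ?case using 7 by (intro bexI[of _ "\<lambda>v\<in>N. vsmul V (- 1) (h v)"]) (auto simp: PiE_iff)
next
  case (11 h)
  then show ?case by (auto simp: PiE_iff extensional_def fun_eq_iff)
qed (auto simp: PiE_iff add_assoc smul_add_right smul_add_left smul_smul intro!: restrict_ext
    intro: add_commute)

definition max_norm :: "'i set \<Rightarrow> ('u, 'k) nspace \<Rightarrow> ('i \<Rightarrow> 'u) \<Rightarrow> real"
  where "max_norm N E h = Max (insert 0 ((\<lambda>v. vnorm E (h v)) ` N))"

lemma max_norm_le_iff:
  "finite N \<Longrightarrow> max_norm N E h \<le> t \<longleftrightarrow> 0 \<le> t \<and> (\<forall>v\<in>N. vnorm E (h v) \<le> t)"
  by (simp add: max_norm_def)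

lemma norm_le_max_norm: "finite N \<Longrightarrow> v \<in> N \<Longrightarrow> vnorm E (h v) \<le> max_norm N E h"
  by (simp add: max_norm_def)

lemma max_norm_nonneg: "finite N \<Longrightarrow> 0 \<le> max_norm N E h"
  by (simp add: max_norm_def)

lemma (in normed_space) seminorm_max_norm:
  assumes N: "finite N"
  shows "seminorm_on (function_space N E) (max_norm N E)"
proof -
  interpret P: lin_space "function_space N E" by (rule lin_space_function_space)
  show ?thesis
  proof (rule P.seminormI)
    fix g h and c :: 'k assume g: "g \<in> carr (function_space N E)"
    show "0 \<le> max_norm N E g" using N by (rule max_norm_nonneg)
    have "norm c * vnorm E (g v) \<le> norm c * max_norm N E g" if "v \<in> N" for v
      using norm_le_max_norm[OF N that] by (intro mult_left_mono) auto
    then show "max_norm N E (vsmul (function_space N E) c g) \<le> norm c * max_norm N E g"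
      using g max_norm_nonneg[OF N, of E g] by (auto simp: max_norm_le_iff N norm_smul PiE_iff)
    assume h: "h \<in> carr (function_space N E)"
    have "vnorm E (vadd E (g v) (h v)) \<le> max_norm N E g + max_norm N E h" if "v \<in> N" for v
      using norm_triangle[of "g v" "h v"] norm_le_max_norm[OF N that, of E g]
        norm_le_max_norm[OF N that, of E h] g h that by (force simp: PiE_iff)
    then show "max_norm N E (vadd (function_space N E) g h) \<le> max_norm N E g + max_norm N E h"
      using max_norm_nonneg[OF N, of E g] max_norm_nonneg[OF N, of E h] by (auto simp: max_norm_le_iff N)
  qed
qed

lemma almost_norming_point:
  assumes E: "normed_space E" and f: "f \<in> carr (dual E)" and "e > 0"
  obtains x r where "x \<in> carr E" "vnorm E x \<le> 1" "f x = of_real r" "vnorm (dual E) f - e < r"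
proof -
  interpret E: normed_space E by fact
  have ne: "{vnorm scalar_space (f x) | x. x \<in> carr E \<and> vnorm E x \<le> 1} \<noteq> {}"
    by (auto intro!: exI[of _ "vzero E"])
  have "op_norm E scalar_space f - e < Sup {vnorm scalar_space (f x) | x. x \<in> carr E \<and> vnorm E x \<le> 1}"
    using \<open>e > 0\<close> by (simp add: op_norm_def)
  from less_cSupD[OF ne this] obtain x where
    x: "x \<in> carr E" "vnorm E x \<le> 1" "op_norm E scalar_space f - e < norm (f x)"
    by auto
  define u where "u = (if f x = 0 then 1 else of_real (norm (f x)) / f x)"
  have u: "norm u = 1" "u * f x = of_real (norm (f x))"
    by (auto simp: u_def norm_divide)
  show ?thesis
  proof (rule that[of "vsmul E u x" "norm (f x)"])
    show "vnorm E (vsmul E u x) \<le> 1" using x u(1) by (simp add: E.norm_smul)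
    show "f (vsmul E u x) = of_real (norm (f x))"
      using u(2) linear_mapD(3)[OF dual_linear[OF f] x(1), of u] by simp
  qed (use x in auto)
qed

text \<open>The dual of \<open>E\<^sup>N\<close> with the maximum norm is \<open>(E')\<^sup>N\<close> with the sum of the norms: for the lower
  bound of \<open>\<parallel>\<phi>\<parallel>\<close>, evaluate \<open>\<phi>\<close> at a tuple of points that almost norm the components and are rotated
  such that the components take real values there.\<close>

lemma functional_on_function_space:
  fixes E :: "('u, 'k :: real_or_complex) nspace"
  assumes E: "normed_space E" and N: "finite N"
    and \<phi>: "linear_map (function_space N E) scalar_space \<phi>"
    and bound: "\<And>h. h \<in> N \<rightarrow>\<^sub>E carr E \<Longrightarrow> norm (\<phi> h) \<le> max_norm N E h"
  obtains \<psi> where "\<And>v. v \<in> N \<Longrightarrow> \<psi> v \<in> carr (dual E)"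
    "\<And>h. h \<in> N \<rightarrow>\<^sub>E carr E \<Longrightarrow> \<phi> h = (\<Sum>v\<in>N. \<psi> v (h v))"
    "(\<Sum>v\<in>N. vnorm (dual E) (\<psi> v)) \<le> 1"
proof -
  interpret E: normed_space E by fact
  interpret P: lin_space "function_space N E" by (rule E.lin_space_function_space)
  define \<delta> where "\<delta> v x = (\<lambda>u\<in>N. if u = v then x else vzero E)" for v x
  have \<delta>: "\<delta> v x \<in> N \<rightarrow>\<^sub>E carr E" if "x \<in> carr E" for v x
    using that by (auto simp: \<delta>_def)
  have \<phi>_add: "\<phi> (\<lambda>v\<in>N. vadd E (g v) (h v)) = \<phi> g + \<phi> h"
    if "g \<in> N \<rightarrow>\<^sub>E carr E" "h \<in> N \<rightarrow>\<^sub>E carr E" for g h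
    using linear_mapD(2)[OF \<phi>, of g h] that by simp
  have \<phi>_smul: "\<phi> (\<lambda>v\<in>N. vsmul E c (g v)) = c * \<phi> g" if "g \<in> N \<rightarrow>\<^sub>E carr E" for g c
    using linear_mapD(3)[OF \<phi>, of g c] that by simp
  define \<psi> where "\<psi> v = (\<lambda>x\<in>carr E. \<phi> (\<delta> v x))" for v
  have \<psi>: "\<psi> v \<in> carr (dual E)" if "v \<in> N" for v
    unfolding \<psi>_def
  proof (rule dualI[OF E.lin_space_axioms])
    have "\<delta> v (vadd E x y) = (\<lambda>u\<in>N. vadd E (\<delta> v x u) (\<delta> v y u))"
      "\<delta> v (vsmul E c x) = (\<lambda>u\<in>N. vsmul E c (\<delta> v x u))"
      if "x \<in> carr E" "y \<in> carr E" for x y c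
      using that by (auto simp: \<delta>_def)
    then show "linear_map E scalar_space (\<lambda>x. \<phi> (\<delta> v x))"
      by (auto simp: linear_map_def \<phi>_add \<phi>_smul \<delta>)
    fix x assume x: "x \<in> carr E"
    have "max_norm N E (\<delta> v x) \<le> vnorm E x"
      using x by (simp add: max_norm_le_iff N \<delta>_def)
    then show "norm (\<phi> (\<delta> v x)) \<le> 1 * vnorm E x" using bound[OF \<delta>[OF x], of v] by simp
  qed
  have partial: "\<phi> (\<lambda>u\<in>N. if u \<in> A then h u else vzero E) = (\<Sum>v\<in>A. \<psi> v (h v))"
    if h: "h \<in> N \<rightarrow>\<^sub>E carr E" and "A \<subseteq> N" for h A
    using finite_subset[OF \<open>A \<subseteq> N\<close> N] \<open>A \<subseteq> N\<close>
  proof induction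
    case empty
    show ?case
      using linear_map_zero[OF P.lin_space_axioms lin_space_scalar_space \<phi>]
      by (simp add: restrict_def)
  next
    case (insert v A)
    define h\<^sub>A where "h\<^sub>A = (\<lambda>u\<in>N. if u \<in> A then h u else vzero E)"
    have hv: "h v \<in> carr E" using insert h by (auto simp: PiE_iff)
    have "(\<lambda>u\<in>N. if u \<in> insert v A then h u else vzero E) =
        (\<lambda>u\<in>N. vadd E (\<delta> v (h v) u) (h\<^sub>A u))"
      using insert h by (auto simp: \<delta>_def h\<^sub>A_def PiE_iff intro!: restrict_ext)
    moreover have "h\<^sub>A \<in> N \<rightarrow>\<^sub>E carr E" using h by (auto simp: h\<^sub>A_def PiE_iff)
    ultimately have "\<phi> (\<lambda>u\<in>N. if u \<in> insert v A then h u else vzero E) = \<phi> (\<delta> v (h v)) + \<phi> h\<^sub>A"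
      using \<phi>_add[OF \<delta>[OF hv]] by simp
    moreover have "\<psi> v (h v) = \<phi> (\<delta> v (h v))" using hv by (simp add: \<psi>_def)
    ultimately show ?case
      using insert unfolding h\<^sub>A_def by (simp add: restrict_def)
  qed
  have decomp: "\<phi> h = (\<Sum>v\<in>N. \<psi> v (h v))" if h: "h \<in> N \<rightarrow>\<^sub>E carr E" for h
  proof -
    have "(\<lambda>u\<in>N. if u \<in> N then h u else vzero E) = h"
      using h by (auto simp: PiE_def extensional_def fun_eq_iff)
    then show ?thesis using partial[OF h subset_refl] by simp
  qed
  have "(\<Sum>v\<in>N. vnorm (dual E) (\<psi> v)) \<le> 1"
  proof (rule field_le_epsilon)
    fix e :: real assume "e > 0"
    define e' where "e' = e / (real (card N) + 1)"
    have e': "e' > 0" "real (card N) * e' \<le> e"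
      using \<open>e > 0\<close> by (auto simp: e'_def divide_simps)
    have "\<forall>v\<in>N. \<exists>x. \<exists>r. x \<in> carr E \<and> vnorm E x \<le> 1 \<and> \<psi> v x = of_real r \<and> vnorm (dual E) (\<psi> v) - e' < r"
    proof
      fix v assume "v \<in> N"
      from almost_norming_point[OF E \<psi>[OF this] e'(1)]
      show "\<exists>x. \<exists>r. x \<in> carr E \<and> vnorm E x \<le> 1 \<and> \<psi> v x = of_real r \<and> vnorm (dual E) (\<psi> v) - e' < r"
        by metis
    qed
    then obtain x r where x: "\<And>v. v \<in> N \<Longrightarrow> x v \<in> carr E" "\<And>v. v \<in> N \<Longrightarrow> vnorm E (x v) \<le> 1"
      and r: "\<And>v. v \<in> N \<Longrightarrow> \<psi> v (x v) = of_real (r v)" "\<And>v. v \<in> N \<Longrightarrow> vnorm (dual E) (\<psi> v) - e' < r v"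
      unfolding bchoice_iff by metis
    have xN: "(\<lambda>v\<in>N. x v) \<in> N \<rightarrow>\<^sub>E carr E" using x(1) by auto
    have "(\<Sum>v\<in>N. vnorm (dual E) (\<psi> v)) \<le> (\<Sum>v\<in>N. r v + e')"
      using r(2) by (intro sum_mono) (simp add: less_imp_le algebra_simps less_diff_eq diff_less_eq)
    also have "\<dots> \<le> (\<Sum>v\<in>N. r v) + e" using e'(2) by (simp add: sum.distrib)
    also have "(\<Sum>v\<in>N. r v) \<le> norm (of_real (\<Sum>v\<in>N. r v) :: 'k)"
      by (simp del: of_real_sum)
    also have "of_real (\<Sum>v\<in>N. r v) = \<phi> (\<lambda>v\<in>N. x v)"
      unfolding decomp[OF xN] by (auto simp: r(1) intro!: sum.cong)
    also have "norm \<dots> \<le> 1"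
      using bound[OF xN] x(2) by (auto simp: max_norm_le_iff[OF N] intro: order_trans)
    finally show "(\<Sum>v\<in>N. vnorm (dual E) (\<psi> v)) \<le> 1 + e" by simp
  qed
  with \<psi> decomp show ?thesis by (rule that)
qed

text \<open>Linearity of \<open>\<Theta>\<close> for finite sums; the sum in the dual is the functional with the given values.\<close>

lemma dual_linear_combination:
  assumes E: "normed_space E" and \<Theta>: "\<Theta> \<in> carr (bidual E)" and "finite N"
    and "\<And>v. v \<in> N \<Longrightarrow> \<psi> v \<in> carr (dual E)"
  shows "\<exists>\<sigma>\<in>carr (dual E). (\<forall>x\<in>carr E. \<sigma> x = (\<Sum>v\<in>N. a v * \<psi> v x)) \<and> \<Theta> \<sigma> = (\<Sum>v\<in>N. a v * \<Theta> (\<psi> v))"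
  using assms(3,4)
proof induction
  case empty
  show ?case
    using zero_in_dual[OF E] linear_map_zero[OF lin_space_dual[OF E] lin_space_scalar_space dual_linear[OF \<Theta>]]
    by (intro bexI[of _ "\<lambda>x\<in>carr E. 0"]) (auto simp: restrict_def)
next
  case (insert v N)
  interpret D: lin_space "dual E" using E by (rule lin_space_dual)
  note \<Theta>D = linear_mapD[OF dual_linear[OF \<Theta>], unfolded scalar_space_simps]
  obtain \<sigma> where \<sigma>: "\<sigma> \<in> carr (dual E)" "\<And>x. x \<in> carr E \<Longrightarrow> \<sigma> x = (\<Sum>v\<in>N. a v * \<psi> v x)"
    "\<Theta> \<sigma> = (\<Sum>v\<in>N. a v * \<Theta> (\<psi> v))"
    using insert by auto
  have v: "\<psi> v \<in> carr (dual E)" using insert by simp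
  show ?case
  proof (intro bexI[of _ "vadd (dual E) \<sigma> (vsmul (dual E) (a v) (\<psi> v))"] conjI ballI)
    show "\<Theta> (vadd (dual E) \<sigma> (vsmul (dual E) (a v) (\<psi> v))) = (\<Sum>v\<in>insert v N. a v * \<Theta> (\<psi> v))"
      using \<sigma> v insert.hyps by (simp add: \<Theta>D D.smul_closed del: dual_simps)
    show "vadd (dual E) \<sigma> (vsmul (dual E) (a v) (\<psi> v)) \<in> carr (dual E)"
      using \<sigma>(1) v by (intro D.add_closed D.smul_closed)
  qed (use \<sigma> v insert.hyps in simp)
qed

text \<open>A space between \<open>E\<close> and its bidual up to isometry: \<open>d\<close> identifies \<open>X\<close> with a subspace of
  the bidual that contains the canonical image of \<open>E\<close>. The case of interest is a copy of the bidual in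
  another type.\<close>

locale within_bidual = E: normed_space E + X: normed_space X
  for E :: "('u, 'k :: real_or_complex) nspace" and X :: "('v, 'k) nspace" +
  fixes k :: "'u \<Rightarrow> 'v" and d :: "'v \<Rightarrow> ('u \<Rightarrow> 'k) \<Rightarrow> 'k"
  assumes k_linear: "linear_map E X k"
    and d_isometric: "isometric_map X (bidual E) d"
    and d_k: "x \<in> carr E \<Longrightarrow> d (k x) = canonical_embedding E x"
begin

lemma E: "normed_space E" and X: "normed_space X"
  by unfold_locales

lemma d_closed: "v \<in> carr X \<Longrightarrow> d v \<in> carr (bidual E)"
  using d_isometric by (simp add: isometric_map_def linear_map_def)

lemma d_add: "v \<in> carr X \<Longrightarrow> w \<in> carr X \<Longrightarrow> f \<in> carr (dual E) \<Longrightarrow> d (vadd X v w) f = d v f + d w f"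
  and d_smul: "v \<in> carr X \<Longrightarrow> f \<in> carr (dual E) \<Longrightarrow> d (vsmul X c v) f = c * d v f"
  using d_isometric by (auto simp: isometric_map_def linear_map_def)

lemma d_vdiff: "v \<in> carr X \<Longrightarrow> w \<in> carr X \<Longrightarrow> f \<in> carr (dual E) \<Longrightarrow> d (vdiff X v w) f = d v f - d w f"
  by (simp add: vdiff_def d_add d_smul)

lemma d_bound: "v \<in> carr X \<Longrightarrow> f \<in> carr (dual E) \<Longrightarrow> norm (d v f) \<le> vnorm X v * vnorm (dual E) f"
  using dual_bound[OF normed_space_dual[OF E] d_closed] d_isometric
  by (simp add: isometric_map_def del: dual_simps)

lemma d_separates:
  assumes "v \<in> carr X" "\<And>f. f \<in> carr (dual E) \<Longrightarrow> d v f = 0"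
  shows "v = vzero X"
proof -
  have "vnorm (bidual E) (d v) \<le> 0"
    unfolding dual_simps by (rule op_norm_le[OF normed_space_dual[OF E]]) (use assms(2) in auto)
  moreover have "vnorm (bidual E) (d v) = vnorm X v"
    using assms(1) d_isometric by (simp add: isometric_map_def)
  ultimately show ?thesis
    using X.norm_nonneg[OF assms(1)] X.norm_eq_zero[OF assms(1)] by linarith
qed

lemma k_injective: "x \<in> carr E \<Longrightarrow> k x = vzero X \<Longrightarrow> x = vzero E"
proof -
  assume x: "x \<in> carr E" "k x = vzero X"
  have "f x = 0" if f: "f \<in> carr (dual E)" for f
  proof -
    have "f x = d (k x) f" using f d_k[OF x(1)] by simp
    also have "\<dots> = d (vsmul X 0 (vzero X)) f" using x(2) by simp
    also have "\<dots> = 0" using d_smul[OF X.zero_closed f, of 0] by simp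
    finally show ?thesis .
  qed
  then show "x = vzero E" using dual_separates[OF E x(1)] by blast
qed

lemma separating_functionals_predual: "separating_functionals X ((\<lambda>f v. d v f) ` carr (dual E))"
proof (unfold_locales, goal_cases)
  case (1 g)
  then show ?case by (auto simp: linear_map_def d_add d_smul)
next
  case (2 g h a)
  then obtain p q where pq: "p \<in> carr (dual E)" "q \<in> carr (dual E)" "g = (\<lambda>v. d v p)" "h = (\<lambda>v. d v q)"
    by auto
  interpret D: lin_space "dual E" using E by (rule lin_space_dual)
  have "d v (vadd (dual E) p (vsmul (dual E) a q)) = d v p + a * d v q" if "v \<in> carr X" for v
    using pq D.smul_closed linear_mapD[OF dual_linear[OF d_closed[OF that]]]
    by (simp del: dual_simps)
  moreover have "vadd (dual E) p (vsmul (dual E) a q) \<in> carr (dual E)"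
    using pq by (intro D.add_closed D.smul_closed)
  ultimately show ?case unfolding pq(3,4) by (intro bexI[OF _ imageI]) auto
next
  case (3 v)
  then show ?case by (intro d_separates) auto
qed

text \<open>
  The candidates for a map \<open>R : X \<rightarrow> E\<close> with \<open>R k = id\<close> are the maps \<open>J + K\<close>, where \<open>K\<close> vanishes
  on \<open>k E\<close>. If none of them is as small on the finite set \<open>N\<close> as claimed, the Hahn-Banach theorem
  in \<open>E\<^sup>N\<close> separates \<open>(J v)\<^sub>v\<close> from the subspace of the \<open>(K v)\<^sub>v\<close>: there are \<open>\<psi>\<^sub>v \<in> E'\<close> with
  \<open>\<Sum>\<^sub>v \<psi>\<^sub>v (K v) = 0\<close> for all \<open>K\<close>, \<open>\<Sum>\<^sub>v \<parallel>\<psi>\<^sub>v\<parallel> \<le> 1\<close> and \<open>|\<Sum>\<^sub>v \<psi>\<^sub>v (J v)| \<ge> s\<close>. Testing with the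
  \<open>K\<close> of rank one shows that the elements \<open>T v = v - k (J v)\<close> of the bidual satisfy
  \<open>\<Sum>\<^sub>v \<langle>T v, \<psi>\<^sub>v\<rangle> = 0\<close>. Hence \<open>\<Sum>\<^sub>v \<psi>\<^sub>v (J v) = \<Sum>\<^sub>v \<langle>v, \<psi>\<^sub>v\<rangle>\<close>, which is at most \<open>r < s\<close> in modulus.
\<close>

lemma small_left_inverse_on_finite_set:
  assumes J: "linear_map X E J" "\<And>x. x \<in> carr E \<Longrightarrow> J (k x) = x"
    and N: "finite N" "N \<subseteq> carr X" "\<And>v. v \<in> N \<Longrightarrow> vnorm X v \<le> r" and rs: "0 \<le> r" "r < s"
  obtains K where "linear_map X E K" "\<And>x. x \<in> carr E \<Longrightarrow> K (k x) = vzero E"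
    "\<And>v. v \<in> N \<Longrightarrow> vnorm E (vadd E (J v) (K v)) \<le> s"
proof (rule ccontr)
  assume no: "\<not> thesis"
  define P where "P = function_space N E"
  interpret P: lin_space P unfolding P_def by (rule E.lin_space_function_space)
  define \<K> where "\<K> = {K. linear_map X E K \<and> (\<forall>x\<in>carr E. K (k x) = vzero E)}"
  define L where "L = (\<lambda>K. restrict K N) ` \<K>"
  have memP: "restrict K N \<in> carr P" if "linear_map X E K" for K
    using that N(2) by (auto simp: P_def linear_map_def)
  have L: "lin_subspace P L"
    unfolding lin_subspace_def
  proof (intro conjI ballI allI)
    show "L \<subseteq> carr P" using memP by (auto simp: L_def \<K>_def)
    have "(\<lambda>v. vzero E) \<in> \<K>" by (auto simp: \<K>_def linear_map_def)
    then show "vzero P \<in> L" by (auto simp: L_def P_def)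
    fix g h c assume "g \<in> L"
    then obtain K where K: "K \<in> \<K>" "g = restrict K N" by (auto simp: L_def)
    have "(\<lambda>v. vsmul E c (K v)) \<in> \<K>"
      using K(1) by (auto simp: \<K>_def linear_map_def E.smul_add_right simp flip: E.smul_smul)
        (simp add: mult.commute)
    moreover have "vsmul P c g = restrict (\<lambda>v. vsmul E c (K v)) N" by (auto simp: K(2) P_def)
    ultimately show "vsmul P c g \<in> L" by (auto simp: L_def)
    assume "h \<in> L"
    then obtain K' where K': "K' \<in> \<K>" "h = restrict K' N" by (auto simp: L_def)
    have "(\<lambda>v. vadd E (K v) (K' v)) \<in> \<K>"
      using K(1) K'(1) by (auto simp: \<K>_def linear_map_def E.smul_add_right E.add_ac)
    moreover have "vadd P g h = restrict (\<lambda>v. vadd E (K v) (K' v)) N" by (auto simp: K(2) K'(2) P_def)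
    ultimately show "vadd P g h \<in> L" by (auto simp: L_def)
  qed
  note max = E.seminorm_max_norm[OF N(1), folded P_def]
  define q where "q = quotient_seminorm P (max_norm N E) L"
  have q: "seminorm_on P q" unfolding q_def by (rule P.seminorm_quotient[OF max L])
  note JN = memP[OF J(1)]
  have "s \<le> q (restrict J N)"
  proof (rule ccontr)
    assume "\<not> s \<le> q (restrict J N)"
    then have "quotient_seminorm P (max_norm N E) L (restrict J N) < s" by (simp add: q_def)
    then obtain l where l: "l \<in> L" "max_norm N E (vadd P (restrict J N) l) < s"
      by (rule P.quotient_seminorm_less[OF L])
    then obtain K where K: "K \<in> \<K>" "l = restrict K N" by (auto simp: L_def)
    have "vnorm E (vadd E (J v) (K v)) \<le> s" if "v \<in> N" for v
      using norm_le_max_norm[OF N(1) that, of E "vadd P (restrict J N) l"] l(2) that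
      by (simp add: P_def K(2))
    then show False using no that K(1) by (auto simp: \<K>_def)
  qed
  obtain \<phi> where \<phi>: "linear_map P scalar_space \<phi>" "\<And>h. h \<in> carr P \<Longrightarrow> norm (\<phi> h) \<le> q h"
    "norm (\<phi> (restrict J N)) = q (restrict J N)"
    using Hahn_Banach[OF P.lin_space_axioms q JN] by blast
  have "norm (\<phi> h) \<le> max_norm N E h" if "h \<in> N \<rightarrow>\<^sub>E carr E" for h
  proof -
    have h: "h \<in> carr P" using that by (simp add: P_def)
    have "q h \<le> max_norm N E (vadd P h (vzero P))"
      unfolding q_def by (rule P.quotient_seminorm_le[OF max L h lin_subspaceD(2)[OF L]])
    then show ?thesis using \<phi>(2)[OF h] h by simp
  qed
  from functional_on_function_space[OF E N(1) \<phi>(1)[unfolded P_def] this]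
  obtain \<psi> where \<psi>: "\<And>v. v \<in> N \<Longrightarrow> \<psi> v \<in> carr (dual E)"
    "\<And>h. h \<in> N \<rightarrow>\<^sub>E carr E \<Longrightarrow> \<phi> h = (\<Sum>v\<in>N. \<psi> v (h v))"
    "(\<Sum>v\<in>N. vnorm (dual E) (\<psi> v)) \<le> 1"
    by blast
  have annihilates: "(\<Sum>v\<in>N. \<psi> v (K v)) = 0" if "K \<in> \<K>" for K
  proof -
    have KL: "restrict K N \<in> L" using that by (simp add: L_def)
    have "norm (\<phi> (restrict K N)) \<le> 0"
      using \<phi>(2)[OF lin_subspaceD(1)[OF L KL]] P.quotient_seminorm_subspace[OF max L KL]
      by (simp add: q_def)
    moreover have "restrict K N \<in> N \<rightarrow>\<^sub>E carr E" using lin_subspaceD(1)[OF L KL] by (simp add: P_def)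
    ultimately show ?thesis using \<psi>(2) by simp
  qed
  define T where "T v = vdiff X v (k (J v))" for v
  have kJ: "linear_map X X (\<lambda>v. k (J v))" using J(1) k_linear by (rule linear_map_comp)
  have T_closed: "T v \<in> carr X" if "v \<in> carr X" for v
    using that linear_mapD(1)[OF kJ] by (simp add: T_def)
  have dT: "d (T v) f = d v f - f (J v)" if "v \<in> carr X" "f \<in> carr (dual E)" for v f
    using that linear_mapD(1)[OF kJ] linear_mapD(1)[OF J(1)]
    by (simp add: T_def d_vdiff d_k)
  have rank_one: "(\<lambda>v. vsmul E (d (T v) f) y) \<in> \<K>" if f: "f \<in> carr (dual E)" and y: "y \<in> carr E" for f y
  proof -
    have "d (T (vadd X v w)) f = d (T v) f + d (T w) f" "d (T (vsmul X c v)) f = c * d (T v) f"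
      if "v \<in> carr X" "w \<in> carr X" for v w c
      using that f J(1) linear_mapD(2,3)[OF dual_linear[OF f]]
      by (simp_all add: dT d_add d_smul linear_mapD algebra_simps)
    moreover have "d (T (k x)) f = 0" if "x \<in> carr E" for x
      using that f linear_mapD(1)[OF k_linear that] by (simp add: dT d_k J(2))
    ultimately show ?thesis
      using y by (auto simp: \<K>_def linear_map_def E.smul_add_left E.smul_smul)
  qed
  have trace: "(\<Sum>v\<in>N. d (T v) f * d c (\<psi> v)) = 0" if f: "f \<in> carr (dual E)" and c: "c \<in> carr X" for f c
  proof -
    have "\<exists>\<sigma>\<in>carr (dual E). (\<forall>x\<in>carr E. \<sigma> x = (\<Sum>v\<in>N. d (T v) f * \<psi> v x)) \<and>
        d c \<sigma> = (\<Sum>v\<in>N. d (T v) f * d c (\<psi> v))"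
      by (rule dual_linear_combination[OF E d_closed[OF c] N(1) \<psi>(1)])
    then obtain \<sigma> where \<sigma>: "\<sigma> \<in> carr (dual E)"
      "\<And>x. x \<in> carr E \<Longrightarrow> \<sigma> x = (\<Sum>v\<in>N. d (T v) f * \<psi> v x)"
      "d c \<sigma> = (\<Sum>v\<in>N. d (T v) f * d c (\<psi> v))"
      by blast
    have "\<sigma> x = 0" if x: "x \<in> carr E" for x
    proof -
      have "\<sigma> x = (\<Sum>v\<in>N. \<psi> v (vsmul E (d (T v) f) x))"
        unfolding \<sigma>(2)[OF x] using linear_mapD(3)[OF dual_linear[OF \<psi>(1)] x] by (intro sum.cong) auto
      then show ?thesis using annihilates[OF rank_one[OF f x]] by simp
    qed
    then have "\<sigma> = vzero (dual E)" using \<sigma>(1) by (auto simp: mem_dual extensional_def)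
    then have "d c \<sigma> = 0"
      using linear_map_zero[OF lin_space_dual[OF E] lin_space_scalar_space dual_linear[OF d_closed[OF c]]]
      by simp
    then show ?thesis using \<sigma>(3) by simp
  qed
  \<comment> \<open>an operator of finite rank that fixes the points \<open>T v\<close> reduces the claim to the trace identity\<close>
  interpret sep: separating_functionals X "(\<lambda>f v. d v f) ` carr (dual E)"
    by (rule separating_functionals_predual)
  have "(\<Sum>v\<in>N. d (S (T v)) (\<psi> v)) = 0" if "S \<in> finite_rank X ((\<lambda>f v. d v f) ` carr (dual E))" for S
    using that
  proof induction
    case zero
    have "d (vzero X) (\<psi> v) = 0" if "v \<in> N" for v
      using d_smul[OF X.zero_closed \<psi>(1)[OF that], of 0] by simp
    then show ?case by simp
  next
    case (add S g c)
    then obtain f where f: "f \<in> carr (dual E)" "g = (\<lambda>v. d v f)" by blast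
    have "d (vadd X (S (T v)) (vsmul X (g (T v)) c)) (\<psi> v) = d (S (T v)) (\<psi> v) + d (T v) f * d c (\<psi> v)"
      if "v \<in> N" for v
      using that N(2) add.hyps(3) \<psi>(1) linear_mapD(1)[OF sep.finite_rank_linear[OF add.hyps(1)] T_closed]
      by (simp add: d_add d_smul f(2) subset_iff)
    then show ?case using add.IH trace[OF f(1) add.hyps(3)] by (simp add: sum.distrib)
  qed
  moreover obtain S where "S \<in> finite_rank X ((\<lambda>f v. d v f) ` carr (dual E))" "\<forall>w\<in>T ` N. S w = w"
    using sep.finite_rank_fixing[of "T ` N"] N T_closed by blast
  ultimately have "(\<Sum>v\<in>N. d (T v) (\<psi> v)) = 0" by fastforce
  then have "(\<Sum>v\<in>N. d v (\<psi> v)) = (\<Sum>v\<in>N. \<psi> v (J v))"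
    using N(2) \<psi>(1) by (simp add: dT subset_iff sum_subtractf)
  also have "\<dots> = \<phi> (restrict J N)"
    using \<psi>(2)[of "restrict J N"] JN by (simp add: P_def)
  finally have "norm (\<phi> (restrict J N)) = norm (\<Sum>v\<in>N. d v (\<psi> v))" by simp
  also have "\<dots> \<le> (\<Sum>v\<in>N. r * vnorm (dual E) (\<psi> v))"
  proof (rule sum_norm_le)
    fix v assume v: "v \<in> N"
    have "vnorm X v * vnorm (dual E) (\<psi> v) \<le> r * vnorm (dual E) (\<psi> v)"
      using N(3)[OF v] normed_space.norm_nonneg[OF normed_space_dual[OF E] \<psi>(1)[OF v]]
      by (intro mult_right_mono) auto
    then show "norm (d v (\<psi> v)) \<le> r * vnorm (dual E) (\<psi> v)"
      using d_bound[of v "\<psi> v"] v N(2) \<psi>(1)[OF v] by force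
  qed
  also have "\<dots> = r * (\<Sum>v\<in>N. vnorm (dual E) (\<psi> v))" by (simp add: sum_distrib_left)
  also have "\<dots> \<le> r * 1" using \<psi>(3) rs(1) by (intro mult_left_mono) auto
  finally show False using \<open>s \<le> q (restrict J N)\<close> \<phi>(3) rs(2) by simp
qed

text \<open>A bound on a sufficiently fine net of the unit ball of \<open>M\<close> is almost a bound on the whole
  ball: if \<open>R\<close> is at most \<open>1 + 2\<eta>\<close> in norm on an \<open>\<eta>\<close>-net, its operator norm \<open>\<rho>\<close> on \<open>M\<close> satisfies
  \<open>\<rho> \<le> (1 + 2\<eta>) + \<eta>\<rho>\<close>. This argument needs \<open>\<rho> < \<infinity>\<close>, which holds because \<open>M\<close> is finite
  dimensional.\<close>

theorem local_reflexivity: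
  assumes M: "M \<in> FIN X" and \<epsilon>: "\<epsilon> > 0"
  obtains R where "linear_map X E R" "\<And>x. x \<in> carr E \<Longrightarrow> R (k x) = x"
    "cont_linear (restrict_space_to X M) E R" "op_norm (restrict_space_to X M) E R \<le> 1 + \<epsilon>"
proof -
  obtain J where J: "linear_map X E J" "\<And>x. x \<in> carr E \<Longrightarrow> J (k x) = x"
    using linear_left_inverse[OF X.lin_space_axioms E.lin_space_axioms k_linear k_injective] by blast
  have subM: "lin_subspace X M" and finM: "finite_dim (restrict_space_to X M)"
    using M by (auto simp: FIN_def)
  note MX = lin_subspaceD(1)[OF subM]
  interpret M: normed_space "restrict_space_to X M" using subM by (rule X.normed_space_subspace)
  note Mn = M.normed_space_axioms
  \<comment> \<open>the solution of \<open>(1 + 2\<eta>) / (1 - \<eta>) = 1 + \<epsilon>\<close>\<close>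
  define \<eta> where "\<eta> = \<epsilon> / (3 + \<epsilon>)"
  have \<eta>: "\<eta> > 0" "\<eta> < 1" using \<epsilon> by (auto simp: \<eta>_def)
  have \<eta>\<epsilon>: "1 + 2 * \<eta> = (1 + \<epsilon>) * (1 - \<eta>)" using \<epsilon> by (simp add: \<eta>_def field_simps)
  obtain N\<^sub>0 where N0: "finite N\<^sub>0" "N\<^sub>0 \<subseteq> M"
    "\<And>x. x \<in> M \<Longrightarrow> vnorm X x \<le> 1 \<Longrightarrow> \<exists>v\<in>N\<^sub>0. vnorm X (vdiff X x v) \<le> \<eta>"
    using finite_dim_unit_ball_net[OF Mn finM \<eta>(1)] by (auto simp: vdiff_def)
  \<comment> \<open>a point of \<open>N\<^sub>0\<close> within \<open>\<eta>\<close> of the unit ball has norm at most \<open>1 + \<eta>\<close>\<close>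
  define N where "N = {v \<in> N\<^sub>0. vnorm X v \<le> 1 + \<eta>}"
  have N: "finite N" "N \<subseteq> carr X" "\<And>v. v \<in> N \<Longrightarrow> vnorm X v \<le> 1 + \<eta>"
    using N0 MX by (auto simp: N_def)
  have net: "\<exists>v\<in>N. vnorm X (vdiff X x v) \<le> \<eta>" if x: "x \<in> M" "vnorm X x \<le> 1" for x
  proof -
    obtain v where v: "v \<in> N\<^sub>0" "vnorm X (vdiff X x v) \<le> \<eta>" using N0(3)[OF x] by blast
    have [simp]: "v \<in> carr X" "x \<in> carr X" using v(1) N0(2) x MX by auto
    have "v = vadd X x (vsmul X (- 1) (vdiff X x v))"
      by (simp add: vdiff_def X.smul_add_right flip: X.smul_smul X.add_assoc)
    then have "vnorm X v \<le> vnorm X x + vnorm X (vdiff X x v)"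
      using X.norm_triangle[of x "vsmul X (- 1) (vdiff X x v)"] by (simp add: X.norm_minus_one)
    then show ?thesis using v x(2) by (auto simp: N_def)
  qed
  obtain K where K: "linear_map X E K" "\<And>x. x \<in> carr E \<Longrightarrow> K (k x) = vzero E"
    "\<And>v. v \<in> N \<Longrightarrow> vnorm E (vadd E (J v) (K v)) \<le> 1 + 2 * \<eta>"
    using small_left_inverse_on_finite_set[OF J N, of "1 + 2 * \<eta>"] \<eta> by auto
  define R where "R v = vadd E (J v) (K v)" for v
  have R: "linear_map X E R"
    using J(1) K(1) by (auto simp: linear_map_def R_def E.smul_add_right E.add_ac)
  have RM: "linear_map (restrict_space_to X M) E R"
    using R MX by (simp add: linear_map_def)
  have cont: "cont_linear (restrict_space_to X M) E R"
    by (rule finite_dim_cont_linear[OF Mn E finM RM])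
  define \<rho> where "\<rho> = op_norm (restrict_space_to X M) E R"
  have \<rho>0: "0 \<le> \<rho>" unfolding \<rho>_def by (rule op_norm_nonneg[OF Mn E cont])
  have "\<rho> \<le> (1 + 2 * \<eta>) + \<eta> * \<rho>"
    unfolding \<rho>_def[unfolded op_norm_def]
  proof (rule cSup_least)
    show "{vnorm E (R x) | x. x \<in> carr (restrict_space_to X M) \<and> vnorm (restrict_space_to X M) x \<le> 1} \<noteq> {}"
      using lin_subspaceD(2)[OF subM] by (auto intro!: exI[of _ "vzero X"])
    fix t assume "t \<in> {vnorm E (R x) | x. x \<in> carr (restrict_space_to X M) \<and> vnorm (restrict_space_to X M) x \<le> 1}"
    then obtain x where x: "t = vnorm E (R x)" "x \<in> M" "vnorm X x \<le> 1" by auto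
    obtain v where v: "v \<in> N" "vnorm X (vdiff X x v) \<le> \<eta>" using net[OF x(2,3)] by blast
    have vM: "v \<in> M" using v(1) N0(2) by (auto simp: N_def)
    note [simp] = MX[OF vM] MX[OF x(2)]
    have xv: "vdiff X x v \<in> M"
      using lin_subspaceD(3,4)[OF subM] vM x(2) by (simp add: vdiff_def)
    have "R x = R (vadd X v (vdiff X x v))" by (simp add: X.add_vdiff)
    also have "\<dots> = vadd E (R v) (R (vdiff X x v))" using R by (simp add: linear_mapD)
    also have "vnorm E \<dots> \<le> vnorm E (R v) + vnorm E (R (vdiff X x v))"
      using R by (intro E.norm_triangle) (auto simp: linear_mapD)
    also have "\<dots> \<le> (1 + 2 * \<eta>) + \<rho> * vnorm X (vdiff X x v)"
      using norm_le_op_norm[OF Mn E cont, of "vdiff X x v"] xv K(3)[OF v(1)]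
      by (intro add_mono) (simp_all add: \<rho>_def R_def)
    also have "\<dots> \<le> (1 + 2 * \<eta>) + \<rho> * \<eta>"
      using v(2) \<rho>0 by (intro add_mono mult_left_mono) auto
    finally show "t \<le> (1 + 2 * \<eta>) + \<eta> * Sup {vnorm E (R x) | x. x \<in> carr (restrict_space_to X M) \<and> vnorm (restrict_space_to X M) x \<le> 1}"
      unfolding x(1) \<rho>_def op_norm_def by (simp add: mult.commute)
  qed
  then have "\<rho> * (1 - \<eta>) \<le> (1 + \<epsilon>) * (1 - \<eta>)" using \<eta>\<epsilon> by (simp add: algebra_simps)
  then have "\<rho> \<le> 1 + \<epsilon>" using \<eta>(2) by simp
  moreover have "R (k x) = x" if "x \<in> carr E" for x using that by (simp add: R_def J(2) K(2))
  ultimately show ?thesis using that R cont by (simp add: \<rho>_def)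
qed

text \<open>The bitranspose of \<open>Q : E \<rightarrow> F\<close> takes its values in \<open>F''\<close>, which is \<open>F\<close>. So \<open>P v\<close> is the point
  of \<open>F\<close> with \<open>h (P v) = \<langle>v, h \<circ> Q\<rangle>\<close> for all \<open>h \<in> F'\<close>, and since \<open>F'\<close> separates points and norms
  \<open>F\<close>, these equations show all properties of \<open>P\<close>.\<close>

lemma extension_to_finite_dim:
  assumes F: "normed_space F" and fin: "finite_dim F" and Q: "linear_map E F Q"
    and contr: "\<And>x. x \<in> carr E \<Longrightarrow> vnorm F (Q x) \<le> vnorm E x"
  obtains P where "linear_map X F P" "\<And>v. v \<in> carr X \<Longrightarrow> vnorm F (P v) \<le> vnorm X v"
    "\<And>x. x \<in> carr E \<Longrightarrow> P (k x) = Q x"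
proof -
  interpret F: normed_space F by fact
  interpret DE: normed_space "dual E" using E by (rule normed_space_dual)
  interpret DF: normed_space "dual F" using F by (rule normed_space_dual)
  define Qt where "Qt h = (\<lambda>x\<in>carr E. h (Q x))" for h :: "_ \<Rightarrow> 'k"
  have Qt_bound: "norm (h (Q x)) \<le> vnorm (dual F) h * vnorm E x"
    if "h \<in> carr (dual F)" "x \<in> carr E" for h x
  proof -
    have "norm (h (Q x)) \<le> vnorm (dual F) h * vnorm F (Q x)"
      using that Q by (intro dual_bound[OF F]) (auto simp: linear_mapD)
    also have "\<dots> \<le> vnorm (dual F) h * vnorm E x"
      using contr[OF that(2)] DF.norm_nonneg[OF that(1)] by (intro mult_left_mono) auto
    finally show ?thesis .
  qed
  have Qt: "Qt h \<in> carr (dual E)" "vnorm (dual E) (Qt h) \<le> vnorm (dual F) h" if h: "h \<in> carr (dual F)" for h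
  proof -
    show "Qt h \<in> carr (dual E)"
      unfolding Qt_def
      using Qt_bound[OF h] by (intro dualI[OF E.lin_space_axioms linear_map_comp[OF Q dual_linear[OF h]]]) auto
    show "vnorm (dual E) (Qt h) \<le> vnorm (dual F) h"
      unfolding dual_simps(4)[of E]
      using Qt_bound[OF h] DF.norm_nonneg[OF h] by (intro op_norm_le[OF E]) (auto simp: Qt_def)
  qed
  have "\<exists>y\<in>carr F. \<forall>h\<in>carr (dual F). h y = d v (Qt h)" if v: "v \<in> carr X" for v
  proof -
    have lin: "linear_map (dual F) scalar_space (\<lambda>h. d v (Qt h))"
      unfolding linear_map_def
    proof (intro conjI ballI allI)
      fix g h c assume g: "g \<in> carr (dual F)"
      note vD = linear_mapD[OF dual_linear[OF d_closed[OF v]], unfolded scalar_space_simps]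
      have "Qt (vsmul (dual F) c g) = vsmul (dual E) c (Qt g)"
        using linear_mapD(1)[OF Q] by (auto simp: Qt_def)
      then show "d v (Qt (vsmul (dual F) c g)) = vsmul scalar_space c (d v (Qt g))"
        using vD(3)[OF Qt(1)[OF g]] by simp
      assume h: "h \<in> carr (dual F)"
      have "Qt (vadd (dual F) g h) = vadd (dual E) (Qt g) (Qt h)"
        using linear_mapD(1)[OF Q] by (auto simp: Qt_def)
      then show "d v (Qt (vadd (dual F) g h)) = vadd scalar_space (d v (Qt g)) (d v (Qt h))"
        using vD(2)[OF Qt(1)[OF g] Qt(1)[OF h]] by simp
    qed simp
    have "norm (d v (Qt h)) \<le> vnorm X v * vnorm (dual F) h" if h: "h \<in> carr (dual F)" for h
      using d_bound[OF v Qt(1)[OF h]] mult_left_mono[OF Qt(2)[OF h] X.norm_nonneg[OF v]] by linarith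
    then have "(\<lambda>h\<in>carr (dual F). d v (Qt h)) \<in> carr (bidual F)"
      by (intro dualI[OF DF.lin_space_axioms lin]) auto
    from finite_dim_reflexive[OF F fin this] show ?thesis by simp
  qed
  then obtain P where P: "\<And>v. v \<in> carr X \<Longrightarrow> P v \<in> carr F"
    "\<And>v h. v \<in> carr X \<Longrightarrow> h \<in> carr (dual F) \<Longrightarrow> h (P v) = d v (Qt h)"
    by metis
  show ?thesis
  proof (rule that[of P])
    show "linear_map X F P"
      unfolding linear_map_def
    proof (intro conjI ballI allI)
      fix v w c assume v: "v \<in> carr X"
      note h_linear = linear_mapD[OF dual_linear[of _ F], unfolded scalar_space_simps]
      show "P v \<in> carr F" using P(1) v .
      show "P (vsmul X c v) = vsmul F c (P v)"
        using v P(1)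
        by (intro dual_separates_points[OF F]) (auto simp: P(2) d_smul Qt h_linear)
      assume w: "w \<in> carr X"
      show "P (vadd X v w) = vadd F (P v) (P w)"
        using v w P(1)
        by (intro dual_separates_points[OF F]) (auto simp: P(2) d_add Qt h_linear)
    qed
    show "vnorm F (P v) \<le> vnorm X v" if v: "v \<in> carr X" for v
    proof -
      obtain h where h: "h \<in> carr (dual F)" "vnorm (dual F) h \<le> 1" "norm (h (P v)) = vnorm F (P v)"
        using norming_functional[OF F P(1)[OF v]] .
      have "vnorm F (P v) \<le> vnorm X v * vnorm (dual E) (Qt h)"
        using h d_bound[OF v Qt(1)[OF h(1)]] by (simp add: P(2)[OF v h(1)])
      also have "\<dots> \<le> vnorm X v * 1"
        using Qt(2)[OF h(1)] h(2) v by (intro mult_left_mono) auto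
      finally show ?thesis by simp
    qed
    show "P (k x) = Q x" if x: "x \<in> carr E" for x
    proof (rule dual_separates_points[OF F])
      fix h assume h: "h \<in> carr (dual F)"
      have "h (P (k x)) = Qt h x"
        using linear_mapD(1)[OF k_linear x] Qt(1)[OF h] by (simp add: P(2)[OF _ h] d_k[OF x])
      then show "h (P (k x)) = h (Q x)" using x by (simp add: Qt_def)
    qed (use x P(1) linear_mapD(1)[OF k_linear x] linear_mapD(1)[OF Q x] in auto)
  qed
qed

end


section \<open>Functoriality of the symmetric tensor power\<close>

lemma tensor_power_simps [simp]:
  "vadd (tensor_power n V) = (\<lambda>z w. \<lambda>\<phi>\<in>multilinear_forms n V. z \<phi> + w \<phi>)"
  "vzero (tensor_power n V) = (\<lambda>\<phi>\<in>multilinear_forms n V. 0)"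
  "vsmul (tensor_power n V) = (\<lambda>c z. \<lambda>\<phi>\<in>multilinear_forms n V. c * z \<phi>)"
  by (simp_all add: tensor_power_def functionals_on_forms_def)

lemma lincomb_tensor_extensional:
  "lincomb (tensor_power n V) R \<in> extensional (multilinear_forms n V)"
  by (cases "(tensor_power n V, R)" rule: lincomb.cases) auto

lemma lincomb_tensor_apply:
  "\<phi> \<in> multilinear_forms n V \<Longrightarrow>
    lincomb (tensor_power n V) R \<phi> = (\<Sum>(c, z)\<leftarrow>R. c * z \<phi>)"
  by (induction R) auto

lemma sym_tensors_extensional:
  "z \<in> sym_tensors n V \<Longrightarrow> z \<in> extensional (multilinear_forms n V)"
  unfolding sym_tensors_def using lincomb_tensor_extensional by (auto elim!: lspanE)

lemma tuples_update: "xs \<in> tuples n V \<Longrightarrow> x \<in> carr V \<Longrightarrow> xs[i := x] \<in> tuples n V"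
  using set_update_subset_insert[of xs i x] by (auto simp: tuples_def)

lemma tuples_map: "linear_map V W T \<Longrightarrow> xs \<in> tuples n V \<Longrightarrow> map T xs \<in> tuples n W"
  by (auto simp: tuples_def linear_map_def)

lemma multilinear_forms_pullback:
  assumes V: "lin_space V" and T: "linear_map V W T" and \<psi>: "\<psi> \<in> multilinear_forms n W"
  shows "(\<lambda>xs\<in>tuples n V. \<psi> (map T xs)) \<in> multilinear_forms n V"
proof -
  interpret V: lin_space V by fact
  have \<psi>_add: "\<psi> (ys[i := vadd W x y]) = \<psi> (ys[i := x]) + \<psi> (ys[i := y])"
    if "ys \<in> tuples n W" "i < n" "x \<in> carr W" "y \<in> carr W" for ys i x y
    using \<psi> that by (auto simp: multilinear_forms_def)
  have \<psi>_smul: "\<psi> (ys[i := vsmul W c x]) = c * \<psi> (ys[i := x])"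
    if "ys \<in> tuples n W" "i < n" "x \<in> carr W" for ys i x c
    using \<psi> that by (auto simp: multilinear_forms_def)
  show ?thesis
    unfolding multilinear_forms_def
    using tuples_map[OF T] linear_mapD[OF T]
    by (auto simp: tuples_update map_update \<psi>_add \<psi>_smul)
qed

text \<open>Functoriality is a matter of algebra. It is applied to left inverses of the canonical embedding,
  which are unbounded in general.\<close>

lemma sym_map_comp:
  assumes "lin_space F" "linear_map E F T" "linear_map F G S"
  shows "sym_map n F G S (sym_map n E F T z) = sym_map n E G (\<lambda>x. S (T x)) z"
proof -
  have "sym_map n E F T z (\<lambda>ys\<in>tuples n F. \<psi> (map S ys)) = z (\<lambda>xs\<in>tuples n E. \<psi> (map (\<lambda>x. S (T x)) xs))"
    if "\<psi> \<in> multilinear_forms n G" for \<psi>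
  proof -
    have "(\<lambda>xs\<in>tuples n E. (\<lambda>ys\<in>tuples n F. \<psi> (map S ys)) (map T xs)) =
        (\<lambda>xs\<in>tuples n E. \<psi> (map (\<lambda>x. S (T x)) xs))"
      using tuples_map[OF assms(2)] by (intro restrict_ext) (simp add: comp_def)
    then show ?thesis
      using multilinear_forms_pullback[OF assms(1,3) that] by (simp add: sym_map_def)
  qed
  then show ?thesis
    unfolding sym_map_def[of n F G] sym_map_def[of n E G] by (intro restrict_ext)
qed

lemma sym_map_cong:
  assumes "\<And>x. x \<in> carr E \<Longrightarrow> T x = T' x"
  shows "sym_map n E F T z = sym_map n E F T' z"
proof -
  have map_eq: "map T xs = map T' xs" if "xs \<in> tuples n E" for xs
    using that assms by (auto simp: tuples_def)
  have eq: "(\<lambda>xs\<in>tuples n E. \<psi> (map T xs)) = (\<lambda>xs\<in>tuples n E. \<psi> (map T' xs))" for \<psi>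
    by (intro restrict_ext arg_cong[of _ _ \<psi>] map_eq)
  show ?thesis
    unfolding sym_map_def by (rule restrict_ext, rule arg_cong[of _ _ z], rule eq)
qed

lemma sym_map_id:
  assumes "z \<in> sym_tensors n E"
  shows "sym_map n E E (\<lambda>x. x) z = z"
proof -
  have id: "restrict \<psi> (tuples n E) = \<psi>" if "\<psi> \<in> multilinear_forms n E" for \<psi>
    using that by (simp add: multilinear_forms_def extensional_restrict)
  show ?thesis
    using sym_tensors_extensional[OF assms]
    by (intro extensionalityI[of _ "multilinear_forms n E"]) (simp_all add: sym_map_def id)
qed

lemma (in lin_space) lincomb_subspace:
  "lincomb (V\<lparr>carr := M\<rparr>) R = lincomb V R"
  by (induction R) auto

text \<open>A symmetric tensor involves only finitely many vectors and lives over their span.\<close>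

lemma sym_tensor_over_finite_dim:
  assumes X: "normed_space X" and z: "z \<in> sym_tensors n X"
  obtains M w where "M \<in> FIN X" "w \<in> sym_tensors n (restrict_space_to X M)"
    "sym_map n (restrict_space_to X M) X (\<lambda>x. x) w = z"
proof -
  interpret X: normed_space X by fact
  obtain R where R: "snd ` set R \<subseteq> diag_tensor n X ` carr X" "z = lincomb (tensor_power n X) R"
    using z unfolding sym_tensors_def by (rule lspanE)
  obtain B where B: "B \<subseteq> carr X" "finite B" "snd ` set R = diag_tensor n X ` B"
    using finite_subset_image[OF _ R(1)] by auto
  define M where "M = lspan X B"
  have sub: "lin_subspace X M" unfolding M_def by (rule X.lin_subspace_lspan[OF B(1)])
  have BM: "B \<subseteq> M" unfolding M_def by (rule X.subset_lspan[OF B(1)])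
  have lin: "linear_map (restrict_space_to X M) X (\<lambda>x. x)"
    using lin_subspaceD(1)[OF sub] by (simp add: linear_map_def)
  have "lspan (restrict_space_to X M) B = M"
    by (simp add: lspan_def X.lincomb_subspace M_def)
  then have FIN: "M \<in> FIN X"
    using sub B(2) BM by (auto simp: FIN_def finite_dim_def)
  define g where "g t = (SOME x. x \<in> B \<and> diag_tensor n X x = t)" for t
  have g: "g t \<in> B" "diag_tensor n X (g t) = t" if "t \<in> snd ` set R" for t
    using someI_ex[of "\<lambda>x. x \<in> B \<and> diag_tensor n X x = t"] that B(3) by (auto simp: g_def)
  define R' where "R' = map (\<lambda>(c, t). (c, diag_tensor n (restrict_space_to X M) (g t))) R"
  define w where "w = lincomb (tensor_power n (restrict_space_to X M)) R'"
  have w: "w \<in> sym_tensors n (restrict_space_to X M)"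
    unfolding sym_tensors_def w_def
    by (rule lspanI[OF _ refl]) (use g BM in \<open>force simp: R'_def\<close>)
  have "sym_map n (restrict_space_to X M) X (\<lambda>x. x) w \<psi> = z \<psi>" if \<psi>: "\<psi> \<in> multilinear_forms n X" for \<psi>
  proof -
    let ?\<psi> = "\<lambda>xs\<in>tuples n (restrict_space_to X M). \<psi> (map (\<lambda>x. x) xs)"
    have \<psi>': "?\<psi> \<in> multilinear_forms n (restrict_space_to X M)"
      using multilinear_forms_pullback[OF X.lin_space_subspace[OF sub] lin \<psi>] .
    have "diag_tensor n (restrict_space_to X M) (g t) ?\<psi> = t \<psi>" if "t \<in> snd ` set R" for t
    proof -
      have "diag_tensor n (restrict_space_to X M) (g t) ?\<psi> = diag_tensor n X (g t) \<psi>"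
        using \<psi> \<psi>' g(1)[OF that] BM by (auto simp: diag_tensor_def elementary_tensor_def tuples_def)
      then show ?thesis using g(2)[OF that] by simp
    qed
    then have diag: "\<And>c t. (c, t) \<in> set R \<Longrightarrow> diag_tensor n (restrict_space_to X M) (g t) ?\<psi> = t \<psi>"
      by (metis image_eqI snd_conv)
    have "sym_map n (restrict_space_to X M) X (\<lambda>x. x) w \<psi> = w ?\<psi>"
      using \<psi> by (simp only: sym_map_def restrict_apply if_True)
    also have "\<dots> = (\<Sum>(c, t)\<leftarrow>R'. c * t ?\<psi>)"
      unfolding w_def by (rule lincomb_tensor_apply[OF \<psi>'])
    also have "\<dots> = (\<Sum>(c, t)\<leftarrow>R. c * diag_tensor n (restrict_space_to X M) (g t) ?\<psi>)"
      by (simp only: R'_def map_map comp_def case_prod_unfold fst_conv snd_conv)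
    also have "\<dots> = (\<Sum>(c, t)\<leftarrow>R. c * t \<psi>)"
      by (rule arg_cong[of _ _ sum_list], rule map_cong[OF refl]) (auto simp only: diag split: prod.split)
    also have "\<dots> = z \<psi>"
      unfolding R(2) by (rule lincomb_tensor_apply[OF \<psi>, symmetric])
    finally show ?thesis .
  qed
  then have "sym_map n (restrict_space_to X M) X (\<lambda>x. x) w = z"
    using sym_tensors_extensional[OF z]
    by (intro extensionalityI[of _ "multilinear_forms n X"]) (auto simp: sym_map_def)
  with FIN w show ?thesis by (rule that)
qed

lemma s_tensor_norm_bound:
  assumes \<alpha>: "s_tensor_norm n \<alpha>" and E: "normed_space E" and F: "normed_space F"
    and T: "cont_linear E F T" and C: "op_norm E F T \<le> C" and z: "z \<in> sym_tensors n E"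
  shows "sym_map n E F T z \<in> sym_tensors n F" "\<alpha> F (sym_map n E F T z) \<le> C ^ n * \<alpha> E z"
proof -
  let ?E = "sym_tensor_space n \<alpha> E" and ?F = "sym_tensor_space n \<alpha> F"
  have n: "normed_space ?E" "normed_space ?F"
    and cont: "cont_linear ?E ?F (sym_map n E F T)"
    and le: "op_norm ?E ?F (sym_map n E F T) \<le> op_norm E F T ^ n"
    using \<alpha> E F T unfolding s_tensor_norm_def by blast+
  have z': "z \<in> carr ?E" using z by (simp add: sym_tensor_space_def)
  show "sym_map n E F T z \<in> sym_tensors n F"
    using linear_mapD(1)[OF cont_linear_linear[OF cont] z'] by (simp add: sym_tensor_space_def)
  have "op_norm E F T ^ n \<le> C ^ n" using C op_norm_nonneg[OF E F T] by (rule power_mono)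
  then have "op_norm ?E ?F (sym_map n E F T) * vnorm ?E z \<le> C ^ n * vnorm ?E z"
    using le normed_space.norm_nonneg[OF n(1) z'] by (intro mult_right_mono) auto
  then show "\<alpha> F (sym_map n E F T z) \<le> C ^ n * \<alpha> E z"
    using norm_le_op_norm[OF n cont z'] by (simp add: sym_tensor_space_def)
qed


section \<open>The embedding lemma\<close>

lemma (in within_bidual) k_contraction:
  assumes "x \<in> carr E"
  shows "vnorm X (k x) \<le> vnorm E x"
  using canonical_embedding(2)[OF E assms] d_isometric linear_mapD(1)[OF k_linear assms] d_k[OF assms]
  by (metis isometric_map_def)

lemma (in within_bidual) op_norm_k: "cont_linear E X k" "op_norm E X k \<le> 1"
proof -
  show "cont_linear E X k" using k_linear k_contraction by (rule cont_linear_contraction)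
  show "op_norm E X k \<le> 1" by (rule op_norm_le[OF E]) (use k_contraction in auto)
qed

text \<open>The map \<open>R\<close> of the local reflexivity theorem is defined on all of \<open>X\<close>, so the multilinear
  forms on \<open>E\<close> can be pulled back to \<open>X\<close>. This is why the equality of \<open>w\<close> and the image of \<open>z\<close> as
  tensors over \<open>X\<close> is enough to conclude that \<open>\<otimes>R\<close> takes \<open>w\<close> to \<open>z\<close>; the vectors in \<open>z\<close> may lie
  outside of \<open>M\<close>.\<close>

lemma finitely_generated_le_bidual:
  fixes \<alpha> :: "('u, 'k :: real_or_complex) tnorm"
  assumes wb: "within_bidual E X k d" and \<alpha>: "s_tensor_norm n \<alpha>" and fg: "finitely_generated n \<alpha>"
    and z: "z \<in> sym_tensors n E"
  shows "\<alpha> E z \<le> \<alpha> X (sym_map n E X k z)"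
proof -
  interpret within_bidual E X k d by (rule wb)
  define z' where "z' = sym_map n E X k z"
  define A where "A = {\<alpha> (restrict_space_to X M) w | M w. M \<in> FIN X \<and>
    w \<in> sym_tensors n (restrict_space_to X M) \<and> sym_map n (restrict_space_to X M) X (\<lambda>x. x) w = z'}"
  have z': "z' \<in> sym_tensors n X"
    unfolding z'_def by (rule s_tensor_norm_bound(1)[OF \<alpha> E X op_norm_k z])
  have "\<alpha> E z \<le> \<alpha> (restrict_space_to X M) w"
    if M: "M \<in> FIN X" and w: "w \<in> sym_tensors n (restrict_space_to X M)"
      and wz: "sym_map n (restrict_space_to X M) X (\<lambda>x. x) w = z'" for M w
  proof -
    have sub: "lin_subspace X M" using M by (simp add: FIN_def)
    have incl: "linear_map (restrict_space_to X M) X (\<lambda>x. x)"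
      using lin_subspaceD(1)[OF sub] by (simp add: linear_map_def)
    have le: "\<alpha> E z \<le> (1 + \<epsilon>) ^ n * \<alpha> (restrict_space_to X M) w" if "\<epsilon> > 0" for \<epsilon>
    proof -
      obtain R where R: "linear_map X E R" "\<And>x. x \<in> carr E \<Longrightarrow> R (k x) = x"
        "cont_linear (restrict_space_to X M) E R" "op_norm (restrict_space_to X M) E R \<le> 1 + \<epsilon>"
        using local_reflexivity[OF M \<open>\<epsilon> > 0\<close>] by blast
      have "sym_map n (restrict_space_to X M) E R w = sym_map n X E R z'"
        unfolding wz[symmetric] by (rule sym_map_comp[OF X.lin_space_axioms incl R(1), symmetric])
      also have "\<dots> = sym_map n E E (\<lambda>x. R (k x)) z"
        unfolding z'_def by (rule sym_map_comp[OF X.lin_space_axioms k_linear R(1)])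
      also have "\<dots> = sym_map n E E (\<lambda>x. x) z" using R(2) by (rule sym_map_cong)
      also have "\<dots> = z" using z by (rule sym_map_id)
      finally show ?thesis
        using s_tensor_norm_bound(2)[OF \<alpha> X.normed_space_subspace[OF sub] E R(3,4) w] by simp
    qed
    have "((\<lambda>\<epsilon>. (1 + \<epsilon>) ^ n * \<alpha> (restrict_space_to X M) w) \<longlongrightarrow> (1 + 0) ^ n * \<alpha> (restrict_space_to X M) w)
        (at_right (0 :: real))"
      by (intro tendsto_intros)
    moreover have "\<forall>\<^sub>F \<epsilon> in at_right 0. \<alpha> E z \<le> (1 + \<epsilon>) ^ n * \<alpha> (restrict_space_to X M) w"
      using eventually_at_right_less[of 0] by eventually_elim (rule le)
    ultimately have "\<alpha> E z \<le> (1 + 0) ^ n * \<alpha> (restrict_space_to X M) w"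
      by (rule tendsto_lowerbound) simp
    then show ?thesis by simp
  qed
  \<comment> \<open>otherwise the infimum would be an unspecified number\<close>
  moreover have "A \<noteq> {}"
    by (rule sym_tensor_over_finite_dim[OF X z']) (auto simp: A_def)
  ultimately have "\<alpha> E z \<le> Inf A"
    by (intro cInf_greatest) (auto simp: A_def)
  also have "Inf A = \<alpha> X z'"
    using fg X z' unfolding finitely_generated_def A_def by simp
  finally show ?thesis by (simp add: z'_def)
qed

text \<open>The supremum in the definition of a cofinitely generated norm is taken over a nonempty set.\<close>

lemma carrier_in_COFIN:
  assumes "normed_space E"
  shows "carr E \<in> COFIN E"
proof -
  interpret E: normed_space E by fact
  have L: "lin_subspace E (carr E)" by (simp add: lin_subspace_def)
  have "coset_of E (carr E) x = carr E" if "x \<in> carr E" for x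
    using E.coset_absorb[OF L E.zero_closed, of x] that by (simp add: E.coset_zero[OF L])
  then have "carr (quotient_space E (carr E)) = (\<lambda>x. carr E) ` carr E"
    unfolding quotient_space_def by (simp cong: image_cong)
  moreover have "carr E \<noteq> {}" using E.zero_closed by blast
  ultimately have "carr (quotient_space E (carr E)) = {carr E}"
    by (simp only: image_constant_conv if_False)
  moreover have "lspan (quotient_space E (carr E)) {} = {carr E}"
    by (auto simp: lspan_def quotient_space_def intro!: exI[of _ "[]"])
  ultimately have "finite_dim (quotient_space E (carr E))"
    unfolding finite_dim_def by (intro exI[of _ "{}"]) simp
  with L show ?thesis by (simp add: COFIN_def closed_in_space_def)
qed

lemma cofinitely_generated_le_bidual:
  fixes \<alpha> :: "('u, 'k :: real_or_complex) tnorm"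
  assumes wb: "within_bidual E X k d" and \<alpha>: "s_tensor_norm n \<alpha>" and cg: "cofinitely_generated n \<alpha>"
    and z: "z \<in> sym_tensors n E"
  shows "\<alpha> E z \<le> \<alpha> X (sym_map n E X k z)"
proof -
  interpret within_bidual E X k d by (rule wb)
  have z': "sym_map n E X k z \<in> sym_tensors n X"
    by (rule s_tensor_norm_bound(1)[OF \<alpha> E X op_norm_k z])
  have le: "\<alpha> (quotient_copy E L) (sym_map n E (quotient_copy E L) (quotient_map E L) z) \<le> \<alpha> X (sym_map n E X k z)"
    if "L \<in> COFIN E" for L
  proof -
    have L: "lin_subspace E L" "closed_in_space E L" "finite_dim (quotient_space E L)"
      using that by (auto simp: COFIN_def)
    note Q = E.quotient_copy[OF L(1,2)]
    let ?F = "quotient_copy E L"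
    obtain P where P: "linear_map X ?F P" "\<And>v. v \<in> carr X \<Longrightarrow> vnorm ?F (P v) \<le> vnorm X v"
      "\<And>x. x \<in> carr E \<Longrightarrow> P (k x) = quotient_map E L x"
      using extension_to_finite_dim[OF Q(1) Q(4)[OF L(3)] Q(2,3)] by blast
    have "sym_map n E ?F (quotient_map E L) z = sym_map n E ?F (\<lambda>x. P (k x)) z"
      using P(3) by (intro sym_map_cong) simp
    also have "\<dots> = sym_map n X ?F P (sym_map n E X k z)"
      by (rule sym_map_comp[OF X.lin_space_axioms k_linear P(1), symmetric])
    finally have eq: "sym_map n E ?F (quotient_map E L) z = sym_map n X ?F P (sym_map n E X k z)" .
    have "\<alpha> ?F (sym_map n X ?F P (sym_map n E X k z)) \<le> 1 ^ n * \<alpha> X (sym_map n E X k z)"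
      by (rule s_tensor_norm_bound(2)[OF \<alpha> X Q(1) cont_linear_contraction[OF P(1,2)] _ z'])
        (use P(2) in \<open>auto intro!: op_norm_le[OF X]\<close>)
    then show ?thesis by (simp add: eq)
  qed
  have "\<alpha> E z = Sup {\<alpha> (quotient_copy E L) (sym_map n E (quotient_copy E L) (quotient_map E L) z)
      | L. L \<in> COFIN E}"
    using cg E z unfolding cofinitely_generated_def by blast
  also have "\<dots> \<le> \<alpha> X (sym_map n E X k z)"
    using le carrier_in_COFIN[OF E] by (intro cSup_least) auto
  finally show ?thesis .
qed

theorem lemma2p6:
  fixes n :: nat
    and \<alpha> :: "('u, 'k :: real_or_complex) tnorm"
    and E :: "('u, 'k) nspace"
    and e :: "(('u \<Rightarrow> 'k) \<Rightarrow> 'k) \<Rightarrow> 'u"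
  assumes "s_tensor_norm n \<alpha>"
    and "finitely_generated n \<alpha> \<or> cofinitely_generated n \<alpha>"
    and "normed_space E"
    and "inj_on e (carr (bidual E))"
  shows "isometric_map (sym_tensor_space n \<alpha> E)
           (sym_tensor_space n \<alpha> (copy_along e (bidual E)))
           (sym_map n E (copy_along e (bidual E)) (e \<circ> canonical_embedding E))"
proof -
  define X where "X = copy_along e (bidual E)"
  define k where "k = e \<circ> canonical_embedding E"
  define d where "d = inv_into (carr (bidual E)) e"
  have bidual: "normed_space (bidual E)"
    using assms(3) by (intro normed_space_dual)
  note d_e = inv_into_f_f[OF assms(4), folded d_def]
  have e: "isometric_map (bidual E) X e"
    unfolding X_def by (rule isometric_map_copy_along[OF bidual assms(4)])
  have \<kappa>: "linear_map E (bidual E) (canonical_embedding E)"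
    by (rule canonical_embedding(1)[OF assms(3)])
  have wb: "within_bidual E X k d"
  proof (intro within_bidual.intro within_bidual_axioms.intro assms(3))
    show "normed_space X"
      unfolding X_def by (rule normed_space_copy_along[OF bidual assms(4)])
    show "linear_map E X k"
      using e \<kappa> by (simp add: k_def isometric_map_def linear_map_def)
    have "carr X = e ` carr (bidual E)" by (simp add: X_def copy_along_def Let_def)
    moreover have "vadd X (e u) (e v) = e (vadd (bidual E) u v)" "vsmul X c (e u) = e (vsmul (bidual E) c u)"
      "vnorm X (e u) = vnorm (bidual E) u" if "u \<in> carr (bidual E)" "v \<in> carr (bidual E)" for u v c
      using e that by (auto simp: isometric_map_def linear_map_def)
    ultimately show "isometric_map X (bidual E) d"
      using lin_space_of_normed[OF bidual]
      by (auto simp: isometric_map_def linear_map_def d_e lin_space.add_closed lin_space.smul_closed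
          simp del: dual_simps)
    show "d (k x) = canonical_embedding E x" if "x \<in> carr E" for x
      using linear_mapD(1)[OF \<kappa> that] by (simp add: k_def d_e)
  qed
  interpret within_bidual E X k d by (rule wb)
  have "linear_map (sym_tensor_space n \<alpha> E) (sym_tensor_space n \<alpha> X) (sym_map n E X k)"
    using assms(1) E X op_norm_k(1) unfolding s_tensor_norm_def by (blast intro: cont_linear_linear)
  moreover have "\<alpha> X (sym_map n E X k z) = \<alpha> E z" if z: "z \<in> sym_tensors n E" for z
  proof (rule antisym)
    show "\<alpha> X (sym_map n E X k z) \<le> \<alpha> E z"
      using s_tensor_norm_bound(2)[OF assms(1) E X op_norm_k z] by simp
    show "\<alpha> E z \<le> \<alpha> X (sym_map n E X k z)"
      using assms(2) finitely_generated_le_bidual[OF wb assms(1) _ z]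
        cofinitely_generated_le_bidual[OF wb assms(1) _ z] by blast
  qed
  ultimately show ?thesis
    unfolding X_def k_def by (simp add: isometric_map_def sym_tensor_space_def)
qed

end
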